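(* Let $r,s,t,n'$ be non-negative integers satisfying $n'\le 2(r+s)-3$. Then every local orthogonal pair $F=(\phi,\psi)$ from $\mathbb P^{r,s,t}$ to $\mathbb P^{n',0}$ is either quasi-standard or null.
   Context: For non-negative integers $r,s,t$, let $\mathbb C^{r,s,t}$ be $\mathbb C^{r+s+t}$ equipped with the (possibly indefinite and degenerate) Hermitian form $\langle z,w\rangle_{r,s,t}:=z_1\bar w_1+\cdots+z_r\bar w_r-z_{r+1}\bar w_{r+1}-\cdots-z_{r+s}\bar w_{r+s}$, and let $\mathbb P^{r,s,t}:=\mathbb P\mathbb C^{r,s,t}$ be its projectivization (the space of lines in $\mathbb C^{r+s+t}$). When $t=0$ write $\mathbb C^{r,s}$, $\mathbb P^{r,s}$; thus $\mathbb P^{n',0}$ is the projectivization of $\mathbb C^{n'}$ with the positive definite standard form. For points $p,q$ of $\mathbb P^{r,s,t}$ write $p\perp q$ if representing vectors have $\langle\cdot,\cdot\rangle_{r,s,t}$ equal to $0$. Local orthogonal pair: let $\phi,\psi$ be two holomorphic maps from an open set $U\subset\mathbb P^{r,s,t}$ into $\mathbb P^{r',s',t'}$. The pair $(\phi,\psi)$ is an orthogonal pair, also called a local orthogonal pair from $\mathbb P^{r,s,t}$ to $\mathbb P^{r',s',t'}$, if $\phi(z)\perp\psi(w)$ for all $z,w\in U$ with $z\perp w$. Null: $(\phi,\psi)$ is null if $\phi(z)\perp\psi(w)$ for all $z,w$ in the domain of definition. Standard: $(\phi,\psi)$ is a standard pair if it is induced by a linear conformal pair, i.e. by linear maps $\Phi,\Psi:\mathbb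 C^{r,s,t}\to\mathbb C^{r',s',t'}$ such that for some $\lambda\in\mathbb R^*$, $\langle\Phi(z),\Psi(w)\rangle_{r',s',t'}=\lambda\langle z,w\rangle_{r,s,t}$ for all $z,w\in\mathbb C^{r,s,t}$. For maps into $\mathbb PV$ with $V$ a linear subspace of $\mathbb C^{r',s',t'}$, the same notions are used with the form restricted to $V$. Quasi-standard: $(\phi,\psi)$ is quasi-standard if there exists an orthogonal decomposition $\mathbb C^{r',s',t'}=V\oplus W$ such that one of the following occurs: (1) the image of $\phi$ or of $\psi$ is contained in $\mathbb PV$ and $(\pi^V\circ\phi,\pi^V\circ\psi)$ is standard; (2) $(\pi^V\circ\phi,\pi^V\circ\psi)$ is standard and $(\pi^W\circ\phi,\pi^W\circ\psi)$ is null. Here $\pi^V,\pi^W$ are the (rational) projections from $\mathbb P^{r',s',t'}$ to $\mathbb PV$ and $\mathbb PW$ induced by the orthogonal projections $\mathbb C^{r',s',t'}\to V$ and $\mathbb C^{r',s',t'}\to W$.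
   Formalization: The open set U on which the local orthogonal pair is defined is additionally assumed to be connected and to contain at least one pair of points z, w with z ⊥ w; without either assumption the claim fails. *)

theory Defs
  imports "HOL-Analysis.Analysis"
begin

text \<open>
  Coordinates are indexed by finite types. A signature is given by disjoint sets
  \<open>P\<close> and \<open>N\<close> of indices with coefficient 1 and -1; all remaining indices span the
  degenerate part. Thus \<open>\<complex>\<^bsup>r,s,t\<^esup>\<close> is \<open>complex ^ 'n\<close> with \<open>herm_form P N\<close>, where
  \<open>card P = r\<close>, \<open>card N = s\<close> and \<open>CARD('n) = r + s + t\<close>.
\<close>

definition herm_form :: "'n::finite set \<Rightarrow> 'n set \<Rightarrow> complex ^ 'n \<Rightarrow> complex ^ 'n \<Rightarrow> complex" where
  "herm_form P N z w = (\<Sum>i\<in>P. z $ i * cnj (w $ i)) - (\<Sum>i\<in>N. z $ i * cnj (w $ i))"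

text \<open>
  Since types are nonempty, a space of dimension possibly 0 is represented as a coordinate
  subspace: \<open>coord_space Q\<close> is a copy of \<open>\<complex>\<^sup>k\<close> for \<open>k = card Q\<close>.
\<close>

definition coord_space :: "'m::finite set \<Rightarrow> (complex ^ 'm) set" where
  "coord_space Q = {v. \<forall>i. i \<notin> Q \<longrightarrow> v $ i = 0}"

text \<open>Points of a projective space are complex lines, as sets of vectors.\<close>

definition proj_space :: "(complex ^ 'n::finite) set \<Rightarrow> (complex ^ 'n) set set" where
  "proj_space E = {vec.span {v} | v. v \<in> E \<and> v \<noteq> 0}"

text \<open>The quotient topology with respect to \<open>z \<mapsto> vec.span {z}\<close> on the nonzero vectors.\<close>

definition proj_topology :: "(complex ^ 'n::finite) set topology" where
  "proj_topology =
     topology (\<lambda>U. U \<subseteq> proj_space UNIV \<and> open {z. z \<noteq> 0 \<and> vec.span {z} \<in> U})"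

lemma openin_proj_topology:
  "openin proj_topology U \<longleftrightarrow>
     U \<subseteq> proj_space UNIV \<and> open {z. z \<noteq> 0 \<and> vec.span {z} \<in> (U :: (complex ^ 'n::finite) set set)}"
proof -
  let ?pre = "\<lambda>U. {z :: complex ^ 'n. z \<noteq> 0 \<and> vec.span {z} \<in> U}"
  have "istopology (\<lambda>U. U \<subseteq> proj_space UNIV \<and> open (?pre U))"
    unfolding istopology_def
  proof (intro conjI allI impI)
    fix S T :: "(complex ^ 'n) set set"
    assume S: "S \<subseteq> proj_space UNIV \<and> open (?pre S)" and T: "T \<subseteq> proj_space UNIV \<and> open (?pre T)"
    show "S \<inter> T \<subseteq> proj_space UNIV" using S by blast
    have "?pre (S \<inter> T) = ?pre S \<inter> ?pre T" by blast
    then show "open (?pre (S \<inter> T))" using S T by (simp add: open_Int)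
  next
    fix K :: "(complex ^ 'n) set set set"
    assume K: "\<forall>S\<in>K. S \<subseteq> proj_space UNIV \<and> open (?pre S)"
    show "\<Union>K \<subseteq> proj_space UNIV" using K by blast
    have "?pre (\<Union>K) = (\<Union>S\<in>K. ?pre S)" by blast
    moreover have "open (\<Union>S\<in>K. ?pre S)" using K by (intro open_UN) blast
    ultimately show "open (?pre (\<Union>K))" by simp
  qed
  then show ?thesis
    unfolding proj_topology_def by (simp add: topology_inverse')
qed

lemma quotient_map_proj_topology:
  "quotient_map (top_of_set (- {0 :: complex ^ 'n::finite})) proj_topology (\<lambda>z. vec.span {z})"
proof -
  have top: "topspace proj_topology = (proj_space UNIV :: (complex ^ 'n) set set)"
  proof (rule antisym)
    show "topspace proj_topology \<subseteq> (proj_space UNIV :: (complex ^ 'n) set set)"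
      using openin_topspace openin_proj_topology by blast
    have "{z :: complex ^ 'n. z \<noteq> 0 \<and> vec.span {z} \<in> proj_space UNIV} = - {0}"
      by (auto simp: proj_space_def)
    then have "openin proj_topology (proj_space UNIV :: (complex ^ 'n) set set)"
      by (simp add: openin_proj_topology open_Compl)
    then show "(proj_space UNIV :: (complex ^ 'n) set set) \<subseteq> topspace proj_topology"
      by (rule openin_subset)
  qed
  have "{x. x \<in> - {0 :: complex ^ 'n} \<and> vec.span {x} \<in> U} = {z. z \<noteq> 0 \<and> vec.span {z} \<in> U}" for U
    by auto
  then show ?thesis
    unfolding quotient_map_def top
    by (auto simp: openin_proj_topology openin_open_eq open_Compl proj_space_def)
qed

text \<open>Holomorphy in several variables: complex differentiability (used for open \<open>D\<close>).\<close>

definition holomorphic_vec_on ::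
    "(complex ^ 'n::finite \<Rightarrow> complex ^ 'm::finite) \<Rightarrow> (complex ^ 'n) set \<Rightarrow> bool" where
  "holomorphic_vec_on f D \<longleftrightarrow>
     (\<forall>z\<in>D. \<exists>A. Vector_Spaces.linear (*s) (*s) A \<and> (f has_derivative A) (at z))"

text \<open>
  Holomorphic maps of an open \<open>U\<close> into \<open>proj_space E\<close>: in homogeneous coordinates the map is
  locally given by a nowhere vanishing holomorphic map.
\<close>

definition holomorphic_proj_map ::
    "(complex ^ 'm::finite) set \<Rightarrow> (complex ^ 'n::finite) set set
      \<Rightarrow> ((complex ^ 'n) set \<Rightarrow> (complex ^ 'm) set) \<Rightarrow> bool" where
  "holomorphic_proj_map E U \<phi> \<longleftrightarrow>
     \<phi> ` U \<subseteq> proj_space E \<and>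
     (\<forall>z. z \<noteq> 0 \<and> vec.span {z} \<in> U \<longrightarrow>
        (\<exists>D f. open D \<and> z \<in> D \<and> holomorphic_vec_on f D \<and>
           (\<forall>x\<in>D. x \<noteq> 0 \<and> vec.span {x} \<in> U \<and> f x \<noteq> 0 \<and> \<phi> (vec.span {x}) = vec.span {f x})))"

definition perp ::
    "(complex ^ 'n::finite \<Rightarrow> complex ^ 'n \<Rightarrow> complex) \<Rightarrow> (complex ^ 'n) set \<Rightarrow> (complex ^ 'n) set \<Rightarrow> bool"
  where "perp B p q \<longleftrightarrow> (\<forall>v\<in>p. \<forall>w\<in>q. B v w = 0)"

text \<open>
  Below, \<open>B\<close> is the form on the source, and the target is \<open>proj_space E\<close> with the form \<open>B'\<close>.
\<close>

definition orthogonal_pair ::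
    "(complex ^ 'n::finite \<Rightarrow> complex ^ 'n \<Rightarrow> complex)
      \<Rightarrow> (complex ^ 'm::finite) set \<Rightarrow> (complex ^ 'm \<Rightarrow> complex ^ 'm \<Rightarrow> complex)
      \<Rightarrow> (complex ^ 'n) set set
      \<Rightarrow> ((complex ^ 'n) set \<Rightarrow> (complex ^ 'm) set) \<Rightarrow> ((complex ^ 'n) set \<Rightarrow> (complex ^ 'm) set) \<Rightarrow> bool"
  where
  "orthogonal_pair B E B' U \<phi> \<psi> \<longleftrightarrow>
     openin proj_topology U \<and> holomorphic_proj_map E U \<phi> \<and> holomorphic_proj_map E U \<psi> \<and>
     (\<forall>p\<in>U. \<forall>q\<in>U. perp B p q \<longrightarrow> perp B' (\<phi> p) (\<psi> q))"

text \<open>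
  Rational maps on \<open>U\<close>, such as the composition of a map with a linear projection, are represented
  by functions whose value is \<open>{0}\<close> at the points where they are undefined.
\<close>

definition def_domain ::
    "(complex ^ 'n::finite) set set \<Rightarrow> ((complex ^ 'n) set \<Rightarrow> (complex ^ 'm::finite) set)
      \<Rightarrow> (complex ^ 'n) set set" where
  "def_domain U \<phi> = {p\<in>U. \<phi> p \<noteq> {0}}"

definition null_pair ::
    "(complex ^ 'm::finite \<Rightarrow> complex ^ 'm \<Rightarrow> complex) \<Rightarrow> (complex ^ 'n::finite) set set
      \<Rightarrow> ((complex ^ 'n) set \<Rightarrow> (complex ^ 'm) set) \<Rightarrow> ((complex ^ 'n) set \<Rightarrow> (complex ^ 'm) set) \<Rightarrow> bool"
  where
  "null_pair B' U \<phi> \<psi> \<longleftrightarrow> (\<forall>p\<in>def_domain U \<phi>. \<forall>q\<in>def_domain U \<psi>. perp B' (\<phi> p) (\<psi> q))"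

text \<open>
  The rational maps \<open>\<phi>\<close> and \<open>[f]\<close> agree wherever both are defined. The first conjunct excludes
  the vacuous case, in particular that \<open>\<phi>\<close> is nowhere defined.
\<close>

definition induced_by ::
    "(complex ^ 'n::finite) set set \<Rightarrow> ((complex ^ 'n) set \<Rightarrow> (complex ^ 'm::finite) set)
      \<Rightarrow> (complex ^ 'n \<Rightarrow> complex ^ 'm) \<Rightarrow> bool" where
  "induced_by U \<phi> f \<longleftrightarrow>
     (\<exists>p\<in>def_domain U \<phi>. f ` p \<noteq> {0}) \<and>
     (\<forall>p\<in>def_domain U \<phi>. f ` p \<noteq> {0} \<longrightarrow> \<phi> p = f ` p)"

definition standard_pair ::
    "(complex ^ 'n::finite \<Rightarrow> complex ^ 'n \<Rightarrow> complex)
      \<Rightarrow> (complex ^ 'm::finite) set \<Rightarrow> (complex ^ 'm \<Rightarrow> complex ^ 'm \<Rightarrow> complex)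
      \<Rightarrow> (complex ^ 'n) set set
      \<Rightarrow> ((complex ^ 'n) set \<Rightarrow> (complex ^ 'm) set) \<Rightarrow> ((complex ^ 'n) set \<Rightarrow> (complex ^ 'm) set) \<Rightarrow> bool"
  where
  "standard_pair B V B' U \<phi> \<psi> \<longleftrightarrow>
     (\<exists>f g. \<exists>c::real.
        Vector_Spaces.linear (*s) (*s) f \<and> range f \<subseteq> V \<and>
        Vector_Spaces.linear (*s) (*s) g \<and> range g \<subseteq> V \<and>
        c \<noteq> 0 \<and> (\<forall>z w. B' (f z) (g w) = of_real c * B z w) \<and>
        induced_by U \<phi> f \<and> induced_by U \<psi> g)"

definition orthogonal_decomposition ::
    "(complex ^ 'm::finite \<Rightarrow> complex ^ 'm \<Rightarrow> complex) \<Rightarrow> (complex ^ 'm) set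
      \<Rightarrow> (complex ^ 'm) set \<Rightarrow> (complex ^ 'm) set \<Rightarrow> bool" where
  "orthogonal_decomposition B' E V W \<longleftrightarrow>
     vec.subspace V \<and> vec.subspace W \<and> V \<inter> W = {0} \<and> E = {v + w | v w. v \<in> V \<and> w \<in> W} \<and>
     (\<forall>v\<in>V. \<forall>w\<in>W. B' v w = 0)"

text \<open>The projection of \<open>V \<oplus> W\<close> onto \<open>V\<close> along \<open>W\<close>.\<close>

definition proj_along :: "(complex ^ 'm::finite) set \<Rightarrow> (complex ^ 'm) set \<Rightarrow> complex ^ 'm \<Rightarrow> complex ^ 'm"
  where "proj_along V W x = (THE v. v \<in> V \<and> x - v \<in> W)"

definition quasi_standard_pair ::
    "(complex ^ 'n::finite \<Rightarrow> complex ^ 'n \<Rightarrow> complex)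
      \<Rightarrow> (complex ^ 'm::finite) set \<Rightarrow> (complex ^ 'm \<Rightarrow> complex ^ 'm \<Rightarrow> complex)
      \<Rightarrow> (complex ^ 'n) set set
      \<Rightarrow> ((complex ^ 'n) set \<Rightarrow> (complex ^ 'm) set) \<Rightarrow> ((complex ^ 'n) set \<Rightarrow> (complex ^ 'm) set) \<Rightarrow> bool"
  where
  "quasi_standard_pair B E B' U \<phi> \<psi> \<longleftrightarrow>
     (\<exists>V W. orthogonal_decomposition B' E V W \<and>
        ((\<phi> ` U \<subseteq> proj_space V \<or> \<psi> ` U \<subseteq> proj_space V) \<and>
           standard_pair B V B' U (\<lambda>p. proj_along V W ` \<phi> p) (\<lambda>p. proj_along V W ` \<psi> p)
         \<or> standard_pair B V B' U (\<lambda>p. proj_along V W ` \<phi> p) (\<lambda>p. proj_along V W ` \<psi> p) \<and>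
           null_pair B' U (\<lambda>p. proj_along W V ` \<phi> p) (\<lambda>p. proj_along W V ` \<psi> p)))"

end

(*
  Near a pair of orthogonal points write phi = [F], psi = [G] and H(z,w) = <F z, G w>. Then H vanishes
  wherever B(z,w) = 0. With m = r + s, take a flag L_1 < L_2 < ... < L_{m-1} of subspaces spanned by points
  near the base point, L_{m-1} orthogonal to some w. The span of F(L_{m-1}) is orthogonal to G w, so it
  has dimension at most n' - 1 <= 2m - 4; hence some step L_k < L_{k+1} = L_k + C u increases the dimension
  of the span by at most one, that is, F maps L_{k+1} to a line modulo the span of F(L_k), which is
  orthogonal to G(xi) for xi orthogonal to L_k. So the 2x2 minors of H on L_{k+1} x L_k^perp vanish.

  If dF also pairs to zero with G at all orthogonal pairs, the same count applies to F together with its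
  derivatives and forces H = 0: the pair is null. Otherwise dF(z)(u) pairs with G(w) as a nonzero multiple
  of B(u,w) when z and w are orthogonal, and the minors show that H = p(z) q(w) B(z,w). After rescaling,
  <F,G> = B, and linear algebra in the span of F and the span of G, each taken modulo the part orthogonal
  to the other, yields case (2) of quasi-standardness. Everything extends from the open set to U by the
  identity theorem along complex lines.
*)

theory Submission
  imports Defs "HOL-Complex_Analysis.Conformal_Mappings"
begin

text \<open>The bound on \<open>n'\<close> is where the count tips: one dimension from the first
  point and two from each of the m - 2 later ones would make 2m - 3, more than the 2m - 4 at most
  that are orthogonal to G w. The obstacle is that the maps live on small open sets and that
  vanishing minors on a single flag say little. So the step is taken at a length where growth by two
  fails for every flag in the given domain at once. Independence of the values already found
  survives a perturbation, so the minors vanish for all flags near a fixed one, and flags may then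
  be varied and differentiated. The radical of the source form is handled by measuring flags after
  applying its Gram matrix \<sigma>. Identities are propagated one argument at a time, since H is
  holomorphic in z and antiholomorphic in w. The scalars p and q carry no regularity: they are
  absorbed in the choice of lifts, and what is extended to \<open>U\<close> are equations
  homogeneous in the lifts.\<close>

section \<open>The standard Hermitian product, to which the forms on source and target are
  reduced\<close>

definition hdot :: "complex ^ 'n::finite \<Rightarrow> complex ^ 'n \<Rightarrow> complex" where
  "hdot x y = (\<Sum>i\<in>UNIV. x $ i * cnj (y $ i))"

lemma hdot_simps [simp]:
  "hdot (x + y) z = hdot x z + hdot y z" "hdot (x - y) z = hdot x z - hdot y z"
  "hdot z (x + y) = hdot z x + hdot z y" "hdot z (x - y) = hdot z x - hdot z y"
  "hdot (c *s x) z = c * hdot x z" "hdot z (c *s x) = cnj c * hdot z x"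
  "hdot 0 z = 0" "hdot z 0 = 0"
  by (simp_all add: hdot_def algebra_simps sum.distrib sum_subtractf sum_distrib_left)

lemma scaleR_eq_smult: "r *\<^sub>R (x :: complex ^ 'n) = complex_of_real r *s x"
  by (simp add: vec_eq_iff) (simp add: scaleR_conv_of_real)

lemma hdot_scaleR [simp]: "hdot (r *\<^sub>R x) y = r *\<^sub>R hdot x y" "hdot x (r *\<^sub>R y) = r *\<^sub>R hdot x y"
  by (simp_all add: scaleR_eq_smult scaleR_conv_of_real)

lemma hdot_sum: "hdot (sum f A) y = (\<Sum>i\<in>A. hdot (f i) y)" "hdot y (sum f A) = (\<Sum>i\<in>A. hdot y (f i))"
  by (induction A rule: infinite_finite_induct) auto

lemma component_eq_hdot: "(y :: complex ^ 'n::finite) $ i = hdot y (axis i 1)"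
  by (simp add: hdot_def axis_def if_distrib cong: if_cong)

lemma hdot_commute: "hdot y x = cnj (hdot x y)"
  by (simp add: hdot_def mult.commute)

lemma hdot_eq_0_commute: "hdot y x = 0 \<longleftrightarrow> hdot x y = 0"
  by (metis hdot_commute complex_cnj_zero_iff)

lemma Re_hdot: "Re (hdot x y) = x \<bullet> y"
  by (simp add: hdot_def inner_vec_def inner_complex_def)

lemma hdot_self: "hdot x x = of_real ((norm x)\<^sup>2)"
proof -
  have "Im (hdot x x) = 0" by (simp add: hdot_def)
  moreover have "Re (hdot x x) = (norm x)\<^sup>2" by (simp add: Re_hdot power2_norm_eq_inner)
  ultimately show ?thesis by (simp add: complex_eq_iff)
qed

lemma hdot_self_eq_0 [simp]: "hdot x x = 0 \<longleftrightarrow> x = 0"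
  by (simp add: hdot_self)

lemma norm_smult: "norm (c *s (x :: complex ^ 'n::finite)) = cmod c * norm x"
proof -
  have "complex_of_real ((norm (c *s x))\<^sup>2) = of_real ((cmod c * norm x)\<^sup>2)"
    unfolding hdot_self[symmetric] power_mult_distrib of_real_mult complex_norm_square
    by (simp add: mult_ac complex_norm_square[symmetric])
  then have "(norm (c *s x))\<^sup>2 = (cmod c * norm x)\<^sup>2" using of_real_eq_iff by blast
  then show ?thesis by (simp add: power2_eq_iff_nonneg)
qed

text \<open>Multiplying \<open>x\<close> by a unimodular \<open>c\<close> makes the product real and
  non-negative, where it equals a real inner product and the real inequality applies.\<close>

lemma norm_hdot_le: "cmod (hdot x y) \<le> norm x * norm y"
proof (cases "hdot x y = 0")
  case False
  define c where "c = cnj (hdot x y) / cmod (hdot x y)"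
  have "cmod c = 1" using False by (simp add: c_def norm_divide)
  have "c * hdot x y = cmod (hdot x y)"
    using False by (simp add: c_def mult.commute complex_norm_square[symmetric] power2_eq_square)
  then have "cmod (hdot x y) = Re (hdot (c *s x) y)" by simp
  also have "\<dots> \<le> norm (c *s x) * norm y" unfolding Re_hdot by (rule norm_cauchy_schwarz)
  finally show ?thesis by (simp add: norm_smult \<open>cmod c = 1\<close>)
qed simp

lemma bounded_bilinear_hdot: "bounded_bilinear hdot"
  by (standard) (auto intro!: exI[of _ 1] norm_hdot_le)

lemmas continuous_on_hdot [continuous_intros] = bounded_bilinear.continuous_on[OF bounded_bilinear_hdot]
lemmas tendsto_hdot [tendsto_intros] = bounded_bilinear.tendsto[OF bounded_bilinear_hdot]

lemma continuous_on_smult [continuous_intros]: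
  fixes f :: "'a::topological_space \<Rightarrow> complex" and g :: "'a \<Rightarrow> complex ^ 'n::finite"
  assumes "continuous_on S f" "continuous_on S g"
  shows "continuous_on S (\<lambda>x. f x *s g x)"
proof -
  have "continuous_on S (\<lambda>x. \<chi> i. f x * g x $ i)"
    using assms by (intro continuous_on_vec_lambda continuous_intros)
  then show ?thesis by (simp add: vector_scalar_mult_def)
qed

lemma complex_linear_bounded_linear:
  fixes f :: "complex ^ 'n::finite \<Rightarrow> complex ^ 'm::finite"
  assumes "Vector_Spaces.linear (*s) (*s) f"
  shows "bounded_linear f"
proof -
  have "linear f"
    by (rule linearI) (simp_all add: scaleR_eq_smult vec.linear_add[OF assms] vec.linear_scale[OF assms])
  then show ?thesis by (rule linear_conv_bounded_linear[THEN iffD1])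
qed

text \<open>The real orthogonal decomposition is already Hermitian: with \<open>w\<close> also
  \<open>\<i> *s w\<close> lies in \<open>S\<close>, and real orthogonality to both kills the real
  and the imaginary part of \<open>hdot z w\<close>.\<close>

lemma hermitian_decomposition:
  fixes x :: "complex ^ 'n::finite"
  assumes "vec.subspace S"
  obtains y z where "y \<in> S" "\<And>w. w \<in> S \<Longrightarrow> hdot z w = 0" "x = y + z"
proof -
  have sub: "subspace S"
    using assms unfolding subspace_def scaleR_eq_smult
    by (auto intro: vec.subspace_0 vec.subspace_add vec.subspace_scale)
  then obtain y z where yz: "y \<in> span S" "\<And>w. w \<in> span S \<Longrightarrow> orthogonal z w" "x = y + z"
    using orthogonal_subspace_decomp_exists[of S x] by blast
  have span: "span S = S" using sub by simp
  have "hdot z w = 0" if "w \<in> S" for w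
  proof -
    have "Re (hdot z w) = 0" using yz(2)[of w] that span by (simp add: Re_hdot orthogonal_def)
    moreover have "Re (hdot z (\<i> *s w)) = 0"
      using yz(2)[of "\<i> *s w"] span vec.subspace_scale[OF assms that] unfolding Re_hdot orthogonal_def by simp
    ultimately show ?thesis by (simp add: complex_eq_iff)
  qed
  then show thesis using that yz span by blast
qed

section \<open>Linear independence and its stability under perturbation\<close>

text \<open>Families instead of sets, so that independence is an open condition on the members.\<close>

definition indep_family :: "nat \<Rightarrow> (nat \<Rightarrow> complex ^ 'n::finite) \<Rightarrow> bool" where
  "indep_family k x \<longleftrightarrow> (\<forall>c. (\<Sum>i<k. c i *s x i) = 0 \<longrightarrow> (\<forall>i<k. c i = 0))"

lemma indep_familyD: "indep_family k x \<Longrightarrow> (\<Sum>i<k. c i *s x i) = 0 \<Longrightarrow> i < k \<Longrightarrow> c i = 0"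
  unfolding indep_family_def by blast

lemma indep_family_cong: "(\<And>i. i < k \<Longrightarrow> x i = y i) \<Longrightarrow> indep_family k x \<longleftrightarrow> indep_family k y"
  unfolding indep_family_def by (metis (no_types, lifting) lessThan_iff sum.cong)

lemma in_span_family:
  fixes x :: "nat \<Rightarrow> complex ^ 'n::finite"
  shows "y \<in> vec.span (x ` {..<k}) \<longleftrightarrow> (\<exists>c. y = (\<Sum>i<k. c i *s x i))"
proof
  assume "y \<in> vec.span (x ` {..<k})"
  then show "\<exists>c. y = (\<Sum>i<k. c i *s x i)"
  proof (induction rule: vec.span_induct_alt)
    case base
    show ?case by (rule exI[of _ "\<lambda>_. 0"]) simp
  next
    case (step c z y)
    then obtain j d where j: "j < k" "z = x j" and d: "y = (\<Sum>i<k. d i *s x i)" by auto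
    have "(\<Sum>i<k. (d i + (if i = j then c else 0)) *s x i) = (\<Sum>i<k. d i *s x i) + (\<Sum>i<k. if i = j then c *s x i else 0)"
      unfolding sum.distrib[symmetric] by (intro sum.cong) (auto simp: vec.scale_left_distrib)
    also have "\<dots> = c *s z + y" using j d by simp
    finally show ?case by (intro exI) (rule sym)
  qed
next
  assume "\<exists>c. y = (\<Sum>i<k. c i *s x i)"
  then show "y \<in> vec.span (x ` {..<k})"
    by (elim exE, hypsubst, intro vec.span_sum vec.span_scale vec.span_base imageI)
qed

lemma indep_family_Suc:
  "indep_family (Suc k) x \<longleftrightarrow> indep_family k x \<and> x k \<notin> vec.span (x ` {..<k})"
proof
  assume ind: "indep_family (Suc k) x"
  have "indep_family k x"
    unfolding indep_family_def
  proof (intro allI impI)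
    fix c i assume c: "(\<Sum>i<k. c i *s x i) = 0" "i < k"
    have "(\<Sum>i<Suc k. (if i < k then c i else 0) *s x i) = 0" using c by simp
    from indep_familyD[OF ind this, of i] c show "c i = 0" by simp
  qed
  moreover have "x k \<notin> vec.span (x ` {..<k})"
  proof
    assume "x k \<in> vec.span (x ` {..<k})"
    then obtain c where c: "x k = (\<Sum>i<k. c i *s x i)" unfolding in_span_family by blast
    have "(\<Sum>i<Suc k. (if i < k then c i else - 1) *s x i) = 0" using c by simp
    from indep_familyD[OF ind this, of k] show False by simp
  qed
  ultimately show "indep_family k x \<and> x k \<notin> vec.span (x ` {..<k})" by blast
next
  assume *: "indep_family k x \<and> x k \<notin> vec.span (x ` {..<k})"
  show "indep_family (Suc k) x"
    unfolding indep_family_def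
  proof (intro allI impI)
    fix c i assume c: "(\<Sum>i<Suc k. c i *s x i) = 0" "i < Suc k"
    have "c k = 0"
    proof (rule ccontr)
      assume ck: "c k \<noteq> 0"
      have "c k *s x k = - (\<Sum>i<k. c i *s x i)" using c(1) by (simp add: add.commute eq_neg_iff_add_eq_0)
      then have "c k *s x k \<in> vec.span (x ` {..<k})"
        by (simp only:) (intro vec.span_neg vec.span_sum vec.span_scale vec.span_base imageI)
      then have "inverse (c k) *s (c k *s x k) \<in> vec.span (x ` {..<k})" by (rule vec.span_scale)
      then show False using * ck by simp
    qed
    then show "c i = 0" using c * indep_familyD[of k x c i] by (cases "i = k") auto
  qed
qed

lemma indep_family_independent:
  "indep_family k x \<Longrightarrow> vec.independent (x ` {..<k}) \<and> card (x ` {..<k}) = k"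
proof (induction k)
  case (Suc k)
  then have *: "vec.independent (x ` {..<k})" "card (x ` {..<k}) = k" "x k \<notin> vec.span (x ` {..<k})"
    by (auto simp: indep_family_Suc)
  then have "x k \<notin> x ` {..<k}" using vec.span_base[of "x k" "x ` {..<k}"] by argo
  then show ?case using * by (simp add: lessThan_Suc vec.independent_insert)
qed (simp add: vec.independent_empty)

lemma indep_family_le_card:
  assumes "indep_family k x" "\<And>i. i < k \<Longrightarrow> x i \<in> vec.span B" "finite B"
  shows "k \<le> card B"
  using vec.independent_span_bound[of B "x ` {..<k}"] indep_family_independent[OF assms(1)] assms(2,3)
  by auto

text \<open>The vector \<open>y\<close> is the component of \<open>x j\<close> orthogonal to the
  other members, normalised; independence makes this component nonzero.\<close>

lemma indep_family_dual:
  assumes "indep_family k x" "j < k"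
  obtains y where "\<And>i. i < k \<Longrightarrow> hdot (x i) y = (if i = j then 1 else 0)"
proof -
  let ?S = "vec.span (x ` ({..<k} - {j}))"
  obtain p r where pr: "p \<in> ?S" "\<And>w. w \<in> ?S \<Longrightarrow> hdot r w = 0" "x j = p + r"
    using hermitian_decomposition[of ?S "x j"] by auto
  have "r \<noteq> 0"
  proof
    assume "r = 0"
    then have "x j \<in> ?S" using pr by simp
    \<comment> \<open>\<open>in_span_family\<close> speaks of initial segments of indices, so the
      omitted member is replaced by 0.\<close>
    moreover have "x ` ({..<k} - {j}) \<subseteq> (\<lambda>i. if i = j then 0 else x i) ` {..<k}" by force
    ultimately have "x j \<in> vec.span ((\<lambda>i. if i = j then 0 else x i) ` {..<k})"
      using vec.span_mono by blast
    then obtain c where "x j = (\<Sum>i<k. c i *s (if i = j then 0 else x i))"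
      unfolding in_span_family by blast
    then have "x j = (\<Sum>i\<in>{..<k}-{j}. c i *s x i)"
      using assms(2) by (simp add: sum.remove[of _ j])
    then have "(\<Sum>i<k. (if i = j then - 1 else c i) *s x i) = 0"
      using assms(2) by (simp add: sum.remove[of _ j])
    from indep_familyD[OF assms(1) this assms(2)] show False by simp
  qed
  define y where "y = (1 / hdot r r) *s r"
  have cn: "cnj (hdot r r) = hdot r r" by (simp add: hdot_self)
  have "hdot (x i) y = (if i = j then 1 else 0)" if "i < k" for i
  proof (cases "i = j")
    case True
    have "hdot p r = 0" using pr(1,2) hdot_eq_0_commute by blast
    then show ?thesis using True pr(3) \<open>r \<noteq> 0\<close> cn by (simp add: y_def)
  next
    case False
    then have "x i \<in> ?S" using that by (auto intro: vec.span_base)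
    then have "hdot (x i) r = 0" using pr(2) hdot_eq_0_commute by blast
    then show ?thesis using False by (simp add: y_def)
  qed
  then show thesis using that by blast
qed

text \<open>Dual vectors read off each coefficient, which bounds all coefficients by
  \<open>K\<close> times the norm of the combination. Moving every member by less than
  \<open>1 / (2 * K)\<close> costs at most half of that estimate.\<close>

lemma indep_family_bound:
  assumes "indep_family k x"
  obtains \<gamma> \<delta> where "\<gamma> > 0" "\<delta> > 0"
    "\<And>x' c. (\<And>i. i < k \<Longrightarrow> dist (x' i) (x i) < \<delta>) \<Longrightarrow> \<gamma> * (\<Sum>i<k. cmod (c i)) \<le> norm (\<Sum>i<k. c i *s x' i)"
proof -
  have "\<forall>j. \<exists>y. j < k \<longrightarrow> (\<forall>i<k. hdot (x i) y = (if i = j then 1 else 0))"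
    using indep_family_dual[OF assms] by metis
  then obtain y where y: "\<And>j i. j < k \<Longrightarrow> i < k \<Longrightarrow> hdot (x i) (y j) = (if i = j then 1 else 0)"
    by metis
  define K where "K = (\<Sum>j<k. norm (y j)) + 1"
  have "K \<ge> 1" by (simp add: K_def sum_nonneg)
  have base: "(\<Sum>i<k. cmod (c i)) \<le> K * norm (\<Sum>i<k. c i *s x i)" for c
  proof -
    have "cmod (c j) \<le> norm (\<Sum>i<k. c i *s x i) * norm (y j)" if "j < k" for j
    proof -
      have "hdot (\<Sum>i<k. c i *s x i) (y j) = (\<Sum>i<k. if i = j then c i else 0)"
        unfolding hdot_sum using y that by (intro sum.cong) auto
      also have "\<dots> = c j" using that by simp
      finally show ?thesis using norm_hdot_le by metis
    qed
    then have "(\<Sum>i<k. cmod (c i)) \<le> (\<Sum>j<k. norm (\<Sum>i<k. c i *s x i) * norm (y j))"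
      by (intro sum_mono) auto
    also have "\<dots> \<le> K * norm (\<Sum>i<k. c i *s x i)"
      by (simp add: K_def sum_distrib_left[symmetric] algebra_simps sum_distrib_right[symmetric])
    finally show ?thesis .
  qed
  show thesis
  proof (rule that[of "1 / (2 * K)" "1 / (2 * K)"])
    fix x' c assume x': "\<And>i. i < k \<Longrightarrow> dist (x' i) (x i) < 1 / (2 * K)"
    have "norm (\<Sum>i<k. c i *s (x' i - x i)) \<le> (\<Sum>i<k. cmod (c i) * (1 / (2 * K)))"
      using x' by (intro sum_norm_le) (unfold norm_smult, rule mult_left_mono, auto simp: dist_norm intro: less_imp_le)
    moreover have "(\<Sum>i<k. c i *s x' i) = (\<Sum>i<k. c i *s x i) + (\<Sum>i<k. c i *s (x' i - x i))"
      by (simp add: sum.distrib[symmetric] vec.scale_right_distrib[symmetric])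
    then have "norm (\<Sum>i<k. c i *s x i) \<le> norm (\<Sum>i<k. c i *s x' i) + norm (\<Sum>i<k. c i *s (x' i - x i))"
      using norm_triangle_ineq4[of "\<Sum>i<k. c i *s x' i" "\<Sum>i<k. c i *s (x' i - x i)"] by simp
    moreover have "(1 / K) * (\<Sum>i<k. cmod (c i)) \<le> norm (\<Sum>i<k. c i *s x i)"
      using base[of c] \<open>K \<ge> 1\<close> by (simp add: field_simps)
    moreover have "(1 / K) * (\<Sum>i<k. cmod (c i)) = 2 * (1 / (2 * K) * (\<Sum>i<k. cmod (c i)))"
      using \<open>K \<ge> 1\<close> by (simp add: field_simps)
    ultimately show "1 / (2 * K) * (\<Sum>i<k. cmod (c i)) \<le> norm (\<Sum>i<k. c i *s x' i)"
      unfolding sum_distrib_left[symmetric] mult.commute[of _ "1 / (2 * K)"] by linarith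
  qed (use \<open>K \<ge> 1\<close> in auto)
qed

lemma indep_family_perturb:
  assumes "indep_family k x"
  obtains \<delta> where "\<delta> > 0" "\<And>x'. (\<And>i. i < k \<Longrightarrow> dist (x' i) (x i) < \<delta>) \<Longrightarrow> indep_family k x'"
proof -
  obtain \<gamma> \<delta> where *: "\<gamma> > 0" "\<delta> > 0"
    "\<And>x' c. (\<And>i. i < k \<Longrightarrow> dist (x' i) (x i) < \<delta>) \<Longrightarrow> \<gamma> * (\<Sum>i<k. cmod (c i)) \<le> norm (\<Sum>i<k. c i *s x' i)"
    using indep_family_bound[OF assms] by blast
  show thesis
  proof (rule that[OF *(2)])
    fix x' assume x': "\<And>i. i < k \<Longrightarrow> dist (x' i) (x i) < \<delta>"
    show "indep_family k x'"
      unfolding indep_family_def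
    proof (intro allI impI)
      fix c i assume "(\<Sum>i<k. c i *s x' i) = 0" "i < k"
      then have "(\<Sum>i<k. cmod (c i)) \<le> 0" using *(3)[OF x', of c] *(1) by (simp add: mult_le_0_iff)
      then have "(\<Sum>i<k. cmod (c i)) = 0" by (simp add: sum_nonneg order_antisym)
      then show "c i = 0" using \<open>i < k\<close> by (simp add: sum_nonneg_eq_0_iff)
    qed
  qed
qed

text \<open>\<open>w'\<close> is \<open>w\<close> minus its projection to the span of \<open>x'\<close>, which is small.\<close>

lemma orthogonal_perturb:
  fixes x :: "nat \<Rightarrow> complex ^ 'n::finite"
  assumes "indep_family k x" "\<And>i. i < k \<Longrightarrow> hdot (x i) w = 0" "\<epsilon> > 0"
  obtains \<delta> where "\<delta> > 0"
    "\<And>x'. (\<And>i. i < k \<Longrightarrow> dist (x' i) (x i) < \<delta>) \<Longrightarrow> \<exists>w'. dist w' w < \<epsilon> \<and> (\<forall>i<k. hdot (x' i) w' = 0)"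
proof -
  obtain \<gamma> \<delta> where *: "\<gamma> > 0" "\<delta> > 0"
    "\<And>x' c. (\<And>i. i < k \<Longrightarrow> dist (x' i) (x i) < \<delta>) \<Longrightarrow> \<gamma> * (\<Sum>i<k. cmod (c i)) \<le> norm (\<Sum>i<k. c i *s x' i)"
    using indep_family_bound[OF assms(1)] by blast
  \<comment> \<open>Chosen so that the bound \<open>\<eta> * norm w / \<gamma>\<close> for the
    projection \<open>p\<close>, obtained below, is at most \<open>\<epsilon> / 2\<close>; the
    summand 1 covers \<open>w = 0\<close>.\<close>
  define \<eta> where "\<eta> = min \<delta> (\<epsilon> * \<gamma> / (2 * (norm w + 1)))"
  have "\<eta> > 0" using * assms(3) by (simp add: \<eta>_def add_nonneg_pos)
  show thesis
  proof (rule that[OF \<open>\<eta> > 0\<close>])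
    fix x' assume x': "\<And>i. i < k \<Longrightarrow> dist (x' i) (x i) < \<eta>"
    let ?S = "vec.span (x' ` {..<k})"
    obtain p r where pr: "p \<in> ?S" "\<And>z. z \<in> ?S \<Longrightarrow> hdot r z = 0" "w = p + r"
      using hermitian_decomposition[of ?S w] by auto
    obtain c where c: "p = (\<Sum>i<k. c i *s x' i)" using pr(1) in_span_family by blast
    have b: "\<gamma> * (\<Sum>i<k. cmod (c i)) \<le> norm p"
      unfolding c using x' by (intro *(3)) (auto simp: \<eta>_def)
    have "hdot p r = 0" using pr(1,2) hdot_eq_0_commute by blast
    \<comment> \<open>Since \<open>w\<close> is orthogonal to the unperturbed members, only the
      differences \<open>x' i - x i\<close> pair with it. This is what makes \<open>p\<close>
      small.\<close>
    then have "hdot p p = hdot p w" using pr(3) by simp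
    also have "\<dots> = (\<Sum>i<k. c i * hdot (x' i - x i) w)"
      using assms(2) by (simp add: c hdot_sum)
    finally have "cmod (hdot p p) = cmod (\<Sum>i<k. c i * hdot (x' i - x i) w)" by simp
    also have "\<dots> \<le> (\<Sum>i<k. cmod (c i) * (\<eta> * norm w))"
    proof (rule sum_norm_le)
      fix i assume "i \<in> {..<k}"
      then have "norm (x' i - x i) \<le> \<eta>" using x'[of i] by (simp add: dist_norm)
      then have "cmod (hdot (x' i - x i) w) \<le> \<eta> * norm w"
        by (rule order_trans[OF norm_hdot_le mult_right_mono]) simp
      then show "cmod (c i * hdot (x' i - x i) w) \<le> cmod (c i) * (\<eta> * norm w)"
        by (simp add: norm_mult mult_left_mono)
    qed
    finally have "cmod (hdot p p) \<le> (\<Sum>i<k. cmod (c i) * (\<eta> * norm w))" .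
    then have "(norm p)\<^sup>2 \<le> (\<Sum>i<k. cmod (c i)) * (\<eta> * norm w)"
      unfolding hdot_self sum_distrib_right norm_of_real by simp
    also have "\<dots> \<le> (norm p / \<gamma>) * (\<eta> * norm w)"
      using b *(1) \<open>\<eta> > 0\<close> by (intro mult_right_mono) (auto simp: field_simps)
    finally have "norm p * norm p \<le> norm p * (\<eta> * norm w / \<gamma>)" by (simp add: power2_eq_square)
    then have "norm p \<le> \<eta> * norm w / \<gamma> \<or> norm p = 0"
      by (metis mult_le_cancel_left_pos norm_ge_zero order_le_less)
    moreover have "\<eta> * norm w / \<gamma> \<le> \<epsilon> / 2"
    proof -
      have "0 < 2 * (norm w + 1)" by (simp add: add_nonneg_pos)
      moreover have "\<eta> \<le> \<epsilon> * \<gamma> / (2 * (norm w + 1))" by (simp add: \<eta>_def)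
      ultimately have "\<eta> * (2 * (norm w + 1)) \<le> \<epsilon> * \<gamma>" by (simp only: pos_le_divide_eq)
      then show ?thesis using *(1) \<open>\<eta> > 0\<close> by (simp add: field_simps)
    qed
    ultimately have "norm p < \<epsilon>" using assms(3) by linarith
    then have "dist r w < \<epsilon>" using pr(3) by (simp add: dist_norm)
    moreover have "\<forall>i<k. hdot (x' i) r = 0"
    proof (intro allI impI)
      fix i assume "i < k"
      then have "x' i \<in> ?S" by (intro vec.span_base) simp
      then show "hdot (x' i) r = 0" using pr(2) hdot_eq_0_commute by blast
    qed
    ultimately show "\<exists>w'. dist w' w < \<epsilon> \<and> (\<forall>i<k. hdot (x' i) w' = 0)" by blast
  qed
qed

section \<open>Derivatives and the identity theorem for holomorphic maps of several
  variables\<close>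

abbreviation clinear :: "(complex ^ 'n::finite \<Rightarrow> complex ^ 'm::finite) \<Rightarrow> bool" where
  "clinear \<equiv> Vector_Spaces.linear (*s) (*s)"

text \<open>The direction comes before the point, so that \<open>dirder F e\<close> is a map of the
  same kind as \<open>F\<close> and can join it in one class of maps.\<close>

definition dirder :: "(complex ^ 'n::finite \<Rightarrow> complex ^ 'm::finite) \<Rightarrow> complex ^ 'n \<Rightarrow> complex ^ 'n \<Rightarrow> complex ^ 'm" where
  "dirder F e z = frechet_derivative F (at z) e"

lemma holomorphic_vec_on_has_derivative:
  assumes "holomorphic_vec_on F D" "z \<in> D"
  shows "(F has_derivative (\<lambda>e. dirder F e z)) (at z)" "clinear (\<lambda>e. dirder F e z)"
proof -
  obtain A where A: "clinear A" "(F has_derivative A) (at z)"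
    using assms unfolding holomorphic_vec_on_def by blast
  have "A = (\<lambda>e. dirder F e z)"
    using frechet_derivative_at[OF A(2)] by (simp add: dirder_def fun_eq_iff)
  then show "(F has_derivative (\<lambda>e. dirder F e z)) (at z)" "clinear (\<lambda>e. dirder F e z)"
    using A by auto
qed

lemma holomorphic_vec_on_continuous_on:
  assumes "holomorphic_vec_on F D"
  shows "continuous_on D F"
  using holomorphic_vec_on_has_derivative(1)[OF assms]
  by (meson continuous_at_imp_continuous_on has_derivative_continuous)

lemma holomorphic_vec_on_subset: "holomorphic_vec_on F D \<Longrightarrow> D' \<subseteq> D \<Longrightarrow> holomorphic_vec_on F D'"
  unfolding holomorphic_vec_on_def by blast

lemma bounded_linear_smult_left: "bounded_linear (\<lambda>h. h *s (b :: complex ^ 'n::finite))"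
proof (rule bounded_linear_intro[where K = "norm b"])
  show "(r *\<^sub>R x) *s b = r *\<^sub>R (x *s b)" for r x
    by (simp add: vec_eq_iff)
qed (simp_all add: vec.scale_left_distrib norm_smult)

lemma has_derivative_line:
  fixes a b :: "complex ^ 'n::finite"
  shows "((\<lambda>t. a + t *s b) has_derivative (\<lambda>h. h *s b)) (at t within S)"
  using has_derivative_add[OF has_derivative_const bounded_linear_imp_has_derivative[OF bounded_linear_smult_left]]
  by fastforce

text \<open>Used to realise, by points of the open set \<open>S\<close>, directions \<open>b\<close>
  that are only known to exist somewhere in the space.\<close>

lemma ex_small_step:
  fixes a b :: "complex ^ 'n::finite"
  assumes "open S" "a \<in> S"
  obtains t where "a + t *s b \<in> S" "t \<noteq> 0"
proof -
  have "((\<lambda>t. a + t *s b) \<longlongrightarrow> a + 0 *s b) (at 0)"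
    by (intro tendsto_intros bounded_linear.tendsto[OF bounded_linear_smult_left])
  then have "\<forall>\<^sub>F t in at 0. a + t *s b \<in> S"
    by (rule topological_tendstoD) (use assms in auto)
  then have "\<forall>\<^sub>F t in at 0. a + t *s b \<in> S \<and> t \<noteq> 0"
    by (auto simp: eventually_conj_iff eventually_at_filter)
  then show thesis
    using eventually_happens'[OF at_neq_bot] that by blast
qed

lemma continuous_on_line: "continuous_on S (\<lambda>t. (a :: complex ^ 'n::finite) + t *s b)"
  by (intro continuous_intros)

lemma open_line: "open D \<Longrightarrow> open {t. (a :: complex ^ 'n::finite) + t *s b \<in> D}"
  using open_vimage[of D "\<lambda>t. a + t *s b"] continuous_on_line[of UNIV a b] by (simp add: vimage_def)

lemma has_field_derivative_hdot_line:
  assumes "holomorphic_vec_on F D" "a + t *s b \<in> D"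
  shows "((\<lambda>t. hdot (F (a + t *s b)) y) has_field_derivative hdot (dirder F b (a + t *s b)) y) (at t)"
proof -
  note F = holomorphic_vec_on_has_derivative[OF assms]
  have "((\<lambda>t. hdot (F (a + t *s b)) y) has_derivative (\<lambda>h. hdot (dirder F (h *s b) (a + t *s b)) y)) (at t)"
    by (rule bounded_linear.has_derivative[OF bounded_bilinear.bounded_linear_left[OF bounded_bilinear_hdot]])
      (rule has_derivative_compose[OF has_derivative_line F(1)])
  then show ?thesis
    unfolding has_field_derivative_def vec.linear_scale[OF F(2)] hdot_simps mult.commute[of _ "hdot _ _"] .
qed

text \<open>Holomorphy on complex lines is all that the identity theorem below asks for, so that
  one-variable theory suffices.\<close>

definition line_holomorphic_on :: "(complex ^ 'n::finite \<Rightarrow> complex) \<Rightarrow> (complex ^ 'n) set \<Rightarrow> bool" where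
  "line_holomorphic_on g D \<longleftrightarrow> (\<forall>a b. (\<lambda>t. g (a + t *s b)) holomorphic_on {t. a + t *s b \<in> D})"

lemma line_holomorphic_on_subset:
  "line_holomorphic_on g D \<Longrightarrow> D' \<subseteq> D \<Longrightarrow> line_holomorphic_on g D'"
  unfolding line_holomorphic_on_def by (meson Collect_mono holomorphic_on_subset subsetD)

lemma line_holomorphic_on_hdot:
  assumes "holomorphic_vec_on F D" "open D"
  shows "line_holomorphic_on (\<lambda>z. hdot (F z) y) D"
  unfolding line_holomorphic_on_def
  by (auto simp: holomorphic_on_open open_line[OF assms(2)] intro: has_field_derivative_hdot_line[OF assms(1)])

text \<open>On the complex line through \<open>x\<close> and a point of \<open>S\<close> this is the
  identity theorem in one variable; convexity of \<open>D\<close> makes the set of parameters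
  connected.\<close>

lemma line_holomorphic_on_eq_0:
  assumes g: "line_holomorphic_on g D" and D: "open D" "convex D"
    and S: "open S" "S \<noteq> {}" "S \<subseteq> D" "\<And>z. z \<in> S \<Longrightarrow> g z = 0" and x: "x \<in> D"
  shows "g x = 0"
proof -
  obtain p where p: "p \<in> S" using S by blast
  define T where "T = {t. p + t *s (x - p) \<in> D}"
  have "convex T"
    unfolding convex_def
  proof (intro ballI allI impI)
    fix s t and u v :: real assume *: "s \<in> T" "t \<in> T" "0 \<le> u" "0 \<le> v" "u + v = 1"
    have "u *\<^sub>R (p + s *s (x - p)) + v *\<^sub>R (p + t *s (x - p)) \<in> D"
      using convexD[OF D(2)] * by (simp add: T_def)
    also have "u *\<^sub>R (p + s *s (x - p)) + v *\<^sub>R (p + t *s (x - p))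
        = (u + v) *\<^sub>R p + (u *\<^sub>R s + v *\<^sub>R t) *s (x - p)"
      by (simp add: vec_eq_iff algebra_simps)
    finally show "u *\<^sub>R s + v *\<^sub>R t \<in> T" using * by (simp add: T_def)
  qed
  have "g (p + 1 *s (x - p)) = 0"
  proof (rule analytic_continuation_open[of "{t. p + t *s (x - p) \<in> S}" T "\<lambda>t. g (p + t *s (x - p))" "\<lambda>_. 0" 1])
    show "{t. p + t *s (x - p) \<in> S} \<noteq> {}" using p by (auto intro!: exI[of _ 0])
    show "connected T" using \<open>convex T\<close> by (rule convex_connected)
    show "(\<lambda>t. g (p + t *s (x - p))) holomorphic_on T" using g unfolding line_holomorphic_on_def T_def by blast
    show "open {t. p + t *s (x - p) \<in> S}" by (rule open_line[OF S(1)])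
    show "open T" unfolding T_def by (rule open_line[OF D(1)])
  qed (use S x in \<open>auto simp: T_def\<close>)
  then show ?thesis by simp
qed

text \<open>Holomorphy is defined by mere differentiability, so continuity of the derivative comes
  from Cauchy's estimate. Applied to \<open>g (x + t *s e) - g (z + t *s e)\<close> as a function of
  \<open>t\<close>, it bounds the difference of the derivatives by a difference of values of
  \<open>g\<close>, which is small by uniform continuity on a compact ball.\<close>

lemma continuous_on_dirder:
  assumes F: "holomorphic_vec_on F D" and D: "open D"
  shows "continuous_on D (dirder F e)"
proof -
  have *: "continuous_on D (\<lambda>z. hdot (dirder F e z) y)" for y
    unfolding continuous_on_iff
  proof (intro ballI allI impI)
    fix z and \<epsilon> :: real assume z: "z \<in> D" and "\<epsilon> > 0"
    obtain R where R: "R > 0" "cball z (2 * R) \<subseteq> D"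
    proof -
      obtain R0 where "R0 > 0" "cball z R0 \<subseteq> D" using D z open_contains_cball by blast
      then show ?thesis using that[of "R0 / 2"] by simp
    qed
    \<comment> \<open>For \<open>x\<close> within \<open>R\<close> of \<open>z\<close>, a disc of
      radius \<open>r\<close> in direction \<open>e\<close> stays in the ball of radius
      \<open>2 * R\<close>; the summand 1 covers \<open>e = 0\<close>.\<close>
    define r where "r = R / (norm e + 1)"
    have r: "r > 0" "r * norm e \<le> R"
    proof -
      have p: "0 < norm e + 1" by (simp add: add_nonneg_pos)
      then show "r > 0" using R(1) by (simp add: r_def)
      have "r * norm e \<le> r * (norm e + 1)" using \<open>r > 0\<close> by simp
      then show "r * norm e \<le> R" using p by (simp add: r_def)
    qed
    define g where "g = (\<lambda>z. hdot (F z) y)"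
    have gK: "continuous_on (cball z (2 * R)) g"
      unfolding g_def using R(2)
      by (intro continuous_intros continuous_on_subset[OF holomorphic_vec_on_continuous_on[OF F]])
    have "uniformly_continuous_on (cball z (2 * R)) g"
      by (rule compact_uniformly_continuous[OF gK compact_cball])
    then obtain \<delta> where \<delta>: "\<delta> > 0" "\<And>x x'. \<lbrakk>x \<in> cball z (2 * R); x' \<in> cball z (2 * R); dist x' x < \<delta>\<rbrakk>
        \<Longrightarrow> dist (g x') (g x) < \<epsilon> / 2 * r"
      using \<open>\<epsilon> > 0\<close> r(1) that
      unfolding uniformly_continuous_on_def by (metis half_gt_zero mult_pos_pos)
    have in_ball: "x + t *s e \<in> cball z (2 * R)" if "dist x z < R" "cmod t \<le> r" for x t
    proof -
      have "norm (z - (x + t *s e)) \<le> norm (z - x) + norm (t *s e)"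
        using norm_triangle_ineq4[of "z - x" "t *s e"] by (simp add: algebra_simps)
      also have "\<dots> \<le> R + r * norm e"
        using that unfolding norm_smult by (intro add_mono mult_right_mono) (auto simp: dist_norm norm_minus_commute)
      finally show ?thesis using r(2) by (simp add: dist_norm)
    qed
    show "\<exists>d>0. \<forall>x'\<in>D. dist x' z < d \<longrightarrow> dist (hdot (dirder F e x') y) (hdot (dirder F e z) y) < \<epsilon>"
    proof (intro exI[of _ "min \<delta> R"] conjI ballI impI)
      fix x assume x: "x \<in> D" "dist x z < min \<delta> R"
      let ?h = "\<lambda>t. g (x + t *s e) - g (z + t *s e)"
      have in1: "x + t *s e \<in> D" "z + t *s e \<in> D" if "cmod t \<le> r" for t
        using in_ball[OF _ that, of x] in_ball[OF _ that, of z] x R by auto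
      have der: "(?h has_field_derivative hdot (dirder F e (x + t *s e)) y - hdot (dirder F e (z + t *s e)) y) (at t)"
        if "cmod t \<le> r" for t
        unfolding g_def using in1[OF that] by (intro DERIV_diff has_field_derivative_hdot_line[OF F])
      have "cmod ((deriv ^^ 1) ?h 0) \<le> fact 1 * (\<epsilon> / 2 * r) / r ^ 1"
      proof (rule Cauchy_inequality)
        show "?h holomorphic_on ball 0 r"
          unfolding holomorphic_on_open[OF open_ball]
          by (intro ballI exI, rule der) simp
        show "continuous_on (cball 0 r) ?h"
          by (intro continuous_at_imp_continuous_on ballI DERIV_isCont, rule der) simp
        fix t :: complex assume "cmod (0 - t) = r"
        then have t: "cmod t \<le> r" by simp
        have "dist (x + t *s e) (z + t *s e) = dist x z" by (simp add: dist_norm)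
        then have "dist (g (x + t *s e)) (g (z + t *s e)) < \<epsilon> / 2 * r"
          using x t R(1) by (intro \<delta>(2) in_ball) auto
        then show "cmod (?h t) \<le> \<epsilon> / 2 * r" by (simp add: dist_norm)
      qed (use r in auto)
      moreover have "deriv ?h 0 = hdot (dirder F e x) y - hdot (dirder F e z) y"
        using DERIV_imp_deriv[OF der[of 0]] r by simp
      ultimately have "cmod (hdot (dirder F e x) y - hdot (dirder F e z) y) \<le> \<epsilon> / 2"
        using r(1) by simp
      then show "dist (hdot (dirder F e x) y) (hdot (dirder F e z) y) < \<epsilon>"
        using \<open>\<epsilon> > 0\<close> by (simp add: dist_norm)
    qed (use \<delta>(1) R(1) in auto)
  qed
  have "continuous_on D (\<lambda>z. \<chi> j. dirder F e z $ j)"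
    by (intro continuous_on_vec_lambda, unfold component_eq_hdot, rule *)
  then show ?thesis by simp
qed

text \<open>By \<open>der\<close> the derivative of the quotient
  \<open>hdot (F z) y2 / hdot (F z) y1\<close> has numerator 0. The quotient is therefore constant
  near \<open>u\<close>, where it vanishes, and the identity theorem carries the zeros of its
  numerator to all of \<open>D\<close>.\<close>

lemma eq_0_of_dirder_zero:
  assumes F: "holomorphic_vec_on F D" and D: "open D" "convex D"
    and S: "open S" "u \<in> S" "S \<subseteq> D" and ne: "hdot (F u) y1 \<noteq> 0" and u0: "hdot (F u) y2 = 0"
    and der: "\<And>z e. z \<in> S \<Longrightarrow> hdot (F z) y1 * hdot (dirder F e z) y2 = hdot (F z) y2 * hdot (dirder F e z) y1"
    and x: "x \<in> D"
  shows "hdot (F x) y2 = 0"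
proof -
  let ?S1 = "{z \<in> S. hdot (F z) y1 \<noteq> 0}"
  have "continuous_on S (\<lambda>z. hdot (F z) y1)"
    using continuous_on_subset[OF holomorphic_vec_on_continuous_on[OF F] S(3)] by (intro continuous_intros)
  then have "open (S \<inter> (\<lambda>z. hdot (F z) y1) -` (- {0}))"
    by (rule continuous_open_preimage) (use S in auto)
  moreover have "S \<inter> (\<lambda>z. hdot (F z) y1) -` (- {0}) = ?S1" by auto
  ultimately obtain r where r: "r > 0" "ball u r \<subseteq> ?S1"
    using S(2) ne open_contains_ball by (metis (mono_tags, lifting) mem_Collect_eq)
  let ?R = "\<lambda>z. hdot (F z) y2 / hdot (F z) y1"
  have der0: "(?R has_derivative (\<lambda>_. 0)) (at z within ball u r)" if "z \<in> ball u r" for z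
  proof -
    have z: "z \<in> D" "hdot (F z) y1 \<noteq> 0" "z \<in> S" using that r S by auto
    have d: "((\<lambda>z. hdot (F z) y) has_derivative (\<lambda>e. hdot (dirder F e z) y)) (at z within ball u r)" for y
      by (rule bounded_linear.has_derivative[OF bounded_bilinear.bounded_linear_left[OF bounded_bilinear_hdot]])
        (rule has_derivative_at_withinI[OF holomorphic_vec_on_has_derivative(1)[OF F z(1)]])
    have "(?R has_derivative (\<lambda>e. (hdot (dirder F e z) y2 * hdot (F z) y1 - hdot (F z) y2 * hdot (dirder F e z) y1)
        / (hdot (F z) y1 * hdot (F z) y1))) (at z within ball u r)"
      by (rule has_derivative_divide'[OF d d z(2)])
    then show ?thesis using der[OF z(3)] by (simp add: mult.commute)
  qed
  have "?R z = 0" if "z \<in> ball u r" for z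
    using has_derivative_zero_unique[OF convex_ball der0 that, of u] r(1) u0 by auto
  then have "hdot (F z) y2 = 0" if "z \<in> ball u r" for z using that r(2) by fastforce
  then show ?thesis
    using line_holomorphic_on_eq_0[OF line_holomorphic_on_hdot[OF F D(1)] D, of "ball u r" y2 x] r S x by auto
qed

section \<open>Nearby frames and nearby orthogonal vectors, expressed by filters\<close>

lemma eventually_indep_family:
  assumes "indep_family k x" "\<And>i. i < k \<Longrightarrow> ((\<lambda>a. g a i) \<longlongrightarrow> x i) F"
  shows "eventually (\<lambda>a. indep_family k (g a)) F"
proof -
  obtain \<delta> where \<delta>: "\<delta> > 0" "\<And>x'. (\<And>i. i < k \<Longrightarrow> dist (x' i) (x i) < \<delta>) \<Longrightarrow> indep_family k x'"
    using indep_family_perturb[OF assms(1)] by blast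
  have "eventually (\<lambda>a. \<forall>i\<in>{..<k}. dist (g a i) (x i) < \<delta>) F"
    using assms(2) \<delta>(1) by (intro eventually_ball_finite) (auto dest: tendstoD)
  then show ?thesis by (rule eventually_mono) (use \<delta>(2) in auto)
qed

lemma eventually_ex_orthogonal:
  assumes "indep_family k x" "\<And>i. i < k \<Longrightarrow> ((\<lambda>a. g a i) \<longlongrightarrow> x i) F"
    and "\<And>i. i < k \<Longrightarrow> hdot (x i) w = 0" and S: "open S" "w \<in> S"
  shows "eventually (\<lambda>a. \<exists>w'\<in>S. \<forall>i<k. hdot (g a i) w' = 0) F"
proof -
  obtain \<epsilon> where \<epsilon>: "\<epsilon> > 0" "ball w \<epsilon> \<subseteq> S" using S open_contains_ball by blast
  obtain \<delta> where \<delta>: "\<delta> > 0"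
    "\<And>x'. (\<And>i. i < k \<Longrightarrow> dist (x' i) (x i) < \<delta>) \<Longrightarrow> \<exists>w'. dist w' w < \<epsilon> \<and> (\<forall>i<k. hdot (x' i) w' = 0)"
    using orthogonal_perturb[OF assms(1,3) \<epsilon>(1)] by blast
  have "eventually (\<lambda>a. \<forall>i\<in>{..<k}. dist (g a i) (x i) < \<delta>) F"
    using assms(2) \<delta>(1) by (intro eventually_ball_finite) (auto dest: tendstoD)
  then show ?thesis
  proof (rule eventually_mono)
    fix a assume "\<forall>i\<in>{..<k}. dist (g a i) (x i) < \<delta>"
    then obtain w' where "dist w' w < \<epsilon>" "\<forall>i<k. hdot (g a i) w' = 0" using \<delta>(2)[of "g a"] by auto
    then show "\<exists>w'\<in>S. \<forall>i<k. hdot (g a i) w' = 0" using \<epsilon>(2) by (auto simp: dist_commute subset_iff)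
  qed
qed

text \<open>Neighbourhoods of the first \<open>n\<close> members of a family; the remaining members are arbitrary.\<close>

definition near :: "nat \<Rightarrow> (nat \<Rightarrow> 'a::metric_space) \<Rightarrow> (nat \<Rightarrow> 'a) filter" where
  "near n v = (INF \<epsilon>\<in>{0<..}. principal {v'. \<forall>j<n. dist (v' j) (v j) < \<epsilon>})"

lemma eventually_near:
  "eventually P (near n v) \<longleftrightarrow> (\<exists>\<epsilon>>0. \<forall>v'. (\<forall>j<n. dist (v' j) (v j) < \<epsilon>) \<longrightarrow> P v')"
proof -
  have "eventually P (near n v) \<longleftrightarrow>
      (\<exists>\<epsilon>\<in>{0<..}. eventually P (principal {v'. \<forall>j<n. dist (v' j) (v j) < \<epsilon>}))"
    unfolding near_def
  proof (rule eventually_INF_base)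
    fix a b :: real assume "a \<in> {0<..}" "b \<in> {0<..}"
    then show "\<exists>x\<in>{0<..}. principal {v'. \<forall>j<n. dist (v' j) (v j) < x}
        \<le> inf (principal {v'. \<forall>j<n. dist (v' j) (v j) < a}) (principal {v'. \<forall>j<n. dist (v' j) (v j) < b})"
      by (intro bexI[of _ "min a b"]) auto
  qed (auto intro: exI[of _ 1])
  then show ?thesis by (auto simp: eventually_principal)
qed

lemma tendsto_near: "j < n \<Longrightarrow> ((\<lambda>v'. v' j) \<longlongrightarrow> v j) (near n v)"
  by (auto simp: tendsto_iff eventually_near)

lemma filterlim_near:
  assumes "\<And>j. j < n \<Longrightarrow> ((\<lambda>a. g a j) \<longlongrightarrow> v j) F"
  shows "filterlim g (near n v) F"
  unfolding filterlim_iff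
proof (intro allI impI)
  fix P assume "eventually P (near n v)"
  then obtain \<epsilon> where \<epsilon>: "\<epsilon> > 0" "\<And>v'. (\<forall>j<n. dist (v' j) (v j) < \<epsilon>) \<Longrightarrow> P v'"
    unfolding eventually_near by blast
  have "eventually (\<lambda>a. \<forall>j\<in>{..<n}. dist (g a j) (v j) < \<epsilon>) F"
    using assms \<epsilon>(1) by (intro eventually_ball_finite) (auto dest: tendstoD)
  then show "eventually (\<lambda>a. P (g a)) F" by (rule eventually_mono) (use \<epsilon>(2) in auto)
qed

lemma eventually_eventually_near:
  assumes "eventually P (near n v)"
  shows "eventually (\<lambda>v'. eventually P (near n v')) (near n v)"
proof -
  obtain \<epsilon> where \<epsilon>: "\<epsilon> > 0" "\<And>v'. (\<forall>j<n. dist (v' j) (v j) < \<epsilon>) \<Longrightarrow> P v'"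
    using assms unfolding eventually_near by blast
  show ?thesis
    unfolding eventually_near
  proof (rule exI[of _ "\<epsilon> / 2"], intro conjI allI impI)
    fix v' assume v': "\<forall>j<n. dist (v' j) (v j) < \<epsilon> / 2"
    show "\<exists>\<epsilon>>0. \<forall>v''. (\<forall>j<n. dist (v'' j) (v' j) < \<epsilon>) \<longrightarrow> P v''"
    proof (rule exI[of _ "\<epsilon> / 2"], intro conjI allI impI \<epsilon>(2))
      fix v'' j assume *: "\<forall>j<n. dist (v'' j) (v' j) < \<epsilon> / 2" "j < n"
      then show "dist (v'' j) (v j) < \<epsilon>"
        using v' dist_triangle[of "v'' j" "v j" "v' j"] by fastforce
    qed (use \<epsilon>(1) in simp)
  qed (use \<epsilon>(1) in simp)
qed

section \<open>The dimension count along flags\<close>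

lemma hdot_span_eq_0:
  assumes "x \<in> vec.span S" "\<And>s. s \<in> S \<Longrightarrow> hdot s w = 0"
  shows "hdot x w = 0"
  using assms(1) by (induction rule: vec.span_induct_alt) (auto simp: assms(2))

lemma hdot_image_span_eq_0:
  assumes "clinear \<sigma>" "x \<in> vec.span S" "\<And>s. s \<in> S \<Longrightarrow> hdot (\<sigma> s) w = 0"
  shows "hdot (\<sigma> x) w = 0"
  using assms(2) by (induction rule: vec.span_induct_alt)
    (auto simp: assms(3) vec.linear_0[OF assms(1)] vec.linear_add[OF assms(1)] vec.linear_scale[OF assms(1)])

lemma coord_space_span: "x \<in> coord_space Q \<Longrightarrow> x \<in> vec.span ((\<lambda>i. axis i 1) ` Q)"
proof -
  assume x: "x \<in> coord_space Q"
  have "x = (\<Sum>i\<in>Q. x $ i *s axis i 1)"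
    using x by (auto simp: vec_eq_iff coord_space_def axis_def if_distrib cong: if_cong)
  also have "\<dots> \<in> vec.span ((\<lambda>i. axis i 1) ` Q)"
    by (intro vec.span_sum vec.span_scale vec.span_base imageI)
  finally show ?thesis .
qed

lemma subspace_coord_space: "vec.subspace (coord_space Q)"
  by (auto simp: vec.subspace_def coord_space_def)

text \<open>A vector \<open>z\<close> with \<open>\<sigma> z\<close> outside the span of the
  \<open>v i\<close> and \<open>\<sigma> e\<close> together is corrected by a multiple of
  \<open>e\<close> to become orthogonal to \<open>w\<close>; the correction cannot bring it into the
  span of the \<open>v i\<close>. The 2 in \<open>k\<close> + 2 pays for the added generator and for
  strictness.\<close>

lemma ex_orthogonal_not_in_span:
  assumes \<sigma>: "clinear \<sigma>" and e: "hdot (\<sigma> e) w \<noteq> 0" and k: "k + 2 \<le> vec.dim (range \<sigma>)"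
  obtains x where "hdot (\<sigma> x) w = 0" "\<sigma> x \<notin> vec.span (v ` {..<k})"
proof -
  let ?T = "insert (\<sigma> e) (v ` {..<k})"
  have "\<not> range \<sigma> \<subseteq> vec.span ?T"
  proof
    assume "range \<sigma> \<subseteq> vec.span ?T"
    then have "vec.dim (range \<sigma>) \<le> card ?T" by (rule vec.dim_le_card) simp
    also have "\<dots> \<le> Suc k" using card_image_le[of "{..<k}" v] by (simp add: card_insert_if)
    finally show False using k by simp
  qed
  then obtain z where z: "\<sigma> z \<notin> vec.span ?T" by blast
  define c where "c = hdot (\<sigma> z) w / hdot (\<sigma> e) w"
  have \<sigma>x: "\<sigma> (z - c *s e) = \<sigma> z - c *s \<sigma> e"
    by (simp add: vec.linear_diff[OF \<sigma>] vec.linear_scale[OF \<sigma>])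
  show thesis
  proof (rule that[of "z - c *s e"])
    show "hdot (\<sigma> (z - c *s e)) w = 0" unfolding \<sigma>x using e by (simp add: c_def)
    show "\<sigma> (z - c *s e) \<notin> vec.span (v ` {..<k})"
    proof
      assume "\<sigma> (z - c *s e) \<in> vec.span (v ` {..<k})"
      then have "\<sigma> z - c *s \<sigma> e \<in> vec.span ?T" unfolding \<sigma>x using vec.span_mono by blast
      moreover have "c *s \<sigma> e \<in> vec.span ?T" by (intro vec.span_scale vec.span_base) simp
      ultimately have "\<sigma> z - c *s \<sigma> e + c *s \<sigma> e \<in> vec.span ?T" by (rule vec.span_add)
      then show False using z by simp
    qed
  qed
qed

text \<open>The matrix \<open>hdot (f y) (G \<xi>)\<close>, with rows indexed by pairs of
  \<open>f\<close> and \<open>y\<close> and columns by \<open>\<xi>\<close>, has rank at most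
  one.\<close>

definition minors_vanish ::
    "('a \<Rightarrow> complex ^ 'm::finite) set \<Rightarrow> ('b \<Rightarrow> complex ^ 'm) \<Rightarrow> 'a set \<Rightarrow> 'b set \<Rightarrow> bool" where
  "minors_vanish \<C> G Y X \<longleftrightarrow> (\<forall>\<xi>1\<in>X. \<forall>\<xi>2\<in>X. \<forall>f\<in>\<C>. \<forall>g\<in>\<C>. \<forall>y1\<in>Y. \<forall>y2\<in>Y.
     hdot (f y1) (G \<xi>1) * hdot (g y2) (G \<xi>2) = hdot (f y1) (G \<xi>2) * hdot (g y2) (G \<xi>1))"

text \<open>
  The form on the source is \<open>hdot (\<sigma> z) w\<close>. The proof keeps \<open>2 * k - 1\<close> independent values of \<open>\<C>\<close> on the
  span of \<open>k\<close> points; at the largest such \<open>k\<close> one further point cannot contribute two new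
  independent values. The class \<open>\<C>\<close> is \<open>{F}\<close> or \<open>F\<close> with its directional derivatives.
\<close>

lemma flag_lemma:
  fixes \<sigma> :: "complex ^ 'n::finite \<Rightarrow> complex ^ 'n" and \<C> :: "(complex ^ 'n \<Rightarrow> complex ^ 'm::finite) set"
  assumes \<sigma>: "clinear \<sigma>" and D: "open D" and D': "open D'"
    and cont: "\<And>f. f \<in> \<C> \<Longrightarrow> continuous_on D f"
    and orth: "\<And>f z w. \<lbrakk>f \<in> \<C>; z \<in> D; w \<in> D'; hdot (\<sigma> z) w = 0\<rbrakk> \<Longrightarrow> hdot (f z) (G w) = 0"
    and fQ: "\<And>f z. \<lbrakk>f \<in> \<C>; z \<in> D\<rbrakk> \<Longrightarrow> f z \<in> coord_space Q"
    and GQ: "\<And>w. w \<in> D' \<Longrightarrow> G w \<in> coord_space Q \<and> G w \<noteq> 0"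
    and e: "\<And>w. w \<in> D' \<Longrightarrow> hdot (\<sigma> e) w \<noteq> 0"
    and card: "card Q + 3 \<le> 2 * vec.dim (range \<sigma>)"
    and start: "z0 \<in> D" "w0 \<in> D'" "hdot (\<sigma> z0) w0 = 0" "\<sigma> z0 \<noteq> 0" "F \<in> \<C>" "F z0 \<noteq> 0"
  obtains k v w where "1 \<le> k" "w \<in> D'" "\<And>j. j < Suc k \<Longrightarrow> v j \<in> D"
    "indep_family (Suc k) (\<lambda>j. \<sigma> (v j))" "\<And>j. j < Suc k \<Longrightarrow> hdot (\<sigma> (v j)) w = 0"
    "\<forall>\<^sub>F v' in near (Suc k) v. minors_vanish \<C> G (D \<inter> vec.span (v' ` {..<Suc k}))
         {\<xi> \<in> D'. \<forall>j<k. hdot (\<sigma> (v' j)) \<xi> = 0}"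
proof -
  \<comment> \<open>A flag spanned by \<open>k\<close> points orthogonal to a common
    \<open>w\<close>, with one independent value for its first point and two for each further
    one.\<close>
  define P where "P k v w f z \<longleftrightarrow> w \<in> D' \<and> (\<forall>j<k. v j \<in> D \<and> hdot (\<sigma> (v j)) w = 0) \<and>
      indep_family k (\<lambda>j. \<sigma> (v j)) \<and> (\<forall>i<2*k-1. f i \<in> \<C> \<and> z i \<in> D \<inter> vec.span (v ` {..<k})) \<and>
      indep_family (2*k-1) (\<lambda>i. f i (z i))" for k v w f z
  have P1: "P 1 (\<lambda>_. z0) w0 (\<lambda>_. F) (\<lambda>_. z0)"
    unfolding P_def using start by (auto simp: indep_family_def vec.span_base)
  \<comment> \<open>The nonzero vector \<open>G w\<close> is orthogonal to all
    \<open>2 * k - 1\<close> values, hence independent of them, and is the additional vector in the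
    count.\<close>
  have P_le: "2 * k \<le> card Q" if "P k v w f z" "1 \<le> k" for k v w f z
  proof -
    let ?x = "\<lambda>i. if i < 2*k-1 then f i (z i) else G w"
    have w: "w \<in> D'" using that(1) by (simp add: P_def)
    have o: "hdot (f i (z i)) (G w) = 0" if "i < 2*k-1" for i
    proof (rule orth)
      show "hdot (\<sigma> (z i)) w = 0"
        by (rule hdot_image_span_eq_0[OF \<sigma>, of _ "v ` {..<k}"]) (use \<open>P k v w f z\<close> that in \<open>auto simp: P_def\<close>)
    qed (use \<open>P k v w f z\<close> that w in \<open>auto simp: P_def\<close>)
    have "indep_family (2*k-1) ?x"
      using that(1) indep_family_cong[of "2*k-1" "\<lambda>i. f i (z i)" ?x] by (auto simp: P_def)
    moreover have "G w \<notin> vec.span (?x ` {..<2*k-1})"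
    proof
      assume "G w \<in> vec.span (?x ` {..<2*k-1})"
      then have "hdot (G w) (G w) = 0" by (rule hdot_span_eq_0) (use o in auto)
      then show False using GQ[OF w] by simp
    qed
    ultimately have "indep_family (Suc (2*k-1)) ?x" by (simp add: indep_family_Suc)
    then have "Suc (2*k-1) \<le> card ((\<lambda>i. axis i (1::complex)) ` Q)"
      by (rule indep_family_le_card) (use that fQ GQ[OF w] in \<open>auto simp: P_def intro!: coord_space_span\<close>)
    also have "\<dots> \<le> card Q" by (simp add: card_image_le)
    finally show ?thesis by simp
  qed
  define m where "m = vec.dim (range \<sigma>)"
  have m: "card Q + 3 \<le> 2 * m" using card by (simp add: m_def)
  have "\<exists>k\<ge>1. (\<exists>v w f z. P k v w f z) \<and> \<not> (\<exists>v w f z. P (Suc k) v w f z)"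
  proof (rule ccontr)
    assume *: "\<not> ?thesis"
    have "\<exists>v w f z. P k v w f z" if "k \<ge> 1" for k
      using that by (induction k rule: nat_induct_at_least) (use P1 * in blast)+
    then show False using P_le[of "card Q + 1"] by fastforce
  qed
  then obtain k v w f z where k: "k \<ge> 1" and P: "P k v w f z" and notP: "\<And>v w f z. \<not> P (Suc k) v w f z"
    by blast
  \<comment> \<open>From \<open>2 * k \<le> card Q\<close> and
    \<open>card Q + 3 \<le> 2 * m\<close>, by parity. It leaves room for one more point orthogonal
    to \<open>w\<close>.\<close>
  have "k + 2 \<le> m" using P_le[OF P k] m by linarith
  have w: "w \<in> D'" using P by (simp add: P_def)
  obtain x where x: "hdot (\<sigma> x) w = 0" "\<sigma> x \<notin> vec.span ((\<lambda>j. \<sigma> (v j)) ` {..<k})"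
    using ex_orthogonal_not_in_span[OF \<sigma> e[OF w], of k] \<open>k + 2 \<le> m\<close> unfolding m_def by blast
  have "v 0 \<in> D" using P k by (simp add: P_def)
  then obtain t where t: "v 0 + t *s x \<in> D" "t \<noteq> 0" by (rule ex_small_step[OF D])
  \<comment> \<open>The vector \<open>x\<close> itself may lie outside \<open>D\<close>. A small
    step from \<open>v 0\<close> stays in \<open>D\<close>, and since \<open>\<sigma> (v 0)\<close>
    is in the old span, independence is inherited from \<open>\<sigma> x\<close>.\<close>
  define V where "V = v(k := v 0 + t *s x)"
  have Vk: "V j = v j" if "j < k" for j using that by (simp add: V_def)
  have VD: "V j \<in> D" if "j < Suc k" for j using that t P by (auto simp: V_def P_def less_Suc_eq)
  have V0: "hdot (\<sigma> (V j)) w = 0" if "j < Suc k" for j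
    using that x(1) P k by (auto simp: V_def P_def less_Suc_eq vec.linear_add[OF \<sigma>] vec.linear_scale[OF \<sigma>])
  have Vind: "indep_family (Suc k) (\<lambda>j. \<sigma> (V j))"
    unfolding indep_family_Suc
  proof
    show "indep_family k (\<lambda>j. \<sigma> (V j))"
      using P indep_family_cong[of k "\<lambda>j. \<sigma> (v j)" "\<lambda>j. \<sigma> (V j)"] by (simp add: P_def Vk)
    show "\<sigma> (V k) \<notin> vec.span ((\<lambda>j. \<sigma> (V j)) ` {..<k})"
    proof
      have eq: "(\<lambda>j. \<sigma> (V j)) ` {..<k} = (\<lambda>j. \<sigma> (v j)) ` {..<k}" using Vk by (intro image_cong) auto
      assume "\<sigma> (V k) \<in> vec.span ((\<lambda>j. \<sigma> (V j)) ` {..<k})"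
      then have "\<sigma> (v 0) + t *s \<sigma> x \<in> vec.span ((\<lambda>j. \<sigma> (v j)) ` {..<k})"
        unfolding eq by (simp add: V_def vec.linear_add[OF \<sigma>] vec.linear_scale[OF \<sigma>])
      moreover have "\<sigma> (v 0) \<in> vec.span ((\<lambda>j. \<sigma> (v j)) ` {..<k})" using k by (intro vec.span_base) auto
      ultimately have "(\<sigma> (v 0) + t *s \<sigma> x) - \<sigma> (v 0) \<in> vec.span ((\<lambda>j. \<sigma> (v j)) ` {..<k})"
        by (rule vec.span_diff)
      then have "t *s \<sigma> x \<in> vec.span ((\<lambda>j. \<sigma> (v j)) ` {..<k})" by simp
      then have "inverse t *s (t *s \<sigma> x) \<in> vec.span ((\<lambda>j. \<sigma> (v j)) ` {..<k})"
        by (rule vec.span_scale)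
      then show False using x(2) t(2) by simp
    qed
  qed
  let ?N = "near (Suc k) V"
  have lim: "((\<lambda>v'. v' j) \<longlongrightarrow> V j) ?N" if "j < Suc k" for j by (rule tendsto_near[OF that])
  have lim\<sigma>: "((\<lambda>v'. \<sigma> (v' j)) \<longlongrightarrow> \<sigma> (V j)) ?N" if "j < Suc k" for j
    by (rule bounded_linear.tendsto[OF complex_linear_bounded_linear[OF \<sigma>] lim[OF that]])
  have ev1: "\<forall>\<^sub>F v' in ?N. \<forall>j\<in>{..<Suc k}. v' j \<in> D"
    using VD D by (intro eventually_ball_finite) (auto intro: topological_tendstoD[OF lim])
  have ev2: "\<forall>\<^sub>F v' in ?N. indep_family (Suc k) (\<lambda>j. \<sigma> (v' j))"
    by (rule eventually_indep_family[OF Vind lim\<sigma>])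
  have ev3: "\<forall>\<^sub>F v' in ?N. \<exists>w'\<in>D'. \<forall>j<Suc k. hdot (\<sigma> (v' j)) w' = 0"
    by (rule eventually_ex_orthogonal[OF Vind lim\<sigma> V0 D' w])
  have "z i \<in> vec.span (v ` {..<k})" if "i < 2*k-1" for i using P that by (simp add: P_def)
  then have "\<forall>i. \<exists>c. i < 2*k-1 \<longrightarrow> z i = (\<Sum>j<k. c j *s v j)" unfolding in_span_family by blast
  then obtain c where c: "\<And>i. i < 2*k-1 \<Longrightarrow> z i = (\<Sum>j<k. c i j *s v j)" by metis
  \<comment> \<open>The points \<open>z i\<close> move with the frame by keeping their coefficients,
    so the old values stay independent for frames near \<open>V\<close>.\<close>
  define Z where "Z v' i = (\<Sum>j<k. c i j *s v' j)" for v' :: "nat \<Rightarrow> complex ^ 'n" and i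
  have limZ: "((\<lambda>v'. Z v' i) \<longlongrightarrow> z i) ?N" if "i < 2*k-1" for i
  proof -
    have "((\<lambda>v'. c i j *s v' j) \<longlongrightarrow> c i j *s V j) ?N" if "j < k" for j
    proof (rule vec_tendstoI)
      fix l show "((\<lambda>v'. (c i j *s v' j) $ l) \<longlongrightarrow> (c i j *s V j) $ l) ?N"
        unfolding vector_smult_component using that by (intro tendsto_intros lim) simp
    qed
    then have "((\<lambda>v'. Z v' i) \<longlongrightarrow> (\<Sum>j<k. c i j *s V j)) ?N"
      unfolding Z_def by (intro tendsto_sum) auto
    then show ?thesis using c[OF that] Vk by simp
  qed
  have zD: "z i \<in> D" "f i \<in> \<C>" if "i < 2*k-1" for i using P that by (auto simp: P_def)
  have ev4: "\<forall>\<^sub>F v' in ?N. \<forall>i\<in>{..<2*k-1}. Z v' i \<in> D"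
    using zD D by (intro eventually_ball_finite) (auto intro: topological_tendstoD[OF limZ])
  have ev5: "\<forall>\<^sub>F v' in ?N. indep_family (2*k-1) (\<lambda>i. f i (Z v' i))"
  proof (rule eventually_indep_family)
    show "indep_family (2*k-1) (\<lambda>i. f i (z i))" using P by (simp add: P_def)
    show "((\<lambda>v'. f i (Z v' i)) \<longlongrightarrow> f i (z i)) ?N" if "i < 2*k-1" for i
      using cont[OF zD(2)[OF that]] zD(1)[OF that] D
      by (intro isCont_tendsto_compose[OF _ limZ[OF that]]) (simp add: continuous_on_eq_continuous_at)
  qed
  show thesis
  proof (rule that[OF k w VD Vind V0])
    show "\<forall>\<^sub>F v' in ?N. minors_vanish \<C> G (D \<inter> vec.span (v' ` {..<Suc k}))
         {\<xi> \<in> D'. \<forall>j<k. hdot (\<sigma> (v' j)) \<xi> = 0}"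
      using ev1 ev2 ev3 ev4 ev5
    proof eventually_elim
      case (elim v')
      show ?case
        unfolding minors_vanish_def
      proof (intro ballI)
        fix \<xi>1 \<xi>2 g1 g2 y1 y2
        assume \<xi>1: "\<xi>1 \<in> {\<xi> \<in> D'. \<forall>j<k. hdot (\<sigma> (v' j)) \<xi> = 0}"
          and \<xi>2: "\<xi>2 \<in> {\<xi> \<in> D'. \<forall>j<k. hdot (\<sigma> (v' j)) \<xi> = 0}" and g: "g1 \<in> \<C>" "g2 \<in> \<C>"
          and y: "y1 \<in> D \<inter> vec.span (v' ` {..<Suc k})" "y2 \<in> D \<inter> vec.span (v' ` {..<Suc k})"
        define n where "n = 2*k-1"
        define h where "h i = (if i < n then f i else if i = n then g1 else g2)" for i
        define q where "q i = (if i < n then Z v' i else if i = n then y1 else y2)" for i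
        have n2: "2 * Suc k - 1 = Suc (Suc n)" using k by (simp add: n_def)
        obtain w' where w': "w' \<in> D'" "\<forall>j<Suc k. hdot (\<sigma> (v' j)) w' = 0" using elim(3) by blast
        have Zspan: "Z v' i \<in> vec.span (v' ` {..<k})" for i
          unfolding Z_def in_span_family by blast
        have "v' ` {..<k} \<subseteq> v' ` {..<Suc k}" by auto
        then have "Z v' i \<in> vec.span (v' ` {..<Suc k})" for i
          using Zspan vec.span_mono by blast
        moreover have "\<And>i. i < n \<Longrightarrow> Z v' i \<in> D \<and> f i \<in> \<C>" using elim(4) zD(2) by (simp add: n_def)
        ultimately have "\<forall>i<Suc (Suc n). h i \<in> \<C> \<and> q i \<in> D \<inter> vec.span (v' ` {..<Suc k})"
          using y g unfolding h_def q_def by auto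
        \<comment> \<open>Length \<open>Suc k\<close> fails for every frame in \<open>D\<close>, so
          it fails for \<open>v'\<close> whichever two values are adjoined.\<close>
        moreover have "\<not> P (Suc k) v' w' h q" by (rule notP)
        ultimately have "\<not> indep_family (Suc (Suc n)) (\<lambda>i. h i (q i))"
          unfolding P_def n2 using w' elim(1,2) by blast
        then obtain a i where a: "(\<Sum>i<Suc (Suc n). a i *s h i (q i)) = 0" "i < Suc (Suc n)" "a i \<noteq> 0"
          unfolding indep_family_def by blast
        have sum: "(\<Sum>i<n. a i *s f i (Z v' i)) + a n *s g1 y1 + a (Suc n) *s g2 y2 = 0"
          using a(1) by (simp add: h_def q_def)
        \<comment> \<open>The old values are independent, so the relation involves a new one.
          Pairing it with \<open>G \<xi>\<close> kills the old values and leaves a two-term relation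
          with the same coefficients for \<open>\<xi>1\<close> and \<open>\<xi>2\<close>.\<close>
        have "a n \<noteq> 0 \<or> a (Suc n) \<noteq> 0"
        proof (rule ccontr)
          assume *: "\<not> (a n \<noteq> 0 \<or> a (Suc n) \<noteq> 0)"
          then have "(\<Sum>i<n. a i *s f i (Z v' i)) = 0" using sum by simp
          then have "i < n \<Longrightarrow> a i = 0" using indep_familyD[OF elim(5), of a i] by (simp add: n_def)
          then show False using a(2,3) * by (auto simp: less_Suc_eq)
        qed
        moreover have "a n * hdot (g1 y1) (G \<xi>) + a (Suc n) * hdot (g2 y2) (G \<xi>) = 0"
          if \<xi>: "\<xi> \<in> {\<xi> \<in> D'. \<forall>j<k. hdot (\<sigma> (v' j)) \<xi> = 0}" for \<xi>
        proof -
          have "hdot (f i (Z v' i)) (G \<xi>) = 0" if "i < n" for i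
          proof (rule orth)
            show "hdot (\<sigma> (Z v' i)) \<xi> = 0"
              by (rule hdot_image_span_eq_0[OF \<sigma> Zspan]) (use \<xi> in auto)
          qed (use elim(4) that zD(2) \<xi> in \<open>auto simp: n_def\<close>)
          then have "hdot ((\<Sum>i<n. a i *s f i (Z v' i)) + a n *s g1 y1 + a (Suc n) *s g2 y2) (G \<xi>)
              = a n * hdot (g1 y1) (G \<xi>) + a (Suc n) * hdot (g2 y2) (G \<xi>)"
            by (simp add: hdot_sum)
          then show ?thesis unfolding sum by simp
        qed
        note this[OF \<xi>1] this[OF \<xi>2]
        ultimately show "hdot (g1 y1) (G \<xi>1) * hdot (g2 y2) (G \<xi>2) = hdot (g1 y1) (G \<xi>2) * hdot (g2 y2) (G \<xi>1)"
          by algebra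
      qed
    qed
  qed
qed

section \<open>The degenerate case: all derivatives respect orthogonality\<close>

lemma hdot_dirder_eq_0:
  assumes F: "holomorphic_vec_on F D" and D: "open D" "z \<in> D"
    and 0: "\<And>t. z + t *s x \<in> D \<Longrightarrow> hdot (F (z + t *s x)) y = 0"
  shows "hdot (dirder F x z) y = 0"
proof -
  have "((\<lambda>t. hdot (F (z + t *s x)) y) has_field_derivative hdot (dirder F x (z + 0 *s x)) y) (at 0)"
    by (rule has_field_derivative_hdot_line[OF F]) (use D in simp)
  moreover have "((\<lambda>t. hdot (F (z + t *s x)) y) has_field_derivative 0) (at 0)"
    by (rule has_field_derivative_transform_within_open[OF DERIV_const[of 0] open_line[OF D(1), of z x]])
      (use D 0 in auto)
  ultimately show ?thesis using DERIV_unique by fastforce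
qed

lemma dirder_coord_space:
  assumes F: "holomorphic_vec_on F D" and D: "open D" "z \<in> D"
    and FQ: "\<And>z. z \<in> D \<Longrightarrow> F z \<in> coord_space Q"
  shows "dirder F x z \<in> coord_space Q"
  unfolding coord_space_def
proof (intro CollectI allI impI)
  fix i assume i: "i \<notin> Q"
  have "hdot (dirder F x z) (axis i 1) = 0"
    by (rule hdot_dirder_eq_0[OF F D]) (use FQ i in \<open>auto simp: component_eq_hdot[symmetric] coord_space_def\<close>)
  then show "dirder F x z $ i = 0" by (simp add: component_eq_hdot)
qed

text \<open>Moving \<open>v\<close> along \<open>e\<close> makes it orthogonal to a given
  \<open>\<xi>\<close>. For \<open>\<xi>\<close> near \<open>w\<close> the move is small, so a frame
  orthogonal to \<open>w\<close> can follow \<open>\<xi>\<close> continuously.\<close>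

lemma tendsto_orthogonal_correction:
  fixes \<sigma> :: "complex ^ 'n::finite \<Rightarrow> complex ^ 'n"
  assumes "hdot (\<sigma> v) w = 0" "hdot (\<sigma> e) w \<noteq> 0"
  shows "((\<lambda>\<xi>. v - (hdot (\<sigma> v) \<xi> / hdot (\<sigma> e) \<xi>) *s e) \<longlongrightarrow> v) (nhds w)"
proof -
  have "((\<lambda>\<xi>. hdot (\<sigma> v) \<xi> / hdot (\<sigma> e) \<xi>) \<longlongrightarrow> hdot (\<sigma> v) w / hdot (\<sigma> e) w) (nhds w)"
    by (intro tendsto_intros filterlim_ident assms(2))
  then have "((\<lambda>\<xi>. v - (hdot (\<sigma> v) \<xi> / hdot (\<sigma> e) \<xi>) *s e) \<longlongrightarrow> v - 0 *s e) (nhds w)"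
    unfolding assms(1) by (intro tendsto_intros bounded_linear.tendsto[OF bounded_linear_smult_left]) simp
  then show ?thesis by simp
qed

lemma orthogonal_correction:
  assumes "clinear \<sigma>" "hdot (\<sigma> e) \<xi> \<noteq> 0"
  shows "hdot (\<sigma> (v - (hdot (\<sigma> v) \<xi> / hdot (\<sigma> e) \<xi>) *s e)) \<xi> = 0"
  unfolding vec.linear_diff[OF assms(1)] vec.linear_scale[OF assms(1)] using assms(2) by simp

text \<open>
  Taking \<open>F\<close> and a derivative of \<open>F\<close> in the minors shows that \<open>hdot (F u) (G \<xi>) / hdot (F u) (G \<xi>0)\<close> is
  constant in \<open>u\<close>; it vanishes at the points \<open>u\<close> orthogonal to \<open>\<xi>\<close>. Then let \<open>\<xi>\<close> tend to \<open>\<xi>0\<close>.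
\<close>

lemma null_of_degenerate:
  fixes \<sigma> :: "complex ^ 'n::finite \<Rightarrow> complex ^ 'n" and F G :: "complex ^ 'n \<Rightarrow> complex ^ 'm::finite"
  assumes \<sigma>: "clinear \<sigma>" and D: "open D" "convex D" and D': "open D'"
    and F: "holomorphic_vec_on F D" and G: "continuous_on D' G"
    and orth: "\<And>z w. \<lbrakk>z \<in> D; w \<in> D'; hdot (\<sigma> z) w = 0\<rbrakk> \<Longrightarrow> hdot (F z) (G w) = 0"
    and dorth: "\<And>z w x. \<lbrakk>z \<in> D; w \<in> D'; hdot (\<sigma> z) w = 0\<rbrakk> \<Longrightarrow> hdot (dirder F x z) (G w) = 0"
    and FQ: "\<And>z. z \<in> D \<Longrightarrow> F z \<in> coord_space Q \<and> F z \<noteq> 0"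
    and GQ: "\<And>w. w \<in> D' \<Longrightarrow> G w \<in> coord_space Q \<and> G w \<noteq> 0"
    and e: "\<And>w. w \<in> D' \<Longrightarrow> hdot (\<sigma> e) w \<noteq> 0"
    and card: "card Q + 3 \<le> 2 * vec.dim (range \<sigma>)"
    and start: "z0 \<in> D" "w0 \<in> D'" "hdot (\<sigma> z0) w0 = 0" "\<sigma> z0 \<noteq> 0"
  obtains T where "open T" "T \<noteq> {}" "T \<subseteq> D'" "\<And>z w. z \<in> D \<Longrightarrow> w \<in> T \<Longrightarrow> hdot (F z) (G w) = 0"
proof -
  define \<C> where "\<C> = insert F (range (dirder F))"
  define M where "M k v' \<longleftrightarrow> minors_vanish \<C> G (D \<inter> vec.span (v' ` {..<Suc k}))
         {\<xi> \<in> D'. \<forall>j<k. hdot (\<sigma> (v' j)) \<xi> = 0}"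
    for k and v' :: "nat \<Rightarrow> complex ^ 'n"
  obtain k v w where k: "1 \<le> k" and w: "w \<in> D'" and v: "\<And>j. j < Suc k \<Longrightarrow> v j \<in> D"
    "indep_family (Suc k) (\<lambda>j. \<sigma> (v j))" "\<And>j. j < Suc k \<Longrightarrow> hdot (\<sigma> (v j)) w = 0"
    and M: "\<forall>\<^sub>F v' in near (Suc k) v. M k v'"
    unfolding M_def
  proof (rule flag_lemma[OF \<sigma> D(1) D', of \<C> G Q e z0 w0 F])
    show "continuous_on D f" if "f \<in> \<C>" for f
      using that holomorphic_vec_on_continuous_on[OF F] continuous_on_dirder[OF F D(1)] by (auto simp: \<C>_def)
    show "hdot (f z) (G w) = 0" if "f \<in> \<C>" "z \<in> D" "w \<in> D'" "hdot (\<sigma> z) w = 0" for f z w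
      using that orth dorth by (auto simp: \<C>_def)
    show "f z \<in> coord_space Q" if "f \<in> \<C>" "z \<in> D" for f z
      using that FQ dirder_coord_space[OF F D(1) that(2)] by (auto simp: \<C>_def)
    show "F \<in> \<C>" by (simp add: \<C>_def)
  qed (use GQ FQ e card start in auto)
  define V where "V \<xi> j = v j - (hdot (\<sigma> (v j)) \<xi> / hdot (\<sigma> e) \<xi>) *s e" for \<xi> j
  have limV: "((\<lambda>\<xi>. V \<xi> j) \<longlongrightarrow> v j) (nhds w)" if "j < Suc k" for j
    unfolding V_def by (rule tendsto_orthogonal_correction[of \<sigma>, OF v(3)[OF that] e[OF w]])
  have lim\<sigma>V: "((\<lambda>\<xi>. \<sigma> (V \<xi> j)) \<longlongrightarrow> \<sigma> (v j)) (nhds w)" if "j < Suc k" for j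
    by (rule bounded_linear.tendsto[OF complex_linear_bounded_linear[OF \<sigma>] limV[OF that]])
  have "\<forall>\<^sub>F \<xi> in nhds w. \<xi> \<in> D' \<and> indep_family (Suc k) (\<lambda>j. \<sigma> (V \<xi> j)) \<and>
      (\<forall>\<^sub>F v' in near (Suc k) (V \<xi>). M k v') \<and> (\<forall>j\<in>{..<Suc k}. V \<xi> j \<in> D)"
  proof (intro eventually_conj)
    show "\<forall>\<^sub>F \<xi> in nhds w. \<xi> \<in> D'" by (rule eventually_nhds_in_open[OF D' w])
    show "\<forall>\<^sub>F \<xi> in nhds w. indep_family (Suc k) (\<lambda>j. \<sigma> (V \<xi> j))"
      by (rule eventually_indep_family[OF v(2) lim\<sigma>V])
    show "\<forall>\<^sub>F \<xi> in nhds w. \<forall>\<^sub>F v' in near (Suc k) (V \<xi>). M k v'"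
      using filterlim_near[of "Suc k" V v "nhds w", OF limV] eventually_eventually_near[OF M]
      unfolding filterlim_iff by blast
    show "\<forall>\<^sub>F \<xi> in nhds w. \<forall>j\<in>{..<Suc k}. V \<xi> j \<in> D"
      using v(1) D(1) by (intro eventually_ball_finite) (auto intro: topological_tendstoD[OF limV])
  qed
  then obtain T where T: "open T" "w \<in> T" and T': "\<And>\<xi>. \<xi> \<in> T \<Longrightarrow> \<xi> \<in> D' \<and> indep_family (Suc k) (\<lambda>j. \<sigma> (V \<xi> j)) \<and>
      (\<forall>\<^sub>F v' in near (Suc k) (V \<xi>). M k v') \<and> (\<forall>j\<in>{..<Suc k}. V \<xi> j \<in> D)"
    unfolding eventually_nhds by blast
  show thesis
  proof (rule that[OF T(1)])
    fix a \<xi>0 assume a: "a \<in> D" and \<xi>0: "\<xi>0 \<in> T"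
    show "hdot (F a) (G \<xi>0) = 0"
    proof (rule ccontr)
      assume ne: "hdot (F a) (G \<xi>0) \<noteq> 0"
      \<comment> \<open>The value at \<open>a\<close> stays nonzero near \<open>\<xi>0\<close>. The
        contradiction will be some \<open>\<xi>\<close> in \<open>U\<close> with
        \<open>hdot (F a) (G \<xi>) = 0\<close>.\<close>
      define U where "U = D' \<inter> (\<lambda>\<xi>. hdot (F a) (G \<xi>)) -` (- {0})"
      have "open U"
        unfolding U_def by (rule continuous_open_preimage) (use G D' in \<open>auto intro: continuous_intros\<close>)
      have "\<xi>0 \<in> U" using ne T'[OF \<xi>0] by (simp add: U_def)
      let ?W = "V \<xi>0"
      have W0: "hdot (\<sigma> (?W j)) \<xi>0 = 0" for j
        unfolding V_def using T'[OF \<xi>0] by (intro orthogonal_correction[OF \<sigma> e]) simp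
      have lim: "((\<lambda>v'. \<sigma> (v' j)) \<longlongrightarrow> \<sigma> (?W j)) (near (Suc k) ?W)" if "j < Suc k" for j
        by (rule bounded_linear.tendsto[OF complex_linear_bounded_linear[OF \<sigma>] tendsto_near[OF that]])
      have "\<forall>\<^sub>F v' in near (Suc k) ?W. M k v' \<and> (\<exists>\<xi>\<in>U. \<forall>j<Suc k. hdot (\<sigma> (v' j)) \<xi> = 0)"
        using T'[OF \<xi>0] by (intro eventually_conj eventually_ex_orthogonal[OF _ lim W0 \<open>open U\<close> \<open>\<xi>0 \<in> U\<close>]) auto
      then obtain \<epsilon> where \<epsilon>: "\<epsilon> > 0" "\<And>v'. (\<forall>j<Suc k. dist (v' j) (?W j) < \<epsilon>) \<Longrightarrow>
          M k v' \<and> (\<exists>\<xi>\<in>U. \<forall>j<Suc k. hdot (\<sigma> (v' j)) \<xi> = 0)"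
        unfolding eventually_near by blast
      define S where "S = D \<inter> ball (?W k) \<epsilon>"
      have S: "open S" "?W k \<in> S" "S \<subseteq> D" using D(1) \<epsilon>(1) T'[OF \<xi>0] by (auto simp: S_def)
      \<comment> \<open>Only the last member varies. The minors concern the complement of the first
        \<open>k\<close> members, so a single pair \<open>\<xi>0\<close>, \<open>\<xi>\<close>
        serves for all \<open>u\<close> in \<open>S\<close>.\<close>
      have frame: "M k (?W(k := u)) \<and> (\<exists>\<xi>\<in>U. \<forall>j<Suc k. hdot (\<sigma> ((?W(k := u)) j)) \<xi> = 0)" if "u \<in> S" for u
        using that \<epsilon>(1) by (intro \<epsilon>(2)) (auto simp: S_def dist_commute)
      obtain u where u: "u \<in> S" "hdot (F u) (G \<xi>0) \<noteq> 0"
        using line_holomorphic_on_eq_0[OF line_holomorphic_on_hdot[OF F D(1)] D S(1) _ S(3) _ a, of "G \<xi>0"] S(2) ne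
        by auto
      obtain \<xi> where \<xi>: "\<xi> \<in> U" "\<And>j. j < Suc k \<Longrightarrow> hdot (\<sigma> ((?W(k := u)) j)) \<xi> = 0"
        using frame[OF u(1)] by blast
      have \<xi>D: "\<xi> \<in> D'" using \<xi>(1) by (simp add: U_def)
      have \<xi>W: "hdot (\<sigma> (?W j)) \<xi> = 0" if "j < k" for j using \<xi>(2)[of j] that by simp
      have "hdot (F a) (G \<xi>) = 0"
      proof (rule eq_0_of_dirder_zero[OF F D S(1) u(1) S(3) u(2) _ _ a])
        show "hdot (F u) (G \<xi>) = 0"
          using orth[of u \<xi>] u S(3) \<xi>(2)[of k] \<xi>D by auto
        fix z x assume z: "z \<in> S"
        have zz: "z \<in> D \<inter> vec.span ((?W(k := z)) ` {..<Suc k})"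
          using z S(3) by (auto intro!: vec.span_base rev_image_eqI[of k])
        have cl: "F \<in> \<C>" "dirder F x \<in> \<C>" by (auto simp: \<C>_def)
        have o: "\<xi>0 \<in> {\<xi> \<in> D'. \<forall>j<k. hdot (\<sigma> ((?W(k := z)) j)) \<xi> = 0}"
          "\<xi> \<in> {\<xi> \<in> D'. \<forall>j<k. hdot (\<sigma> ((?W(k := z)) j)) \<xi> = 0}"
          using W0 \<xi>W T'[OF \<xi>0] \<xi>D by auto
        have "M k (?W(k := z))" using frame[OF z] by blast
        from this[unfolded M_def minors_vanish_def, THEN bspec, THEN bspec, THEN bspec, THEN bspec, THEN bspec, THEN bspec,
            OF o cl zz zz]
        show "hdot (F z) (G \<xi>0) * hdot (dirder F x z) (G \<xi>) = hdot (F z) (G \<xi>) * hdot (dirder F x z) (G \<xi>0)" .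
      qed
      then show False using \<xi>(1) by (simp add: U_def)
    qed
  qed (use T T' in auto)
qed

section \<open>The nondegenerate case: factoring the source form out of the pairing\<close>

lemma has_derivative_hdot_right:
  assumes "(G has_derivative G') (at w)"
  shows "((\<lambda>w. hdot y (G w)) has_derivative (\<lambda>h. hdot y (G' h))) (at w)"
  by (rule bounded_linear.has_derivative[OF bounded_bilinear.bounded_linear_right[OF bounded_bilinear_hdot] assms])

lemma has_derivative_eq_0_of_locally_constant:
  fixes R :: "'a::real_normed_vector \<Rightarrow> 'b::real_normed_vector"
  assumes R: "(R has_derivative R') (at \<xi>)" and c: "\<forall>\<^sub>F t in at 0. R (\<xi> + t *\<^sub>R \<eta>) = R \<xi>"
  shows "R' \<eta> = 0"
proof -
  have "((\<lambda>t::real. \<xi> + t *\<^sub>R \<eta>) has_derivative (\<lambda>t. t *\<^sub>R \<eta>)) (at 0)"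
    by (auto intro!: derivative_eq_intros)
  moreover have "(R has_derivative R') (at (\<xi> + 0 *\<^sub>R \<eta>))" using R by simp
  ultimately have "((\<lambda>t. R (\<xi> + t *\<^sub>R \<eta>)) has_derivative (\<lambda>t. R' (t *\<^sub>R \<eta>))) (at 0)"
    by (rule has_derivative_compose)
  moreover have "((\<lambda>t::real. R (\<xi> + t *\<^sub>R \<eta>)) has_derivative (\<lambda>t. 0)) (at 0)"
    by (rule has_derivative_transform_eventually[OF has_derivative_const])
      (use c in \<open>auto elim: eventually_mono\<close>)
  ultimately have "(\<lambda>t::real. R' (t *\<^sub>R \<eta>)) = (\<lambda>t. 0)" by (rule has_derivative_unique)
  then show ?thesis by (metis scaleR_one)
qed

text \<open>
  The ratio \<open>R\<close> of the proof is constant on the orthogonal complement of each admissible frame \<open>v'\<close>, so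
  its derivative at \<open>\<xi>\<close> vanishes on the complements of all frames orthogonal to \<open>\<xi>\<close>; these span the space.
\<close>

lemma split_of_nondegenerate:
  fixes \<sigma> :: "complex ^ 'n::finite \<Rightarrow> complex ^ 'n" and F G :: "complex ^ 'n \<Rightarrow> complex ^ 'm::finite"
  assumes \<sigma>: "clinear \<sigma>" and D: "open D" and D': "open D'"
    and F: "holomorphic_vec_on F D" and G: "holomorphic_vec_on G D'"
    and orth: "\<And>z w. \<lbrakk>z \<in> D; w \<in> D'; hdot (\<sigma> z) w = 0\<rbrakk> \<Longrightarrow> hdot (F z) (G w) = 0"
    and e: "\<And>w. w \<in> D' \<Longrightarrow> hdot (\<sigma> e) w \<noteq> 0"
    and nd: "\<And>z w. \<lbrakk>z \<in> D; w \<in> D'\<rbrakk> \<Longrightarrow> hdot (dirder F e z) (G w) \<noteq> 0"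
    and FQ: "\<And>z. z \<in> D \<Longrightarrow> F z \<in> coord_space Q \<and> F z \<noteq> 0"
    and GQ: "\<And>w. w \<in> D' \<Longrightarrow> G w \<in> coord_space Q \<and> G w \<noteq> 0"
    and card: "card Q + 3 \<le> 2 * vec.dim (range \<sigma>)"
    and start: "z0 \<in> D" "w0 \<in> D'" "hdot (\<sigma> z0) w0 = 0" "\<sigma> z0 \<noteq> 0"
  obtains S T p q where "open S" "S \<noteq> {}" "S \<subseteq> D" "open T" "T \<noteq> {}" "T \<subseteq> D'"
    "\<And>z. z \<in> S \<Longrightarrow> p z \<noteq> 0" "\<And>w. w \<in> T \<Longrightarrow> q w \<noteq> 0"
    "\<And>z w. z \<in> S \<Longrightarrow> w \<in> T \<Longrightarrow> hdot (F z) (G w) = p z * q w * hdot (\<sigma> z) w"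
proof -
  define H where "H z w = hdot (F z) (G w)" for z w
  define B where "B z w = hdot (\<sigma> z) w" for z w
  have HB: "B z w \<noteq> 0" if "H z w \<noteq> 0" "z \<in> D" "w \<in> D'" for z w
    using that orth by (auto simp: H_def B_def)
  obtain k v w where k: "1 \<le> k" and w: "w \<in> D'" and v: "\<And>j. j < Suc k \<Longrightarrow> v j \<in> D"
    "indep_family (Suc k) (\<lambda>j. \<sigma> (v j))" "\<And>j. j < Suc k \<Longrightarrow> hdot (\<sigma> (v j)) w = 0"
    and M: "\<forall>\<^sub>F v' in near (Suc k) v. minors_vanish {F} G (D \<inter> vec.span (v' ` {..<Suc k}))
         {\<xi> \<in> D'. \<forall>j<k. hdot (\<sigma> (v' j)) \<xi> = 0}"
    by (rule flag_lemma[OF \<sigma> D(1) D', of "{F}" G Q e z0 w0 F])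
      (use GQ FQ e card start orth holomorphic_vec_on_continuous_on[OF F] in auto)
  obtain \<epsilon> where \<epsilon>: "\<epsilon> > 0" and M': "\<And>v' \<xi>1 \<xi>2 y1 y2. \<lbrakk>\<forall>j<Suc k. dist (v' j) (v j) < \<epsilon>; \<xi>1 \<in> D'; \<xi>2 \<in> D';
      y1 \<in> D \<inter> vec.span (v' ` {..<Suc k}); y2 \<in> D \<inter> vec.span (v' ` {..<Suc k});
      \<forall>j<k. B (v' j) \<xi>1 = 0; \<forall>j<k. B (v' j) \<xi>2 = 0\<rbrakk> \<Longrightarrow> H y1 \<xi>1 * H y2 \<xi>2 = H y1 \<xi>2 * H y2 \<xi>1"
    using M unfolding eventually_near minors_vanish_def B_def H_def by auto
  \<comment> \<open>For \<open>B z \<xi> = 0\<close> the derivative at \<open>z\<close>, paired with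
    \<open>G \<xi>\<close>, is a functional of the direction \<open>u\<close> that vanishes wherever
    \<open>B u \<xi>\<close> does. \<open>K\<close> is the factor between the two, read off at
    \<open>u = e\<close>.\<close>
  define K where "K z \<xi> = hdot (dirder F e z) (G \<xi>) / B e \<xi>" for z \<xi>
  have dir: "hdot (dirder F u z) (G \<xi>) = B u \<xi> * K z \<xi>" if z: "z \<in> D" and \<xi>: "\<xi> \<in> D'" "B z \<xi> = 0" for u z \<xi>
  proof -
    define c where "c = B u \<xi> / B e \<xi>"
    have "hdot (dirder F (u - c *s e) z) (G \<xi>) = 0"
    proof (rule hdot_dirder_eq_0[OF F D z])
      fix t assume t: "z + t *s (u - c *s e) \<in> D"
      have "hdot (\<sigma> (z + t *s (u - c *s e))) \<xi> = 0"
        using \<xi> e[OF \<xi>(1)]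
        by (simp add: vec.linear_add[OF \<sigma>] vec.linear_scale[OF \<sigma>] vec.linear_diff[OF \<sigma>] B_def c_def del: vec.scale_right_diff_distrib)
      then show "hdot (F (z + t *s (u - c *s e))) (G \<xi>) = 0" by (rule orth[OF t \<xi>(1)])
    qed
    then show ?thesis
      by (simp add: holomorphic_vec_on_has_derivative(2)[OF F z, THEN vec.linear_diff]
          holomorphic_vec_on_has_derivative(2)[OF F z, THEN vec.linear_scale] c_def K_def)
  qed
  have Kne: "K z \<xi> \<noteq> 0" if "z \<in> D" "\<xi> \<in> D'" for z \<xi>
    using nd[OF that] e[OF that(2)] by (simp add: K_def B_def)
  \<comment> \<open>The minor for the values at \<open>v' 0 + t *s u\<close> and at
    \<open>u\<close>, differentiated at \<open>t = 0\<close>. The factor \<open>K (v' 0)\<close>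
    does not depend on \<open>u\<close>: along the complement of the frame, the ratios of
    \<open>H u\<close> to \<open>B u\<close> change by the same factor for all
    \<open>u\<close>.\<close>
  have E: "B u \<xi>1 * K (v' 0) \<xi>1 * H u \<xi>2 = B u \<xi>2 * K (v' 0) \<xi>2 * H u \<xi>1"
    if v': "\<And>j. j < k \<Longrightarrow> dist (v' j) (v j) < \<epsilon>" "v' 0 \<in> D" and u: "dist u (v k) < \<epsilon>" "u \<in> D"
      and \<xi>: "\<xi>1 \<in> D'" "\<xi>2 \<in> D'" "\<And>j. j < k \<Longrightarrow> B (v' j) \<xi>1 = 0" "\<And>j. j < k \<Longrightarrow> B (v' j) \<xi>2 = 0"
    for v' u \<xi>1 \<xi>2
  proof -
    let ?v = "v'(k := u)"
    have "hdot (dirder F u (v' 0)) (cnj (H u \<xi>2) *s G \<xi>1 - cnj (H u \<xi>1) *s G \<xi>2) = 0"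
    proof (rule hdot_dirder_eq_0[OF F D v'(2)])
      fix t assume t: "v' 0 + t *s u \<in> D"
      have "H (v' 0 + t *s u) \<xi>1 * H u \<xi>2 = H (v' 0 + t *s u) \<xi>2 * H u \<xi>1"
      proof (rule M'[of ?v])
        have "v' 0 \<in> vec.span (?v ` {..<Suc k})" using k by (auto intro!: vec.span_base rev_image_eqI[of 0])
        moreover have us: "u \<in> vec.span (?v ` {..<Suc k})" by (auto intro!: vec.span_base rev_image_eqI[of k])
        ultimately show "v' 0 + t *s u \<in> D \<inter> vec.span (?v ` {..<Suc k})"
          using t vec.span_add vec.span_scale by blast
        show "u \<in> D \<inter> vec.span (?v ` {..<Suc k})" using us u by blast
      qed (use v' u \<xi> in auto)
      then show "hdot (F (v' 0 + t *s u)) (cnj (H u \<xi>2) *s G \<xi>1 - cnj (H u \<xi>1) *s G \<xi>2) = 0"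
        by (simp add: H_def mult.commute)
    qed
    then show ?thesis
      using dir[OF v'(2) \<xi>(1), of u] dir[OF v'(2) \<xi>(2), of u] \<xi>(3,4)[of 0] k by (simp add: mult.commute)
  qed
  have ball_k: "open (D \<inter> ball (v k) \<epsilon>)" "v k \<in> D \<inter> ball (v k) \<epsilon>" using D \<epsilon> v(1) by auto
  have "\<exists>u\<in>D \<inter> ball (v k) \<epsilon>. H u w \<noteq> 0"
  proof (rule ccontr)
    assume *: "\<not> ?thesis"
    have "hdot (dirder F e (v k)) (G w) = 0"
      by (rule hdot_dirder_eq_0[OF holomorphic_vec_on_subset[OF F] ball_k]) (use * in \<open>auto simp: H_def\<close>)
    then show False using nd[OF v(1) w] by simp
  qed
  then obtain u0 where u0: "u0 \<in> D \<inter> ball (v k) \<epsilon>" "H u0 w \<noteq> 0" by blast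
  have "continuous_on (D \<times> D') (\<lambda>x. H (fst x) (snd x))"
    unfolding H_def
    by (intro continuous_intros continuous_on_compose2[OF holomorphic_vec_on_continuous_on[OF F]]
        continuous_on_compose2[OF holomorphic_vec_on_continuous_on[OF G]]) auto
  then have "open ((D \<times> D') \<inter> (\<lambda>x. H (fst x) (snd x)) -` (- {0}))"
    by (rule continuous_open_preimage) (use D D' in \<open>auto intro: open_Times\<close>)
  moreover have "(u0, w) \<in> (D \<times> D') \<inter> (\<lambda>x. H (fst x) (snd x)) -` (- {0})" using u0 w by auto
  ultimately obtain S0 T0 where ST0: "open S0" "open T0" "u0 \<in> S0" "w \<in> T0"
    "S0 \<times> T0 \<subseteq> (D \<times> D') \<inter> (\<lambda>x. H (fst x) (snd x)) -` (- {0})"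
    by (elim open_prod_elim) auto
  define S where "S = S0 \<inter> (D \<inter> ball (v k) \<epsilon>)"
  have S: "open S" "u0 \<in> S" "S \<subseteq> D" using ST0 ball_k u0 by (auto simp: S_def)
  have Hne: "H u \<xi> \<noteq> 0" "\<xi> \<in> D'" if "u \<in> S" "\<xi> \<in> T0" for u \<xi> using that ST0(5) by (auto simp: S_def)
  define V where "V \<xi> j = v j - (hdot (\<sigma> (v j)) \<xi> / hdot (\<sigma> e) \<xi>) *s e" for \<xi> j
  have limV: "((\<lambda>\<xi>. V \<xi> j) \<longlongrightarrow> v j) (nhds w)" if "j < Suc k" for j
    unfolding V_def by (rule tendsto_orthogonal_correction[of \<sigma>, OF v(3)[OF that] e[OF w]])
  have lim\<sigma>V: "((\<lambda>\<xi>. \<sigma> (V \<xi> j)) \<longlongrightarrow> \<sigma> (v j)) (nhds w)" if "j < Suc k" for j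
    by (rule bounded_linear.tendsto[OF complex_linear_bounded_linear[OF \<sigma>] limV[OF that]])
  have "\<forall>\<^sub>F \<xi> in nhds w. \<xi> \<in> T0 \<and> indep_family (Suc k) (\<lambda>j. \<sigma> (V \<xi> j)) \<and>
      (\<forall>j\<in>{..<Suc k}. V \<xi> j \<in> D \<inter> ball (v j) \<epsilon>)"
  proof (intro eventually_conj)
    show "\<forall>\<^sub>F \<xi> in nhds w. \<xi> \<in> T0" by (rule eventually_nhds_in_open[OF ST0(2,4)])
    show "\<forall>\<^sub>F \<xi> in nhds w. indep_family (Suc k) (\<lambda>j. \<sigma> (V \<xi> j))"
      by (rule eventually_indep_family[OF v(2) lim\<sigma>V])
    show "\<forall>\<^sub>F \<xi> in nhds w. \<forall>j\<in>{..<Suc k}. V \<xi> j \<in> D \<inter> ball (v j) \<epsilon>"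
    proof (intro eventually_ball_finite ballI)
      fix j assume "j \<in> {..<Suc k}"
      then show "\<forall>\<^sub>F \<xi> in nhds w. V \<xi> j \<in> D \<inter> ball (v j) \<epsilon>"
        using v(1) D \<epsilon> by (intro topological_tendstoD[OF limV]) auto
    qed simp
  qed
  then obtain \<delta> where \<delta>: "\<delta> > 0" and \<delta>': "\<And>\<xi>. \<xi> \<in> ball w \<delta> \<Longrightarrow> \<xi> \<in> T0 \<and> indep_family (Suc k) (\<lambda>j. \<sigma> (V \<xi> j)) \<and>
      (\<forall>j\<in>{..<Suc k}. V \<xi> j \<in> D \<inter> ball (v j) \<epsilon>)"
    unfolding eventually_nhds_metric by (metis mem_ball dist_commute)
  define T where "T = ball w \<delta>"
  have T: "open T" "w \<in> T" "T \<subseteq> T0" "T \<subseteq> D'"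
    using \<delta> \<delta>' Hne(2)[OF S(2)] by (auto simp: T_def)
  have HT: "H u \<xi> \<noteq> 0" "B u \<xi> \<noteq> 0" if "u \<in> S" "\<xi> \<in> T" for u \<xi>
    using Hne[of u \<xi>] HB[of u \<xi>] that T S by auto
  \<comment> \<open>The ratio of \<open>H\<close> to \<open>B\<close> at \<open>u\<close>, divided
    by the same ratio at \<open>u0\<close>. A factorisation of \<open>H\<close> through
    \<open>B\<close> means that this quotient is constant in \<open>\<xi>\<close>.\<close>
  define R where "R u \<xi> = (H u \<xi> * B u0 \<xi>) / (H u0 \<xi> * B u \<xi>)" for u \<xi>
  have Rconst: "R u \<xi> = R u w" if u: "u \<in> S" and \<xi>: "\<xi> \<in> T" for u \<xi>
  proof -
    have "\<exists>R'. (R u has_derivative R') (at \<xi>)" if \<xi>: "\<xi> \<in> T" for \<xi>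
    proof -
      have dG: "(G has_derivative (\<lambda>h. dirder G h \<xi>)) (at \<xi>)"
        using holomorphic_vec_on_has_derivative(1)[OF G] T \<xi> by blast
      show ?thesis
        unfolding R_def H_def B_def
        by (rule exI, rule has_derivative_divide'[OF has_derivative_mult has_derivative_mult])
          (use HT \<xi> u S in \<open>auto intro!: has_derivative_hdot_right dG has_derivative_ident simp: H_def B_def\<close>)
    qed
    then obtain R' where R': "\<And>\<xi>. \<xi> \<in> T \<Longrightarrow> (R u has_derivative R' \<xi>) (at \<xi>)" by metis
    have "(R u has_derivative (\<lambda>h. 0)) (at \<xi> within T)" if \<xi>: "\<xi> \<in> T" for \<xi>
    proof -
      define Y where "Y = {\<eta>. \<exists>v'. (\<forall>j<k. dist (v' j) (v j) < \<epsilon> \<and> v' j \<in> D \<and> B (v' j) \<xi> = 0 \<and> B (v' j) \<eta> = 0)}"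
      have "R' \<xi> \<eta> = 0" if "\<eta> \<in> Y" for \<eta>
      proof (rule has_derivative_eq_0_of_locally_constant[OF R'[OF \<xi>]])
        obtain v' where v': "\<And>j. j < k \<Longrightarrow> dist (v' j) (v j) < \<epsilon> \<and> v' j \<in> D \<and> B (v' j) \<xi> = 0 \<and> B (v' j) \<eta> = 0"
          using \<open>\<eta> \<in> Y\<close> unfolding Y_def by blast
        have "((\<lambda>t::real. \<xi> + t *\<^sub>R \<eta>) \<longlongrightarrow> \<xi> + 0 *\<^sub>R \<eta>) (at 0)" by (intro tendsto_intros)
        then have "\<forall>\<^sub>F t::real in at 0. \<xi> + t *\<^sub>R \<eta> \<in> T"
          using T(1) \<xi> by (auto dest: topological_tendstoD)
        then show "\<forall>\<^sub>F t::real in at 0. R u (\<xi> + t *\<^sub>R \<eta>) = R u \<xi>"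
        proof (rule eventually_mono)
          fix t :: real assume t: "\<xi> + t *\<^sub>R \<eta> \<in> T"
          let ?\<xi>' = "\<xi> + t *\<^sub>R \<eta>"
          \<comment> \<open>The frame is orthogonal to \<open>\<eta>\<close> as well, hence to
            \<open>?\<xi>'\<close>. The same change of \<open>K\<close> occurs for \<open>u\<close>
            and \<open>u0\<close> and cancels in \<open>R\<close>.\<close>
          have E': "B u' \<xi> * K (v' 0) \<xi> * H u' ?\<xi>' = B u' ?\<xi>' * K (v' 0) ?\<xi>' * H u' \<xi>" if "u' \<in> S" for u'
            using v' that t \<xi> T k by (intro E) (auto simp: S_def dist_commute B_def)
          have ne: "K (v' 0) \<xi> \<noteq> 0" "K (v' 0) ?\<xi>' \<noteq> 0"
            using Kne[of "v' 0"] v'[of 0] k subsetD[OF T(4) \<xi>] subsetD[OF T(4) t] by simp_all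
          note nz = HT[OF u \<xi>] HT[OF u t] HT[OF S(2) \<xi>] HT[OF S(2) t]
          have h1: "H u ?\<xi>' = B u ?\<xi>' * K (v' 0) ?\<xi>' * H u \<xi> / (B u \<xi> * K (v' 0) \<xi>)"
            using E'[OF u] ne nz by (simp add: field_simps)
          have h2: "H u0 ?\<xi>' = B u0 ?\<xi>' * K (v' 0) ?\<xi>' * H u0 \<xi> / (B u0 \<xi> * K (v' 0) \<xi>)"
            using E'[OF S(2)] ne nz by (simp add: field_simps)
          show "R u ?\<xi>' = R u \<xi>"
            unfolding R_def h1 h2 using ne nz by (simp add: field_simps)
        qed
      qed
      moreover have "span Y = UNIV"
      proof (rule ccontr)
        assume "span Y \<noteq> UNIV"
        then obtain a where a: "a \<noteq> 0" "\<And>\<eta>. \<eta> \<in> span Y \<Longrightarrow> a \<bullet> \<eta> = 0"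
          using span_not_univ_subset_hyperplane[of Y] by blast
        have Vind: "indep_family (Suc k) (\<lambda>j. \<sigma> (V \<xi> j))"
          and VD: "\<And>j. j < Suc k \<Longrightarrow> V \<xi> j \<in> D \<inter> ball (v j) \<epsilon>"
          using \<delta>' \<xi> by (auto simp: T_def)
        have V0: "B (V \<xi> j) \<xi> = 0" for j
          unfolding V_def B_def using \<xi> T by (intro orthogonal_correction[OF \<sigma> e]) auto
        \<comment> \<open>Once the frame misses \<open>a\<close>, the component of \<open>a\<close>
          orthogonal to the frame is a nonzero member of \<open>Y\<close> whose inner product with
          \<open>a\<close> is its own squared norm.\<close>
        have "\<exists>v'. (\<forall>j<k. v' j \<in> D \<inter> ball (v j) \<epsilon> \<and> B (v' j) \<xi> = 0) \<and> a \<notin> vec.span ((\<lambda>j. \<sigma> (v' j)) ` {..<k})"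
        proof (cases "a \<in> vec.span ((\<lambda>j. \<sigma> (V \<xi> j)) ` {..<k})")
          case False
          then show ?thesis using VD V0 by (intro exI[of _ "V \<xi>"]) auto
        next
          case True
          then obtain c where c: "a = (\<Sum>j<k. c j *s \<sigma> (V \<xi> j))" unfolding in_span_family by blast
          obtain i where i: "i < k" "c i \<noteq> 0"
          proof (rule ccontr)
            assume "\<not> thesis"
            then have "\<And>j. j < k \<Longrightarrow> c j = 0" using that by blast
            then show False using c a(1) by simp
          qed
          have "open (D \<inter> ball (v i) \<epsilon>)" "V \<xi> i \<in> D \<inter> ball (v i) \<epsilon>" using VD[of i] i D by auto
          then obtain t where t: "V \<xi> i + t *s V \<xi> k \<in> D \<inter> ball (v i) \<epsilon>" "t \<noteq> 0" by (rule ex_small_step)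
          \<comment> \<open>The spare member \<open>V \<xi> k\<close> tilts member \<open>i\<close>.
            Representing \<open>a\<close> in the tilted frame would require both
            \<open>d i = c i\<close> and \<open>d i * t = 0\<close>.\<close>
          let ?v = "(V \<xi>)(i := V \<xi> i + t *s V \<xi> k)"
          have "a \<notin> vec.span ((\<lambda>j. \<sigma> (?v j)) ` {..<k})"
          proof
            assume "a \<in> vec.span ((\<lambda>j. \<sigma> (?v j)) ` {..<k})"
            then obtain d where d: "a = (\<Sum>j<k. d j *s \<sigma> (?v j))" unfolding in_span_family by blast
            have "(\<Sum>j<k. d j *s \<sigma> (?v j)) = (\<Sum>j<k. d j *s \<sigma> (V \<xi> j) + (if j = i then (d i * t) *s \<sigma> (V \<xi> k) else 0))"
              by (intro sum.cong) (auto simp: vec.linear_add[OF \<sigma>] vec.linear_scale[OF \<sigma>] vec.scale_right_distrib)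
            also have "\<dots> = (\<Sum>j<k. d j *s \<sigma> (V \<xi> j)) + (d i * t) *s \<sigma> (V \<xi> k)"
              using i by (simp add: sum.distrib)
            finally have "(\<Sum>j<k. d j *s \<sigma> (V \<xi> j)) + (d i * t) *s \<sigma> (V \<xi> k) - (\<Sum>j<k. c j *s \<sigma> (V \<xi> j)) = 0"
              using c d by simp
            then have "(\<Sum>j<Suc k. (if j = k then d i * t else d j - c j) *s \<sigma> (V \<xi> j)) = 0"
              by (simp add: vec.scale_left_diff_distrib sum_subtractf algebra_simps)
            note * = indep_familyD[OF Vind this]
            have "d i * t = 0" using *[of k] by simp
            moreover have "d i = c i" using *[of i] i by simp
            ultimately show False using i t by simp
          qed
          moreover have "B (?v j) \<xi> = 0" for j
            using V0[of i] V0[of k] V0[of j]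
            by (auto simp: B_def vec.linear_add[OF \<sigma>] vec.linear_scale[OF \<sigma>])
          ultimately show ?thesis using VD t by (intro exI[of _ ?v]) auto
        qed
        then obtain v' where v': "\<And>j. j < k \<Longrightarrow> v' j \<in> D \<inter> ball (v j) \<epsilon> \<and> B (v' j) \<xi> = 0"
          "a \<notin> vec.span ((\<lambda>j. \<sigma> (v' j)) ` {..<k})" by blast
        let ?X = "vec.span ((\<lambda>j. \<sigma> (v' j)) ` {..<k})"
        obtain y r where yr: "y \<in> ?X" "\<And>x. x \<in> ?X \<Longrightarrow> hdot r x = 0" "a = y + r"
          using hermitian_decomposition[of ?X a] by auto
        have "r \<noteq> 0" using yr v'(2) by auto
        have "B (v' j) r = 0" if "j < k" for j
          unfolding B_def using yr(2)[of "\<sigma> (v' j)"] that hdot_eq_0_commute by (auto intro: vec.span_base)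
        then have "r \<in> Y" unfolding Y_def using v' by (auto simp: dist_commute intro!: exI[of _ v'])
        then have "a \<bullet> r = 0" using a(2) span_base by blast
        moreover have "y \<bullet> r = 0" using yr(1,2) hdot_eq_0_commute by (metis Re_hdot zero_complex.sel(1))
        ultimately show False using yr(3) \<open>r \<noteq> 0\<close> by (simp add: inner_add_left)
      qed
      moreover have "linear (R' \<xi>)" using R'[OF \<xi>] by (simp add: has_derivative_linear)
      ultimately have "R' \<xi> \<eta> = 0" for \<eta>
        using linear_eq_0_on_span[of "R' \<xi>" Y \<eta>] by auto
      then have "R' \<xi> = (\<lambda>h. 0)" by auto
      then show ?thesis using R'[OF \<xi>] by (simp add: has_derivative_at_withinI)
    qed
    then show ?thesis
      using has_derivative_zero_unique[of T "R u" \<xi> w] \<xi> T(2) by (auto simp: T_def)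
  qed
  \<comment> \<open>The equation \<open>R z \<xi> = R z w\<close> solved for the pairing:
    \<open>p\<close> is the ratio of \<open>H\<close> to \<open>B\<close> at \<open>w\<close>, and
    \<open>q\<close> is the ratio at \<open>u0\<close>, normalised to be 1 at
    \<open>w\<close>.\<close>
  show thesis
  proof (rule that[OF S(1) _ S(3) T(1) _ T(4), of "\<lambda>u. H u w / B u w" "\<lambda>\<xi>. H u0 \<xi> * B u0 w / (B u0 \<xi> * H u0 w)"])
    show "H z w / B z w \<noteq> 0" if "z \<in> S" for z using HT[OF that T(2)] by simp
    show "H u0 \<xi> * B u0 w / (B u0 \<xi> * H u0 w) \<noteq> 0" if "\<xi> \<in> T" for \<xi>
      using HT[OF S(2) that] HT[OF S(2) T(2)] by simp
    show "hdot (F z) (G \<xi>) = H z w / B z w * (H u0 \<xi> * B u0 w / (B u0 \<xi> * H u0 w)) * hdot (\<sigma> z) \<xi>"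
      if z: "z \<in> S" and \<xi>: "\<xi> \<in> T" for z \<xi>
      using Rconst[OF z \<xi>] HT[OF z \<xi>] HT[OF z T(2)] HT[OF S(2) \<xi>] HT[OF S(2) T(2)]
      unfolding R_def H_def[symmetric] B_def[symmetric] by (simp add: field_simps)
  qed (use S T in auto)
qed

section \<open>Linear maps from a pair with prescribed pairing\<close>

lemma clinearI:
  fixes f :: "complex ^ 'n::finite \<Rightarrow> complex ^ 'm::finite"
  assumes "\<And>x y. f (x + y) = f x + f y" "\<And>c x. f (c *s x) = c *s f x"
  shows "clinear f"
  unfolding Vector_Spaces.linear_iff by (intro conjI allI assms vec.vector_space_axioms)

text \<open>Differences of points of \<open>S\<close> point in all directions. This carries linear
  conditions from an open set to the whole space.\<close>

lemma subspace_eq_UNIV: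
  fixes X :: "(complex ^ 'n::finite) set"
  assumes X: "vec.subspace X" and S: "open S" "S \<noteq> {}" "S \<subseteq> X"
  shows "X = UNIV"
proof -
  have "z \<in> X" for z
  proof -
    obtain s where s: "s \<in> S" using S(2) by blast
    then obtain t where t: "s + t *s z \<in> S" "t \<noteq> 0" by (rule ex_small_step[OF S(1)])
    have "inverse t *s ((s + t *s z) - s) \<in> X"
      using t s S(3) by (intro vec.subspace_scale[OF X] vec.subspace_diff[OF X]) auto
    then show ?thesis using t by simp
  qed
  then show ?thesis by blast
qed

text \<open>The last clause characterises \<open>P\<close>: linearity follows from it, and
  projections of concrete vectors are later identified by it.\<close>

lemma hermitian_projection:
  fixes V :: "(complex ^ 'n::finite) set"
  assumes V: "vec.subspace V"
  obtains P where "clinear P" "\<And>x. P x \<in> V" "\<And>x v. v \<in> V \<Longrightarrow> hdot (x - P x) v = 0"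
    "\<And>x y. y \<in> V \<Longrightarrow> (\<And>v. v \<in> V \<Longrightarrow> hdot (x - y) v = 0) \<Longrightarrow> P x = y"
proof -
  have "\<exists>y. y \<in> V \<and> (\<forall>v\<in>V. hdot (x - y) v = 0)" for x
    using hermitian_decomposition[OF V, of x] by (metis add_diff_cancel_left')
  then obtain P where P: "\<And>x. P x \<in> V" "\<And>x v. v \<in> V \<Longrightarrow> hdot (x - P x) v = 0" by metis
  have uniq: "P x = y" if y: "y \<in> V" "\<And>v. v \<in> V \<Longrightarrow> hdot (x - y) v = 0" for x y
  proof -
    have d: "P x - y \<in> V" using P(1) y(1) vec.subspace_diff[OF V] by blast
    have "hdot (P x - y) (P x - y) = hdot (x - y) (P x - y) - hdot (x - P x) (P x - y)"
      by (simp only: hdot_simps[symmetric]) simp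
    also have "\<dots> = 0" using P(2)[OF d] y(2)[OF d] by simp
    finally show ?thesis by (simp only: hdot_self_eq_0 right_minus_eq)
  qed
  have "clinear P"
  proof (rule clinearI)
    fix x y c
    have "hdot (x + y - (P x + P y)) v = 0" if "v \<in> V" for v
      using P(2)[OF that, of x] P(2)[OF that, of y] by simp
    then show "P (x + y) = P x + P y" using P(1) vec.subspace_add[OF V] by (intro uniq) auto
    have "hdot (c *s x - c *s P x) v = 0" if "v \<in> V" for v
      using P(2)[OF that, of x] by simp
    then show "P (c *s x) = c *s P x" using P(1) vec.subspace_scale[OF V] by (intro uniq) auto
  qed
  then show thesis using that P uniq by blast
qed

text \<open>The pairing is linear in \<open>z\<close>, so \<open>F\<close> is linear modulo
  \<open>X0\<close>, the part of its span orthogonal to every \<open>G w\<close>. The map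
  \<open>f\<close> takes its representative in the Hermitian complement of \<open>X0\<close>. The
  condition \<open>A\<close> determines \<open>f z\<close>, is stable under linear combinations and
  is solvable on the open set \<open>S\<close>, hence everywhere. A general \<open>b\<close> lets
  the lemma serve with \<open>F\<close> and \<open>G\<close> exchanged.\<close>

lemma ex_linear_part:
  fixes F :: "complex ^ 'n::finite \<Rightarrow> complex ^ 'm::finite" and G :: "'i \<Rightarrow> complex ^ 'm"
    and b :: "complex ^ 'n \<Rightarrow> 'i \<Rightarrow> complex"
  assumes S: "open S" "S \<noteq> {}"
    and FG: "\<And>z w. z \<in> S \<Longrightarrow> w \<in> T \<Longrightarrow> hdot (F z) (G w) = b z w"
    and b: "\<And>z z' w. b (z + z') w = b z w + b z' w" "\<And>c z w. b (c *s z) w = c * b z w"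
  obtains f where "clinear f" "\<And>z. f z \<in> vec.span (F ` S)"
    "\<And>z w. w \<in> T \<Longrightarrow> hdot (f z) (G w) = b z w"
    "\<And>z x. \<lbrakk>x \<in> vec.span (F ` S); \<And>w. w \<in> T \<Longrightarrow> hdot x (G w) = 0\<rbrakk> \<Longrightarrow> hdot (f z) x = 0"
    "\<And>z. z \<in> S \<Longrightarrow> F z - f z \<in> vec.span (F ` S)"
    "\<And>z w. z \<in> S \<Longrightarrow> w \<in> T \<Longrightarrow> hdot (F z - f z) (G w) = 0"
proof -
  define X where "X = vec.span (F ` S)"
  define X0 where "X0 = {x \<in> X. \<forall>w\<in>T. hdot x (G w) = 0}"
  define A where "A z x \<longleftrightarrow> x \<in> X \<and> (\<forall>y\<in>X0. hdot x y = 0) \<and> (\<forall>w\<in>T. hdot x (G w) = b z w)" for z x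
  have X: "vec.subspace X" by (simp add: X_def)
  have X0: "vec.subspace X0"
    using X unfolding vec.subspace_def X0_def by auto
  have uniq: "x = x'" if A: "A z x" "A z x'" for z x x'
  proof -
    have "x - x' \<in> X0"
      using A vec.subspace_diff[OF X] by (auto simp: A_def X0_def)
    then have "hdot x (x - x') = 0" "hdot x' (x - x') = 0" using A unfolding A_def by blast+
    then have "hdot (x - x') (x - x') = 0" by (simp only: hdot_simps(2)) simp
    then show ?thesis by (simp only: hdot_self_eq_0 right_minus_eq)
  qed
  have add: "A (z + z') (x + x')" if "A z x" "A z' x'" for z z' x x'
    using that vec.subspace_add[OF X] by (simp add: A_def b)
  have scale: "A (c *s z) (c *s x)" if "A z x" for c z x
    using that vec.subspace_scale[OF X] by (simp add: A_def b)
  have b0: "b 0 w = 0" for w using b(2)[of 0 0 w] by simp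
  have onS: "\<exists>x. A z x \<and> F z - x \<in> X0" if z: "z \<in> S" for z
  proof -
    obtain y r where yr: "y \<in> X0" "\<And>u. u \<in> X0 \<Longrightarrow> hdot r u = 0" "F z = y + r"
      using hermitian_decomposition[OF X0, of "F z"] by blast
    have FX: "F z \<in> X" using z by (auto simp: X_def intro: vec.span_base)
    have r: "r = F z - y" using yr(3) by simp
    have "A z r"
      unfolding A_def
    proof (intro conjI ballI)
      show "r \<in> X" unfolding r using FX yr(1) vec.subspace_diff[OF X] by (auto simp: X0_def)
      show "hdot r (G w) = b z w" if "w \<in> T" for w
        unfolding r using yr(1) FG[OF z that] that by (simp add: X0_def)
    qed (use yr in auto)
    then show ?thesis using yr by (intro exI[of _ r]) simp
  qed
  have "{z. \<exists>x. A z x} = UNIV"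
  proof (rule subspace_eq_UNIV[OF _ S])
    have "A 0 0" using vec.subspace_0[OF X] by (simp add: A_def b0)
    then show "vec.subspace {z. \<exists>x. A z x}"
      unfolding vec.subspace_def using add scale by blast
  qed (use onS in blast)
  then have "\<forall>z. \<exists>x. A z x" by auto
  then obtain f where f: "\<And>z. A z (f z)" using choice[of A] by blast
  have lin: "clinear f"
    by (rule clinearI) (rule uniq[OF f], rule add[OF f f], rule uniq[OF f], rule scale[OF f])
  have FX0: "F z - f z \<in> X0" if "z \<in> S" for z using onS[OF that] uniq[OF f] by metis
  show thesis
  proof (rule that[OF lin])
    show "f z \<in> vec.span (F ` S)" "w \<in> T \<Longrightarrow> hdot (f z) (G w) = b z w" for z w
      using f[of z] unfolding A_def X_def by blast+
    show "hdot (f z) x = 0" if "x \<in> vec.span (F ` S)" "\<And>w. w \<in> T \<Longrightarrow> hdot x (G w) = 0" for z x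
      using f[of z] that unfolding A_def X0_def X_def by blast
  qed (use FX0 in \<open>simp_all add: X0_def X_def\<close>)
qed

text \<open>\<open>V\<close> is spanned by the values of \<open>f\<close> and \<open>g\<close>. The
  remainder \<open>F z - f z\<close> is orthogonal to \<open>f\<close> by the choice of complement,
  and to \<open>g\<close> because it is orthogonal to every \<open>G w\<close> and \<open>g\<close>
  takes values in their span; likewise for \<open>G w - g w\<close>.\<close>

lemma linear_decomposition:
  fixes F G :: "complex ^ 'n::finite \<Rightarrow> complex ^ 'm::finite" and \<sigma> :: "complex ^ 'n \<Rightarrow> complex ^ 'n"
  assumes \<sigma>: "clinear \<sigma>" and S: "open S" "S \<noteq> {}" and T: "open T" "T \<noteq> {}" and E: "vec.subspace E"
    and FE: "\<And>z. z \<in> S \<Longrightarrow> F z \<in> E" and GE: "\<And>w. w \<in> T \<Longrightarrow> G w \<in> E"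
    and FG: "\<And>z w. z \<in> S \<Longrightarrow> w \<in> T \<Longrightarrow> hdot (F z) (G w) = hdot (\<sigma> z) w"
  obtains V f g where "vec.subspace V" "V \<subseteq> E" "clinear f" "range f \<subseteq> V" "clinear g" "range g \<subseteq> V"
    "\<And>z w. hdot (f z) (g w) = hdot (\<sigma> z) w"
    "\<And>z v. z \<in> S \<Longrightarrow> v \<in> V \<Longrightarrow> hdot (F z - f z) v = 0"
    "\<And>w v. w \<in> T \<Longrightarrow> v \<in> V \<Longrightarrow> hdot (G w - g w) v = 0"
    "\<And>z w. z \<in> S \<Longrightarrow> w \<in> T \<Longrightarrow> hdot (F z - f z) (G w - g w) = 0"
proof -
  have GF: "hdot (G w) (F z) = hdot w (\<sigma> z)" if "w \<in> T" "z \<in> S" for w z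
    using FG[OF that(2,1)] hdot_commute by metis
  obtain f where f: "clinear f" "\<And>z. f z \<in> vec.span (F ` S)"
    "\<And>z w. w \<in> T \<Longrightarrow> hdot (f z) (G w) = hdot (\<sigma> z) w"
    "\<And>z x. \<lbrakk>x \<in> vec.span (F ` S); \<And>w. w \<in> T \<Longrightarrow> hdot x (G w) = 0\<rbrakk> \<Longrightarrow> hdot (f z) x = 0"
    "\<And>z. z \<in> S \<Longrightarrow> F z - f z \<in> vec.span (F ` S)"
    "\<And>z w. z \<in> S \<Longrightarrow> w \<in> T \<Longrightarrow> hdot (F z - f z) (G w) = 0"
    by (rule ex_linear_part[where S = S and T = T and F = F and G = G and b = "\<lambda>z w. hdot (\<sigma> z) w"])
      (use S FG in \<open>auto simp: vec.linear_add[OF \<sigma>] vec.linear_scale[OF \<sigma>]\<close>)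
  obtain g where g: "clinear g" "\<And>w. g w \<in> vec.span (G ` T)"
    "\<And>w z. z \<in> S \<Longrightarrow> hdot (g w) (F z) = hdot w (\<sigma> z)"
    "\<And>w x. \<lbrakk>x \<in> vec.span (G ` T); \<And>z. z \<in> S \<Longrightarrow> hdot x (F z) = 0\<rbrakk> \<Longrightarrow> hdot (g w) x = 0"
    "\<And>w. w \<in> T \<Longrightarrow> G w - g w \<in> vec.span (G ` T)"
    "\<And>w z. w \<in> T \<Longrightarrow> z \<in> S \<Longrightarrow> hdot (G w - g w) (F z) = 0"
    by (rule ex_linear_part[where S = T and T = S and F = G and G = F and b = "\<lambda>w z. hdot w (\<sigma> z)"])
      (use T GF in auto)
  have perpG: "hdot x y = 0" if "y \<in> vec.span (G ` T)" "\<And>w. w \<in> T \<Longrightarrow> hdot x (G w) = 0" for x y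
    using hdot_span_eq_0[OF that(1), of x] that(2) hdot_eq_0_commute by blast
  have perpF: "hdot y x = 0" if "x \<in> vec.span (F ` S)" "\<And>z. z \<in> S \<Longrightarrow> hdot y (F z) = 0" for x y
    using hdot_span_eq_0[OF that(1), of y] that(2) hdot_eq_0_commute by blast
  have fg: "hdot (f z) (g w) = hdot (\<sigma> z) w" for z w
  proof -
    have "{w. \<forall>z. hdot (f z) (g w) = hdot (\<sigma> z) w} = UNIV"
    proof (rule subspace_eq_UNIV[OF _ T])
      show "vec.subspace {w. \<forall>z. hdot (f z) (g w) = hdot (\<sigma> z) w}"
        unfolding vec.subspace_def
        by (auto simp: vec.linear_0[OF g(1)] vec.linear_add[OF g(1)] vec.linear_scale[OF g(1)])
      show "T \<subseteq> {w. \<forall>z. hdot (f z) (g w) = hdot (\<sigma> z) w}"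
      proof (intro subsetI CollectI allI)
        fix w z assume w: "w \<in> T"
        have "hdot (G w - g w) (f z) = 0" by (rule perpF[OF f(2) g(6)[OF w]])
        then have "hdot (f z) (G w - g w) = 0" using hdot_eq_0_commute by blast
        then show "hdot (f z) (g w) = hdot (\<sigma> z) w" using f(3)[OF w] by simp
      qed
    qed
    then show ?thesis by blast
  qed
  define V where "V = vec.span (range f \<union> range g)"
  have XE: "vec.span (F ` S) \<subseteq> E" "vec.span (G ` T) \<subseteq> E"
    using FE GE by (auto intro!: vec.span_minimal[OF _ E])
  have inV: "hdot x v = 0" if "v \<in> V" "\<And>z. hdot x (f z) = 0" "\<And>w. hdot x (g w) = 0" for x v
  proof -
    have "hdot v x = 0"
      by (rule hdot_span_eq_0[OF that(1)[unfolded V_def]]) (use that(2,3) hdot_eq_0_commute in blast)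
    then show ?thesis using hdot_eq_0_commute by blast
  qed
  show thesis
  proof (rule that[of V f g])
    show "V \<subseteq> E" unfolding V_def using f(2) g(2) XE by (intro vec.span_minimal[OF _ E]) auto
    show "range f \<subseteq> V" "range g \<subseteq> V" by (auto simp: V_def intro: vec.span_base)
    show "hdot (F z - f z) v = 0" if "z \<in> S" "v \<in> V" for z v
    proof (rule inV[OF that(2)])
      show "hdot (F z - f z) (f z') = 0" for z'
        using f(4)[OF f(5)[OF that(1)] f(6)[OF that(1)]] hdot_eq_0_commute by blast
      show "hdot (F z - f z) (g w) = 0" for w
        by (rule perpG[OF g(2) f(6)[OF that(1)]])
    qed
    show "hdot (G w - g w) v = 0" if "w \<in> T" "v \<in> V" for w v
    proof (rule inV[OF that(2)])
      show "hdot (G w - g w) (g w') = 0" for w'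
        using g(4)[OF g(5)[OF that(1)] g(6)[OF that(1)]] hdot_eq_0_commute by blast
      show "hdot (G w - g w) (f z) = 0" for z
        by (rule perpF[OF f(2) g(6)[OF that(1)]])
    qed
    show "hdot (F z - f z) (G w - g w) = 0" if "z \<in> S" "w \<in> T" for z w
      by (rule perpG[OF g(5)[OF that(2)] f(6)[OF that(1)]])
  qed (use f g fg in \<open>auto simp: V_def\<close>)
qed

section \<open>The local alternative\<close>

lemma dichotomy:
  fixes \<sigma> :: "complex ^ 'n::finite \<Rightarrow> complex ^ 'n" and F G :: "complex ^ 'n \<Rightarrow> complex ^ 'm::finite"
  assumes \<sigma>: "clinear \<sigma>" and D: "open D" and D': "open D'"
    and F: "holomorphic_vec_on F D" and G: "holomorphic_vec_on G D'"
    and orth: "\<And>z w. \<lbrakk>z \<in> D; w \<in> D'; hdot (\<sigma> z) w = 0\<rbrakk> \<Longrightarrow> hdot (F z) (G w) = 0"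
    and FQ: "\<And>z. z \<in> D \<Longrightarrow> F z \<in> coord_space Q \<and> F z \<noteq> 0"
    and GQ: "\<And>w. w \<in> D' \<Longrightarrow> G w \<in> coord_space Q \<and> G w \<noteq> 0"
    and card: "card Q + 3 \<le> 2 * vec.dim (range \<sigma>)"
    and start: "z0 \<in> D" "w0 \<in> D'" "hdot (\<sigma> z0) w0 = 0" "\<sigma> z0 \<noteq> 0" "hdot (\<sigma> e0) w0 \<noteq> 0"
  shows "\<exists>S T. open S \<and> S \<noteq> {} \<and> S \<subseteq> D \<and> open T \<and> T \<noteq> {} \<and> T \<subseteq> D' \<and>
    ((\<forall>z\<in>S. \<forall>w\<in>T. hdot (F z) (G w) = 0) \<or>
     (\<exists>p q. (\<forall>z\<in>S. p z \<noteq> 0) \<and> (\<forall>w\<in>T. q w \<noteq> 0) \<and>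
        (\<forall>z\<in>S. \<forall>w\<in>T. hdot (F z) (G w) = p z * q w * hdot (\<sigma> z) w)))"
proof (cases "\<exists>z\<in>D. \<exists>w\<in>D'. \<exists>x. hdot (\<sigma> z) w = 0 \<and> hdot (dirder F x z) (G w) \<noteq> 0")
  case True
  then obtain z w e where z: "z \<in> D" and w: "w \<in> D'" and zw: "hdot (\<sigma> z) w = 0"
    and ne: "hdot (dirder F e z) (G w) \<noteq> 0" by blast
  have e: "hdot (\<sigma> e) w \<noteq> 0"
  proof
    assume e0: "hdot (\<sigma> e) w = 0"
    have "hdot (dirder F e z) (G w) = 0"
      by (rule hdot_dirder_eq_0[OF F D z], rule orth)
        (use w zw e0 in \<open>simp_all add: vec.linear_add[OF \<sigma>] vec.linear_scale[OF \<sigma>]\<close>)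
    then show False using ne by simp
  qed
  let ?h = "\<lambda>x. hdot (dirder F e (fst x)) (G (snd x)) * hdot (\<sigma> e) (snd x)"
  have "continuous_on (D \<times> D') ?h"
    by (intro continuous_intros continuous_on_compose2[OF continuous_on_dirder[OF F D]]
        continuous_on_compose2[OF holomorphic_vec_on_continuous_on[OF G]]) auto
  then have "open ((D \<times> D') \<inter> ?h -` (- {0}))"
    by (rule continuous_open_preimage) (use D D' in \<open>auto intro: open_Times\<close>)
  moreover have "(z, w) \<in> (D \<times> D') \<inter> ?h -` (- {0})" using z w e ne by auto
  ultimately obtain S0 T0 where ST0: "open S0" "open T0" "z \<in> S0" "w \<in> T0"
    "S0 \<times> T0 \<subseteq> (D \<times> D') \<inter> ?h -` (- {0})"
    by (elim open_prod_elim) auto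
  have sub: "S0 \<subseteq> D" "T0 \<subseteq> D'" using ST0 by auto
  have nz: "hdot (dirder F e z) (G w) \<noteq> 0" "hdot (\<sigma> e) w \<noteq> 0" if "z \<in> S0" "w \<in> T0" for z w
    using ST0(5) that by auto
  \<comment> \<open>A flag must start at a point outside the kernel of \<open>\<sigma>\<close>. If
    \<open>z\<close> lies in the kernel, it is moved within the complement of
    \<open>w\<close>.\<close>
  obtain z1 where z1: "z1 \<in> S0" "hdot (\<sigma> z1) w = 0" "\<sigma> z1 \<noteq> 0"
  proof (cases "\<sigma> z = 0")
    case True
    obtain x where x: "hdot (\<sigma> x) w = 0" "\<sigma> x \<notin> vec.span ((\<lambda>_. 0) ` {..<0::nat})"
      using ex_orthogonal_not_in_span[OF \<sigma> e, of 0] card by auto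
    obtain t where t: "z + t *s x \<in> S0" "t \<noteq> 0" using ex_small_step[OF ST0(1,3)] by blast
    then show thesis
      using that[of "z + t *s x"] True x by (auto simp: vec.linear_add[OF \<sigma>] vec.linear_scale[OF \<sigma>])
  qed (use that[of z] ST0 zw in auto)
  have orthS: "\<And>z w. \<lbrakk>z \<in> S0; w \<in> T0; hdot (\<sigma> z) w = 0\<rbrakk> \<Longrightarrow> hdot (F z) (G w) = 0"
    and FQS: "\<And>z. z \<in> S0 \<Longrightarrow> F z \<in> coord_space Q \<and> F z \<noteq> 0"
    and GQT: "\<And>w. w \<in> T0 \<Longrightarrow> G w \<in> coord_space Q \<and> G w \<noteq> 0"
    using orth FQ GQ sub by blast+
  show ?thesis
  proof (rule split_of_nondegenerate[OF \<sigma> ST0(1,2) holomorphic_vec_on_subset[OF F sub(1)]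
          holomorphic_vec_on_subset[OF G sub(2)] orthS nz(2)[OF ST0(3)] nz(1) FQS GQT card z1(1) ST0(4) z1(2,3)])
    fix S T p q
    assume *: "open S" "S \<noteq> {}" "S \<subseteq> S0" "open T" "T \<noteq> {}" "T \<subseteq> T0"
      and pq: "\<And>z. z \<in> S \<Longrightarrow> p z \<noteq> 0" "\<And>w. w \<in> T \<Longrightarrow> q w \<noteq> 0"
        "\<And>z w. z \<in> S \<Longrightarrow> w \<in> T \<Longrightarrow> hdot (F z) (G w) = p z * q w * hdot (\<sigma> z) w"
    have "S \<subseteq> D" "T \<subseteq> D'" using * sub by auto
    moreover have "\<exists>p q. (\<forall>z\<in>S. p z \<noteq> 0) \<and> (\<forall>w\<in>T. q w \<noteq> 0) \<and>
        (\<forall>z\<in>S. \<forall>w\<in>T. hdot (F z) (G w) = p z * q w * hdot (\<sigma> z) w)"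
      by (intro exI[of _ p] exI[of _ q]) (simp add: pq)
    ultimately show ?thesis using * by (intro exI[of _ S] exI[of _ T] conjI disjI2)
  qed assumption+
next
  case False
  \<comment> \<open>The null case works on a convex domain, and with one direction \<open>e0\<close>
    that pairs nontrivially with every \<open>w\<close>; hence the ball and
    \<open>D1\<close>.\<close>
  obtain r where r: "r > 0" "ball z0 r \<subseteq> D" using D start(1) open_contains_ball by blast
  define D1 where "D1 = {w \<in> D'. hdot (\<sigma> e0) w \<noteq> 0}"
  have "D1 = D' \<inter> (\<lambda>w. hdot (\<sigma> e0) w) -` (- {0})" by (auto simp: D1_def)
  moreover have "open (D' \<inter> (\<lambda>w. hdot (\<sigma> e0) w) -` (- {0}))"
    by (rule continuous_open_preimage) (use D' in \<open>auto intro!: continuous_intros\<close>)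
  ultimately have D1: "open D1" by simp
  obtain T where T: "open T" "T \<noteq> {}" "T \<subseteq> D1" "\<And>z w. z \<in> ball z0 r \<Longrightarrow> w \<in> T \<Longrightarrow> hdot (F z) (G w) = 0"
  proof (rule null_of_degenerate[OF \<sigma> open_ball convex_ball D1 holomorphic_vec_on_subset[OF F r(2)], of G Q e0 z0 w0])
    show "continuous_on D1 G"
      by (rule continuous_on_subset[OF holomorphic_vec_on_continuous_on[OF G]]) (auto simp: D1_def)
  qed (use False orth FQ GQ card start r in \<open>auto simp: D1_def\<close>)
  then show ?thesis using r by (intro exI[of _ "ball z0 r"] exI[of _ T]) (auto simp: D1_def)
qed

section \<open>Extension of local identities to the projective domain\<close>

lemma span_singleton_eq:
  fixes z z' :: "complex ^ 'n::finite"
  assumes "vec.span {z} = vec.span {z'}" "z \<noteq> 0"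
  obtains c where "c \<noteq> 0" "z = c *s z'"
proof -
  have "z \<in> vec.span {z'}" using assms(1) vec.span_base[of z "{z}"] by simp
  then obtain c where "z = c *s z'" unfolding vec.span_singleton by blast
  then show thesis using assms(2) that[of c] by auto
qed

lemma span_singleton_smult:
  fixes z :: "complex ^ 'n::finite"
  assumes "c \<noteq> 0"
  shows "vec.span {c *s z} = vec.span {z}"
proof -
  have "k *s z \<in> range (\<lambda>k. k *s (c *s z))" for k
    using assms by (intro range_eqI[of _ _ "k / c"]) simp
  then show ?thesis unfolding vec.span_singleton by (auto intro: range_eqI)
qed

definition proj_preimage :: "(complex ^ 'n::finite) set set \<Rightarrow> (complex ^ 'n) set" where
  "proj_preimage U = {z. z \<noteq> 0 \<and> vec.span {z} \<in> U}"

lemma ex_proj_preimage: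
  assumes "openin proj_topology U" "p \<in> U"
  obtains z where "z \<in> proj_preimage U" "p = vec.span {z}"
proof -
  have "p \<in> proj_space UNIV" using assms by (auto simp: openin_proj_topology)
  then obtain z where "z \<noteq> 0" "p = vec.span {z}" by (auto simp: proj_space_def)
  then show thesis using that[of z] assms(2) by (simp add: proj_preimage_def)
qed

lemma proj_preimage_smult: "z \<in> proj_preimage U \<Longrightarrow> c \<noteq> 0 \<Longrightarrow> c *s z \<in> proj_preimage U"
  by (simp add: proj_preimage_def span_singleton_smult)


lemma holomorphic_proj_map_lift:
  assumes "holomorphic_proj_map E U \<phi>" "vec.subspace E" "z \<in> proj_preimage U"
  obtains D f where "open D" "z \<in> D" "D \<subseteq> proj_preimage U" "holomorphic_vec_on f D"
    "\<And>x. x \<in> D \<Longrightarrow> f x \<noteq> 0 \<and> f x \<in> E \<and> \<phi> (vec.span {x}) = vec.span {f x}"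
proof -
  have \<phi>: "\<phi> ` U \<subseteq> proj_space E" using assms(1) by (simp add: holomorphic_proj_map_def)
  obtain D f where D: "open D" "z \<in> D" "holomorphic_vec_on f D"
    "\<forall>x\<in>D. x \<noteq> 0 \<and> vec.span {x} \<in> U \<and> f x \<noteq> 0 \<and> \<phi> (vec.span {x}) = vec.span {f x}"
    using assms unfolding holomorphic_proj_map_def proj_preimage_def by blast
  have "f x \<in> E" if x: "x \<in> D" for x
  proof -
    have "\<phi> (vec.span {x}) \<in> proj_space E" using \<phi> D(4) x by blast
    then obtain v where v: "v \<in> E" "\<phi> (vec.span {x}) = vec.span {v}" by (auto simp: proj_space_def)
    then have "vec.span {f x} \<subseteq> E" using D(4) x vec.span_minimal[OF _ assms(2), of "{v}"] by auto
    then show ?thesis using vec.span_base[of "f x" "{f x}"] by blast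
  qed
  then show thesis using that[OF D(1,2) _ D(3)] D(4) by (auto simp: proj_preimage_def)
qed

lemma proj_map_value:
  assumes "holomorphic_proj_map E U \<phi>" "vec.subspace E" "p \<in> U"
  obtains x where "x \<in> E" "x \<noteq> 0" "\<phi> p = vec.span {x}" "\<phi> p \<subseteq> E"
proof -
  have "\<phi> p \<in> proj_space E" using assms by (auto simp: holomorphic_proj_map_def)
  then obtain x where x: "x \<in> E" "x \<noteq> 0" "\<phi> p = vec.span {x}" by (auto simp: proj_space_def)
  then have "\<phi> p \<subseteq> E" using vec.span_minimal[OF _ assms(2), of "{x}"] by auto
  then show thesis using that x by blast
qed

text \<open>A lift of \<phi> on all of \<open>proj_preimage U\<close> may not exist, so vanishing is
  treated as a property of points; by \<open>hom\<close> it is independent of representatives. With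
  \<open>A\<close> the interior of the zero set, every point has a ball inside \<open>A\<close> or
  disjoint from \<open>A\<close>, by the identity theorem for a local lift. The images of
  \<open>A\<close> and of its complement are then open and disjoint, and connectedness of
  \<open>U\<close> decides.\<close>

lemma proj_identity:
  fixes b :: "complex ^ 'n::finite \<Rightarrow> complex ^ 'm::finite \<Rightarrow> complex"
  assumes U: "openin proj_topology U" "connectedin proj_topology U"
    and \<phi>: "holomorphic_proj_map E U \<phi>" and E: "vec.subspace E"
    and hol: "\<And>F D. \<lbrakk>open D; holomorphic_vec_on F D\<rbrakk> \<Longrightarrow> line_holomorphic_on (\<lambda>z. b z (F z)) D"
    and hom: "\<And>c d z x. b z x = 0 \<Longrightarrow> b (c *s z) (d *s x) = 0"
    and S: "open S" "S \<noteq> {}" "S \<subseteq> proj_preimage U" "\<And>z x. \<lbrakk>z \<in> S; x \<in> \<phi> (vec.span {z})\<rbrakk> \<Longrightarrow> b z x = 0"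
    and z: "z \<in> proj_preimage U" and x: "x \<in> \<phi> (vec.span {z})"
  shows "b z x = 0"
proof -
  define Z where "Z z \<longleftrightarrow> z \<in> proj_preimage U \<and> (\<forall>x\<in>\<phi> (vec.span {z}). b z x = 0)" for z
  define A where "A = interior {z. Z z}"
  have Z_scale: "Z (c *s z)" if "Z z" "c \<noteq> 0" for c z
    using that proj_preimage_smult hom[of z _ c 1] by (auto simp: Z_def span_singleton_smult)
  \<comment> \<open>\<open>A\<close> must be a cone to be the full preimage of its image
    \<open>E1\<close>, since openness in \<open>proj_topology\<close> is tested on
    preimages.\<close>
  have A_scale: "c *s z \<in> A" if z: "z \<in> A" and c: "c \<noteq> 0" for c z
  proof -
    define A' where "A' = (\<lambda>y. inverse c *s y) -` A"
    have "open A'"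
      unfolding A'_def by (rule open_vimage) (auto simp: A_def intro!: continuous_intros)
    moreover have "A' \<subseteq> {z. Z z}"
    proof
      fix y assume "y \<in> A'"
      then have "Z (inverse c *s y)" using interior_subset by (auto simp: A'_def A_def)
      from Z_scale[OF this c] c show "y \<in> {z. Z z}" by simp
    qed
    ultimately have "A' \<subseteq> A" unfolding A_def by (rule interior_maximal[rotated])
    moreover have "c *s z \<in> A'" using z c by (simp add: A'_def)
    ultimately show ?thesis by blast
  qed
  have local: "\<exists>D. open D \<and> y \<in> D \<and> D \<subseteq> proj_preimage U \<and> (D \<subseteq> A \<or> D \<inter> A = {})" if y: "y \<in> proj_preimage U" for y
  proof -
    obtain D F where D: "open D" "y \<in> D" "D \<subseteq> proj_preimage U" "holomorphic_vec_on F D"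
      "\<And>x. x \<in> D \<Longrightarrow> F x \<noteq> 0 \<and> F x \<in> E \<and> \<phi> (vec.span {x}) = vec.span {F x}"
      using holomorphic_proj_map_lift[OF \<phi> E y] by blast
    obtain r where r: "r > 0" "ball y r \<subseteq> D" using D open_contains_ball by blast
    show ?thesis
    proof (cases "ball y r \<inter> A = {}")
      case False
      have lh: "line_holomorphic_on (\<lambda>z. b z (F z)) (ball y r)"
        by (rule line_holomorphic_on_subset[OF hol[OF D(1,4)] r(2)])
      have "b z (F z) = 0" if "z \<in> ball y r" for z
      proof (rule line_holomorphic_on_eq_0[OF lh open_ball convex_ball, of "ball y r \<inter> A"])
        show "b z (F z) = 0" if "z \<in> ball y r \<inter> A" for z
        proof -
          have "Z z" using that interior_subset by (auto simp: A_def)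
          moreover have "F z \<in> \<phi> (vec.span {z})" using D(5)[of z] that r vec.span_base[of "F z" "{F z}"] by auto
          ultimately show ?thesis by (simp add: Z_def)
        qed
      qed (use False that in \<open>auto simp: A_def\<close>)
      then have "Z z" if "z \<in> ball y r" for z
        using that r D hom[of z "F z" 1] by (auto simp: Z_def vec.span_singleton subset_iff)
      then have "ball y r \<subseteq> A" unfolding A_def by (intro interior_maximal) auto
      then show ?thesis using r D by (intro exI[of _ "ball y r"]) auto
    qed (use r D in \<open>auto intro!: exI[of _ "ball y r"]\<close>)
  qed
  have AU: "A \<subseteq> proj_preimage U" using interior_subset by (auto simp: A_def Z_def)
  define E1 where "E1 = (\<lambda>z. vec.span {z}) ` A"
  define E2 where "E2 = (\<lambda>z. vec.span {z}) ` (proj_preimage U - A)"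
  have pre1: "{z. z \<noteq> 0 \<and> vec.span {z} \<in> E1} = A"
  proof (intro equalityI subsetI)
    fix z assume "z \<in> {z. z \<noteq> 0 \<and> vec.span {z} \<in> E1}"
    then obtain z' where "z' \<in> A" "vec.span {z} = vec.span {z'}" "z \<noteq> 0" by (auto simp: E1_def)
    then show "z \<in> A" using span_singleton_eq A_scale by metis
  qed (use AU in \<open>auto simp: E1_def proj_preimage_def\<close>)
  have pre2: "{z. z \<noteq> 0 \<and> vec.span {z} \<in> E2} = proj_preimage U - A"
  proof (intro equalityI subsetI)
    fix z assume "z \<in> {z. z \<noteq> 0 \<and> vec.span {z} \<in> E2}"
    then obtain z' where z': "z' \<in> proj_preimage U" "z' \<notin> A" "vec.span {z} = vec.span {z'}" "z \<noteq> 0"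
      by (auto simp: E2_def)
    then obtain c where c: "c \<noteq> 0" "z = c *s z'" using span_singleton_eq by metis
    have "z \<notin> A" using A_scale[of z "inverse c"] c z'(2) by auto
    then show "z \<in> proj_preimage U - A" using c z'(1) proj_preimage_smult by auto
  qed (auto simp: E2_def proj_preimage_def)
  have open2: "open (proj_preimage U - A)"
    unfolding open_subopen[of "proj_preimage U - A"]
  proof
    fix y assume y: "y \<in> proj_preimage U - A"
    then obtain D where "open D" "y \<in> D" "D \<subseteq> proj_preimage U" "D \<subseteq> A \<or> D \<inter> A = {}" using local by blast
    then show "\<exists>T. open T \<and> y \<in> T \<and> T \<subseteq> proj_preimage U - A" using y by (intro exI[of _ D]) auto
  qed
  have U_proj: "U \<subseteq> proj_space UNIV" using U(1) by (simp add: openin_proj_topology)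
  have "openin proj_topology E1" "openin proj_topology E2"
    unfolding openin_proj_topology pre1 pre2
    using open2 AU by (auto simp: E1_def E2_def A_def proj_space_def proj_preimage_def)
  moreover have "U \<subseteq> E1 \<union> E2"
  proof
    fix p assume p: "p \<in> U"
    then obtain v where "v \<noteq> 0" "p = vec.span {v}" using U_proj by (auto simp: proj_space_def)
    then show "p \<in> E1 \<union> E2" using p by (auto simp: E1_def E2_def proj_preimage_def)
  qed
  moreover have "E1 \<inter> E2 \<inter> U = {}"
  proof -
    have False if p: "p \<in> E1" "p \<in> E2" for p
    proof -
      obtain v where v: "v \<in> A" "p = vec.span {v}" using p(1) by (auto simp: E1_def)
      then have "v \<in> {z. z \<noteq> 0 \<and> vec.span {z} \<in> E2}" using p(2) AU by (auto simp: proj_preimage_def)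
      then show False unfolding pre2 using v by blast
    qed
    then show ?thesis by blast
  qed
  moreover have "E1 \<inter> U \<noteq> {}"
  proof -
    have "S \<subseteq> A" unfolding A_def using S by (intro interior_maximal) (auto simp: Z_def)
    then show ?thesis using S(2,3) by (auto simp: E1_def proj_preimage_def)
  qed
  ultimately have "E2 \<inter> U = {}" using U(2) unfolding connectedin by blast
  then have "z \<in> A" using z by (auto simp: E2_def proj_preimage_def)
  then have "Z z" using interior_subset by (auto simp: A_def)
  then show ?thesis using x by (simp add: Z_def)
qed

lemma clinear_comp_holomorphic:
  assumes P: "clinear P" and F: "holomorphic_vec_on F D"
  shows "holomorphic_vec_on (\<lambda>z. P (F z)) D"
  unfolding holomorphic_vec_on_def
proof
  fix z assume z: "z \<in> D"
  note F = holomorphic_vec_on_has_derivative[OF F z]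
  have "clinear (\<lambda>e. P (dirder F e z))"
    by (rule clinearI) (simp_all add: vec.linear_add[OF F(2)] vec.linear_scale[OF F(2)] vec.linear_add[OF P] vec.linear_scale[OF P])
  moreover have "((\<lambda>z. P (F z)) has_derivative (\<lambda>e. P (dirder F e z))) (at z)"
    by (rule bounded_linear.has_derivative[OF complex_linear_bounded_linear[OF P] F(1)])
  ultimately show "\<exists>A. clinear A \<and> ((\<lambda>z. P (F z)) has_derivative A) (at z)" by blast
qed

lemma holomorphic_vec_on_ident: "holomorphic_vec_on (\<lambda>z. z) D"
  unfolding holomorphic_vec_on_def using vec.linear_ident has_derivative_ident by blast

text \<open>\<open>hdot (P x) (P y)\<close> is holomorphic in the lift of \<phi> but antiholomorphic
  in that of \<psi>. The extension is made in \<open>z\<close> first and then, after exchanging the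
  arguments of \<open>hdot\<close>, in \<open>w\<close>.\<close>

lemma null_extend:
  fixes \<phi> \<psi> :: "(complex ^ 'n::finite) set \<Rightarrow> (complex ^ 'm::finite) set"
  assumes U: "openin proj_topology U" "connectedin proj_topology U"
    and \<phi>: "holomorphic_proj_map E U \<phi>" and \<psi>: "holomorphic_proj_map E U \<psi>" and E: "vec.subspace E"
    and P: "clinear P"
    and S: "open S" "S \<noteq> {}" "S \<subseteq> proj_preimage U" and T: "open T" "T \<noteq> {}" "T \<subseteq> proj_preimage U"
    and 0: "\<And>z w x y. \<lbrakk>z \<in> S; w \<in> T; x \<in> \<phi> (vec.span {z}); y \<in> \<psi> (vec.span {w})\<rbrakk> \<Longrightarrow> hdot (P x) (P y) = 0"
    and p: "p \<in> U" "q \<in> U" and xy: "x \<in> \<phi> p" "y \<in> \<psi> q"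
  shows "hdot (P x) (P y) = 0"
proof -
  have hol: "line_holomorphic_on (\<lambda>z. hdot (P (F z)) v) D" if "open D" "holomorphic_vec_on F D" for F v and D :: "(complex ^ 'n) set"
    by (rule line_holomorphic_on_hdot[OF clinear_comp_holomorphic[OF P that(2)] that(1)])
  have *: "hdot (P x) (P y) = 0" if z: "z \<in> proj_preimage U" "x \<in> \<phi> (vec.span {z})" and w: "w \<in> T" "y \<in> \<psi> (vec.span {w})" for z w x y
    by (rule proj_identity[OF U \<phi> E _ _ S _ z, of "\<lambda>_ x. hdot (P x) (P y)"])
      (use hol 0 w in \<open>auto simp: vec.linear_scale[OF P]\<close>)
  then have *: "hdot (P y) (P x) = 0"
    if "z \<in> proj_preimage U" "x \<in> \<phi> (vec.span {z})" "w \<in> T" "y \<in> \<psi> (vec.span {w})" for z w x y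
    using that hdot_eq_0_commute by blast
  have "hdot (P y) (P x) = 0" if z: "z \<in> proj_preimage U" "x \<in> \<phi> (vec.span {z})" and w: "w \<in> proj_preimage U" "y \<in> \<psi> (vec.span {w})" for z w x y
    by (rule proj_identity[OF U \<psi> E _ _ T _ w, of "\<lambda>_ y. hdot (P y) (P x)"])
      (use hol *[OF z] in \<open>auto simp: vec.linear_scale[OF P]\<close>)
  moreover obtain z w where "z \<in> proj_preimage U" "p = vec.span {z}" "w \<in> proj_preimage U" "q = vec.span {w}"
    using ex_proj_preimage[OF U(1) p(1)] ex_proj_preimage[OF U(1) p(2)] by metis
  ultimately show ?thesis using xy hdot_eq_0_commute by blast
qed

lemma clinear_image_span_singleton:
  assumes "clinear f"
  shows "f ` vec.span {z} = vec.span {f z}"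
  using vec.linear_span_image[OF assms, of "{z}"] by simp

lemma induced_by_cong:
  assumes "\<And>p. p \<in> U \<Longrightarrow> \<phi> p = \<psi> p"
  shows "induced_by U \<phi> f \<longleftrightarrow> induced_by U \<psi> f"
proof -
  have "def_domain U \<phi> = def_domain U \<psi>" using assms by (auto simp: def_domain_def)
  moreover have "\<phi> p = \<psi> p" if "p \<in> def_domain U \<psi>" for p using that assms by (simp add: def_domain_def)
  ultimately show ?thesis by (simp add: induced_by_def)
qed

text \<open>Proportionality of \<open>P x\<close> and \<open>f z\<close> is the vanishing of the
  minors formed from their coordinates. The scalar \<open>c\<close> drops out of these, so they are
  holomorphic for any local lift, however \<open>c\<close> depends on \<open>z\<close>.\<close>

lemma induced_by_extend:
  fixes \<phi> :: "(complex ^ 'n::finite) set \<Rightarrow> (complex ^ 'm::finite) set"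
  assumes U: "openin proj_topology U" "connectedin proj_topology U"
    and \<phi>: "holomorphic_proj_map E U \<phi>" and E: "vec.subspace E"
    and P: "clinear P" and f: "clinear f" and nz: "f a \<noteq> 0"
    and S: "open S" "S \<noteq> {}" "S \<subseteq> proj_preimage U"
    and F: "\<And>z. z \<in> S \<Longrightarrow> \<phi> (vec.span {z}) = vec.span {F z} \<and> (\<exists>c. c \<noteq> 0 \<and> P (F z) = c *s f z)"
  shows "induced_by U (\<lambda>p. P ` \<phi> p) f"
proof -
  have minor: "f z $ i * P x $ j - f z $ j * P x $ i = 0" if z: "z \<in> proj_preimage U" "x \<in> \<phi> (vec.span {z})" for z x i j
  proof (rule proj_identity[OF U \<phi> E _ _ S _ z, of "\<lambda>z x. f z $ i * P x $ j - f z $ j * P x $ i"])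
    fix F :: "complex ^ 'n \<Rightarrow> complex ^ 'm" and D :: "(complex ^ 'n) set" assume *: "open D" "holomorphic_vec_on F D"
    have "line_holomorphic_on (\<lambda>z. hdot (f z) v) D" "line_holomorphic_on (\<lambda>z. hdot (P (F z)) v) D" for v
      using line_holomorphic_on_hdot[OF clinear_comp_holomorphic[OF P *(2)] *(1)]
        line_holomorphic_on_hdot[OF clinear_comp_holomorphic[OF f holomorphic_vec_on_ident] *(1)] by auto
    then show "line_holomorphic_on (\<lambda>z. f z $ i * P (F z) $ j - f z $ j * P (F z) $ i) D"
      unfolding line_holomorphic_on_def component_eq_hdot by (auto intro!: holomorphic_intros)
  next
    fix c d z x assume "f z $ i * P x $ j - f z $ j * P x $ i = 0"
    then show "f (c *s z) $ i * P (d *s x) $ j - f (c *s z) $ j * P (d *s x) $ i = 0"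
      unfolding vec.linear_scale[OF f] vec.linear_scale[OF P] vector_smult_component by algebra
  next
    fix z x assume z: "z \<in> S" and x: "x \<in> \<phi> (vec.span {z})"
    obtain c where c: "\<phi> (vec.span {z}) = vec.span {F z}" "P (F z) = c *s f z" using F[OF z] by blast
    then obtain d where "x = d *s F z" using x by (auto simp: vec.span_singleton)
    then have "P x = d *s (c *s f z)" by (simp only: vec.linear_scale[OF P] c(2))
    then show "f z $ i * P x $ j - f z $ j * P x $ i = 0" by simp
  qed
  \<comment> \<open>Supplies the point at which both sides are defined, as the first conjunct of
    \<open>induced_by\<close> demands.\<close>
  have "\<not> S \<subseteq> {z. f z = 0}"
    using subspace_eq_UNIV[OF vec.linear_subspace_kernel[OF f] S(1,2)] nz by blast
  then obtain z where z: "z \<in> S" "f z \<noteq> 0" by blast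
  obtain c where c: "\<phi> (vec.span {z}) = vec.span {F z}" "c \<noteq> 0" "P (F z) = c *s f z" using F[OF z(1)] by blast
  have "P ` \<phi> (vec.span {z}) \<noteq> {0}" "f ` vec.span {z} \<noteq> {0}"
  proof -
    have "P (F z) \<in> P ` \<phi> (vec.span {z})" unfolding c(1) by (intro imageI vec.span_base) simp
    moreover have "P (F z) \<noteq> 0" using c z by simp
    ultimately show "P ` \<phi> (vec.span {z}) \<noteq> {0}" by blast
    have "f z \<in> f ` vec.span {z}" by (intro imageI vec.span_base) simp
    then show "f ` vec.span {z} \<noteq> {0}" using z by blast
  qed
  moreover have "vec.span {z} \<in> U" using z(1) S(3) by (auto simp: proj_preimage_def)
  moreover have "P ` \<phi> p = f ` p" if p: "p \<in> U" "P ` \<phi> p \<noteq> {0}" "f ` p \<noteq> {0}" for p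
  proof -
    obtain z where z: "z \<in> proj_preimage U" "p = vec.span {z}" using ex_proj_preimage[OF U(1) p(1)] by blast
    obtain x where x: "\<phi> p = vec.span {x}" by (rule proj_map_value[OF \<phi> E p(1)])
    have im: "P ` \<phi> p = vec.span {P x}" "f ` p = vec.span {f z}"
      using clinear_image_span_singleton[OF P, of x] clinear_image_span_singleton[OF f, of z] x z(2) by auto
    have ne: "P x \<noteq> 0" "f z \<noteq> 0" using p(2,3) im by auto
    then obtain i where i: "f z $ i \<noteq> 0" by (auto simp: vec_eq_iff)
    have m: "f z $ i * P x $ j - f z $ j * P x $ i = 0" for j
      by (rule minor[OF z(1)]) (use z x in \<open>auto intro: vec.span_base\<close>)
    define c where "c = P x $ i / f z $ i"
    have eq: "P x = c *s f z"
      unfolding vec_eq_iff using m i by (auto simp: c_def field_simps)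
    then have "c \<noteq> 0" using ne by auto
    then show ?thesis unfolding im eq by (rule span_singleton_smult)
  qed
  ultimately show ?thesis
    unfolding induced_by_def def_domain_def
    by (intro conjI ballI impI bexI[of _ "vec.span {z}"]) (simp_all only: mem_Collect_eq simp_thms)
qed

section \<open>The forms of the statement and the conclusion\<close>

lemma dim_coord_space: "vec.dim (coord_space I) = card I"
proof (rule vec.dim_unique[of "(\<lambda>i. axis i 1) ` I"])
  show "(\<lambda>i. axis i 1) ` I \<subseteq> coord_space I" by (auto simp: coord_space_def axis_def)
  show "coord_space I \<subseteq> vec.span ((\<lambda>i. axis i 1) ` I)" using coord_space_span by blast
  show "vec.independent ((\<lambda>i. axis i 1) ` I)"
    by (rule vec.independent_mono[OF independent_cart_basis]) (auto simp: cart_basis_def)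
  show "card ((\<lambda>i. axis i (1::complex)) ` I) = card I"
    by (rule card_image) (auto simp: inj_on_def axis_eq_axis)
qed

lemma herm_form_eq_hdot:
  assumes "v \<in> coord_space Q"
  shows "herm_form Q {} v w = hdot v w"
  unfolding herm_form_def hdot_def using assms
  by (auto simp: coord_space_def intro!: sum.mono_neutral_left)

text \<open>Multiplication by the diagonal Gram matrix of the source form. Its kernel is the
  radical, and its rank is the r + s of the dimension count.\<close>

definition gram :: "'n::finite set \<Rightarrow> 'n set \<Rightarrow> complex ^ 'n \<Rightarrow> complex ^ 'n" where
  "gram P N v = (\<chi> i. if i \<in> P then v $ i else if i \<in> N then - v $ i else 0)"

lemma clinear_gram: "clinear (gram P N)"
  by (rule clinearI) (auto simp: gram_def vec_eq_iff)

lemma herm_form_eq_gram: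
  assumes "P \<inter> N = {}"
  shows "herm_form P N z w = hdot (gram P N z) w"
proof -
  have "hdot (gram P N z) w = (\<Sum>i\<in>UNIV. (if i \<in> P then z $ i * cnj (w $ i) else 0) - (if i \<in> N then z $ i * cnj (w $ i) else 0))"
    unfolding hdot_def gram_def using assms by (intro sum.cong) auto
  then show ?thesis by (simp add: herm_form_def sum_subtractf sum.If_cases)
qed

lemma gram_self_adjoint: "hdot (gram P N z) w = hdot z (gram P N w)"
  unfolding hdot_def gram_def by (intro sum.cong) auto

lemma range_gram: "P \<inter> N = {} \<Longrightarrow> range (gram P N) = coord_space (P \<union> N)"
proof (intro equalityI subsetI)
  fix v assume "P \<inter> N = {}" "v \<in> coord_space (P \<union> N)"
  then have "v = gram P N (gram P N v)" by (auto simp: gram_def coord_space_def vec_eq_iff)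
  then show "v \<in> range (gram P N)" by blast
qed (auto simp: gram_def coord_space_def)

text \<open>Rank at least 2 makes the complement of \<open>w\<close> larger than the radical. A
  radical point is moved slightly in a direction of that complement, which keeps it orthogonal to
  \<open>w\<close>.\<close>

lemma ex_orthogonal_nonradical:
  assumes "open S" "z \<in> S" "hdot (gram P N z) w = 0" and dim: "2 \<le> vec.dim (range (gram P N))"
  obtains z' where "z' \<in> S" "hdot (gram P N z') w = 0" "gram P N z' \<noteq> 0"
proof (cases "gram P N z = 0")
  case True
  have "\<exists>x. hdot (gram P N x) w = 0 \<and> gram P N x \<noteq> 0"
  proof (cases "gram P N w = 0")
    case True
    have "\<exists>x. gram P N x \<noteq> 0"
    proof (rule ccontr)
      assume "\<not> ?thesis"
      then have "range (gram P N) = {0}" by auto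
      then show False using dim by simp
    qed
    then show ?thesis using True by (auto simp: gram_self_adjoint)
  next
    case False
    \<comment> \<open>The number is the squared norm of \<open>gram P N w\<close>, so
      \<open>gram P N w\<close> is a direction transversal to the complement of
      \<open>w\<close>.\<close>
    then have "hdot (gram P N (gram P N w)) w \<noteq> 0" by (subst gram_self_adjoint) simp
    from ex_orthogonal_not_in_span[OF clinear_gram this, of 0] dim show ?thesis by auto
  qed
  then obtain x where x: "hdot (gram P N x) w = 0" "gram P N x \<noteq> 0" by blast
  obtain t where t: "z + t *s x \<in> S" "t \<noteq> 0" using ex_small_step[OF assms(1,2)] by blast
  then show thesis
    using that[of "z + t *s x"] True x by (auto simp: vec.linear_add[OF clinear_gram] vec.linear_scale[OF clinear_gram])
qed (use assms that in blast)

theorem theorem1p5: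
  fixes r s t n' :: nat
    and P N :: "'n::finite set" and Q :: "'m::finite set"
    and U :: "(complex ^ 'n) set set"
    and \<phi> \<psi> :: "(complex ^ 'n) set \<Rightarrow> (complex ^ 'm) set"
  assumes "P \<inter> N = {}" and "card P = r" and "card N = s" and "CARD('n) = r + s + t"
    and "card Q = n'"
    and "int n' \<le> 2 * (int r + int s) - 3"
    and "orthogonal_pair (herm_form P N) (coord_space Q) (herm_form Q {}) U \<phi> \<psi>"
    and "connectedin proj_topology U"
    and "\<exists>p\<in>U. \<exists>q\<in>U. perp (herm_form P N) p q"
  shows "quasi_standard_pair (herm_form P N) (coord_space Q) (herm_form Q {}) U \<phi> \<psi>
       \<or> null_pair (herm_form Q {}) U \<phi> \<psi>"
proof -
  define \<sigma> where "\<sigma> = gram P N"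
  define E where "E = coord_space Q"
  have E: "vec.subspace E" by (simp add: E_def subspace_coord_space)
  have \<sigma>: "clinear \<sigma>" by (simp add: \<sigma>_def clinear_gram)
  have BB: "herm_form P N z w = hdot (\<sigma> z) w" for z w using herm_form_eq_gram[OF assms(1)] by (simp add: \<sigma>_def)
  have dim: "vec.dim (range \<sigma>) = r + s"
    using assms(1-3) by (simp add: \<sigma>_def range_gram dim_coord_space card_Un_disjoint)
  have card: "card Q + 3 \<le> 2 * vec.dim (range \<sigma>)" unfolding dim assms(5) using assms(6) by presburger
  have U: "openin proj_topology U" "connectedin proj_topology U"
    and \<phi>: "holomorphic_proj_map E U \<phi>" and \<psi>: "holomorphic_proj_map E U \<psi>"
    and pair: "\<And>p q. \<lbrakk>p \<in> U; q \<in> U; perp (herm_form P N) p q\<rbrakk> \<Longrightarrow> perp (herm_form Q {}) (\<phi> p) (\<psi> q)"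
    using assms(7,8) by (auto simp: orthogonal_pair_def E_def)
  obtain p0 q0 where pq: "p0 \<in> U" "q0 \<in> U" "perp (herm_form P N) p0 q0" using assms(9) by blast
  obtain z0 w0 where zw: "z0 \<in> proj_preimage U" "p0 = vec.span {z0}" "w0 \<in> proj_preimage U" "q0 = vec.span {w0}"
    using ex_proj_preimage[OF U(1) pq(1)] ex_proj_preimage[OF U(1) pq(2)] by metis
  have zw0: "hdot (\<sigma> z0) w0 = 0"
    using pq(3) unfolding perp_def zw BB by (meson insertI1 vec.span_base)
  obtain D F where D: "open D" "z0 \<in> D" "D \<subseteq> proj_preimage U" "holomorphic_vec_on F D"
    "\<And>x. x \<in> D \<Longrightarrow> F x \<noteq> 0 \<and> F x \<in> E \<and> \<phi> (vec.span {x}) = vec.span {F x}"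
    using holomorphic_proj_map_lift[OF \<phi> E zw(1)] by blast
  obtain D' G where D': "open D'" "w0 \<in> D'" "D' \<subseteq> proj_preimage U" "holomorphic_vec_on G D'"
    "\<And>x. x \<in> D' \<Longrightarrow> G x \<noteq> 0 \<and> G x \<in> E \<and> \<psi> (vec.span {x}) = vec.span {G x}"
    using holomorphic_proj_map_lift[OF \<psi> E zw(3)] by blast
  \<comment> \<open>As \<open>card Q\<close> is non-negative, the bound alone forces the rank to be
    at least 2.\<close>
  have dim2: "2 \<le> vec.dim (range (gram P N))" using card by (simp add: \<sigma>_def)
  \<comment> \<open>The two points leave the radical in turn: \<open>w0\<close> moves while
    orthogonal to \<open>z0\<close>, then \<open>z0\<close> moves while orthogonal to the new
    \<open>w1\<close>. Since \<open>\<sigma> w1\<close> is nonzero, it is the transversal direction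
    in \<open>e\<close>.\<close>
  obtain w1 where w1: "w1 \<in> D'" "hdot (\<sigma> w1) z0 = 0" "\<sigma> w1 \<noteq> 0"
    using ex_orthogonal_nonradical[OF D'(1,2) _ dim2, of z0] zw0 gram_self_adjoint hdot_eq_0_commute
    unfolding \<sigma>_def by metis
  obtain z1 where z1: "z1 \<in> D" "hdot (\<sigma> z1) w1 = 0" "\<sigma> z1 \<noteq> 0"
    using ex_orthogonal_nonradical[OF D(1,2) _ dim2, of w1] w1(2) gram_self_adjoint hdot_eq_0_commute
    unfolding \<sigma>_def by metis
  have e: "hdot (\<sigma> (\<sigma> w1)) w1 \<noteq> 0" using w1(3) unfolding \<sigma>_def by (subst gram_self_adjoint) simp
  have orth: "hdot (F z) (G w) = 0" if "z \<in> D" "w \<in> D'" "hdot (\<sigma> z) w = 0" for z w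
  proof -
    have p: "perp (herm_form P N) (vec.span {z}) (vec.span {w})"
      using that(3) by (auto simp: perp_def BB vec.span_singleton vec.linear_scale[OF \<sigma>])
    have "vec.span {z} \<in> U" "vec.span {w} \<in> U" using that D(3) D'(3) by (auto simp: proj_preimage_def)
    from pair[OF this p] have "perp (herm_form Q {}) (vec.span {F z}) (vec.span {G w})"
      using D(5)[OF that(1)] D'(5)[OF that(2)] by simp
    then have "herm_form Q {} (F z) (G w) = 0" unfolding perp_def by (meson insertI1 vec.span_base)
    then show ?thesis using herm_form_eq_hdot D(5) that(1) by (metis E_def)
  qed
  have FQ: "\<And>z. z \<in> D \<Longrightarrow> F z \<in> coord_space Q \<and> F z \<noteq> 0"
    and GQ: "\<And>w. w \<in> D' \<Longrightarrow> G w \<in> coord_space Q \<and> G w \<noteq> 0"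
    using D(5) D'(5) by (auto simp: E_def)
  obtain S T where S: "open S" "S \<noteq> {}" "S \<subseteq> D" and T: "open T" "T \<noteq> {}" "T \<subseteq> D'"
    and ST: "(\<forall>z\<in>S. \<forall>w\<in>T. hdot (F z) (G w) = 0) \<or>
     (\<exists>p q. (\<forall>z\<in>S. p z \<noteq> 0) \<and> (\<forall>w\<in>T. q w \<noteq> 0) \<and>
        (\<forall>z\<in>S. \<forall>w\<in>T. hdot (F z) (G w) = p z * q w * hdot (\<sigma> z) w))"
    using dichotomy[OF \<sigma> D(1) D'(1) D(4) D'(4) orth FQ GQ card z1(1) w1(1) z1(2,3) e] by blast
  have SU: "S \<subseteq> proj_preimage U" and TU: "T \<subseteq> proj_preimage U" using S D T D' by auto
  have \<phi>S: "\<phi> (vec.span {z}) = vec.span {F z}" "F z \<in> E" if "z \<in> S" for z using D(5) S(3) that by auto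
  have \<psi>T: "\<psi> (vec.span {w}) = vec.span {G w}" "G w \<in> E" if "w \<in> T" for w using D'(5) T(3) that by auto
  have valE: "\<phi> p \<subseteq> E" "\<psi> p \<subseteq> E" if "p \<in> U" for p
    using proj_map_value[OF \<phi> E that] proj_map_value[OF \<psi> E that] by metis+
  show ?thesis
    using ST
  proof
    assume 0: "\<forall>z\<in>S. \<forall>w\<in>T. hdot (F z) (G w) = 0"
    have "hdot x y = 0" if "p \<in> U" "q \<in> U" "x \<in> \<phi> p" "y \<in> \<psi> q" for p q x y
    proof (rule null_extend[OF U \<phi> \<psi> E vec.linear_ident S(1,2) SU T(1,2) TU _ that])
      fix z w x y assume z: "z \<in> S" "x \<in> \<phi> (vec.span {z})" and w: "w \<in> T" "y \<in> \<psi> (vec.span {w})"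
      obtain c d where "x = c *s F z" "y = d *s G w"
        using z(2)[unfolded \<phi>S(1)[OF z(1)]] w(2)[unfolded \<psi>T(1)[OF w(1)]]
        unfolding vec.span_singleton by blast
      then show "hdot x y = 0" using 0 z(1) w(1) by simp
    qed
    then have "herm_form Q {} x y = 0" if "p \<in> U" "q \<in> U" "x \<in> \<phi> p" "y \<in> \<psi> q" for p q x y
      using that valE herm_form_eq_hdot unfolding E_def by (metis subsetD)
    then show ?thesis by (auto simp: null_pair_def def_domain_def perp_def)
  next
    assume "\<exists>p q. (\<forall>z\<in>S. p z \<noteq> 0) \<and> (\<forall>w\<in>T. q w \<noteq> 0) \<and>
        (\<forall>z\<in>S. \<forall>w\<in>T. hdot (F z) (G w) = p z * q w * hdot (\<sigma> z) w)"
    then obtain p q where p: "\<And>z. z \<in> S \<Longrightarrow> p z \<noteq> 0" and q: "\<And>w. w \<in> T \<Longrightarrow> q w \<noteq> 0"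
      and H: "\<And>z w. z \<in> S \<Longrightarrow> w \<in> T \<Longrightarrow> hdot (F z) (G w) = p z * q w * hdot (\<sigma> z) w" by blast
    \<comment> \<open>Homogeneous coordinates are free up to nonzero scalars, so \<open>p\<close>
      and \<open>q\<close> are absorbed; \<open>q\<close> is conjugated because \<open>hdot\<close>
      is antilinear on the right.\<close>
    define F' where "F' z = (1 / p z) *s F z" for z
    define G' where "G' w = (1 / cnj (q w)) *s G w" for w
    have FF': "F z = p z *s F' z" if "z \<in> S" for z using p[OF that] by (simp add: F'_def)
    have GG': "G w = cnj (q w) *s G' w" if "w \<in> T" for w using q[OF that] by (simp add: G'_def)
    have F'E: "F' z \<in> E" if "z \<in> S" for z unfolding F'_def by (rule vec.subspace_scale[OF E \<phi>S(2)[OF that]])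
    have G'E: "G' w \<in> E" if "w \<in> T" for w unfolding G'_def by (rule vec.subspace_scale[OF E \<psi>T(2)[OF that]])
    have F'G': "hdot (F' z) (G' w) = hdot (\<sigma> z) w" if "z \<in> S" "w \<in> T" for z w
      using H[OF that] p[OF that(1)] q[OF that(2)] by (simp add: F'_def G'_def)
    obtain V f g where V: "vec.subspace V" "V \<subseteq> E" and f: "clinear f" "range f \<subseteq> V"
      and g: "clinear g" "range g \<subseteq> V" and fg: "\<And>z w. hdot (f z) (g w) = hdot (\<sigma> z) w"
      and F'f: "\<And>z v. z \<in> S \<Longrightarrow> v \<in> V \<Longrightarrow> hdot (F' z - f z) v = 0"
      and G'g: "\<And>w v. w \<in> T \<Longrightarrow> v \<in> V \<Longrightarrow> hdot (G' w - g w) v = 0"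
      and W0: "\<And>z w. z \<in> S \<Longrightarrow> w \<in> T \<Longrightarrow> hdot (F' z - f z) (G' w - g w) = 0"
      using linear_decomposition[OF \<sigma> S(1,2) T(1,2) E F'E G'E F'G'] by blast
    obtain R where R: "clinear R" "\<And>x. R x \<in> V" "\<And>x v. v \<in> V \<Longrightarrow> hdot (x - R x) v = 0"
      "\<And>x y. y \<in> V \<Longrightarrow> (\<And>v. v \<in> V \<Longrightarrow> hdot (x - y) v = 0) \<Longrightarrow> R x = y"
      using hermitian_projection[OF V(1)] by blast
    \<comment> \<open>The target form is positive definite on \<open>E\<close>, so the complement of
      \<open>V\<close> in \<open>E\<close> is a direct one.\<close>
    define W where "W = {x \<in> E. \<forall>v\<in>V. hdot x v = 0}"
    have W: "vec.subspace W" using E unfolding vec.subspace_def W_def by auto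
    have RW: "x - R x \<in> W" if "x \<in> E" for x
      using vec.subspace_diff[OF E that subsetD[OF V(2) R(2)]] R(3) by (simp only: W_def mem_Collect_eq) blast
    have VW: "V \<inter> W = {0}"
      using vec.subspace_0[OF V(1)] vec.subspace_0[OF W] by (auto simp: W_def)
    have dec: "orthogonal_decomposition (herm_form Q {}) E V W"
      unfolding orthogonal_decomposition_def
    proof (intro conjI ballI V W VW)
      show "E = {v + w |v w. v \<in> V \<and> w \<in> W}"
      proof (intro equalityI subsetI)
        fix x assume "x \<in> E"
        then show "x \<in> {v + w |v w. v \<in> V \<and> w \<in> W}"
          using R(2)[of x] RW[of x] by (intro CollectI exI[of _ "R x"] exI[of _ "x - R x"]) simp
      qed (use V(2) vec.subspace_add[OF E] in \<open>auto simp: W_def\<close>)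
      show "herm_form Q {} v w = 0" if "v \<in> V" "w \<in> W" for v w
        using that V(2) herm_form_eq_hdot[of v Q w] hdot_eq_0_commute[of v w] by (auto simp: W_def E_def)
    qed
    have alongV: "proj_along V W x = R x" if "x \<in> E" for x
      unfolding proj_along_def
    proof (rule the_equality)
      show "R x \<in> V \<and> x - R x \<in> W" using R(2) RW that by blast
      show "v = R x" if "v \<in> V \<and> x - v \<in> W" for v
        using R(4)[of v x] that by (auto simp: W_def)
    qed
    have alongW: "proj_along W V x = x - R x" if "x \<in> E" for x
      unfolding proj_along_def
    proof (rule the_equality)
      show "x - R x \<in> W \<and> x - (x - R x) \<in> V" using R(2) RW that by simp
      show "w = x - R x" if "w \<in> W \<and> x - w \<in> V" for w
        using R(4)[of "x - w" x] that by (auto simp: W_def)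
    qed
    have RF: "R (F z) = p z *s f z" if "z \<in> S" for z
      unfolding FF'[OF that] vec.linear_scale[OF R(1)]
      using R(4)[of "f z" "F' z"] f(2) F'f[OF that] by auto
    have RG: "R (G w) = cnj (q w) *s g w" if "w \<in> T" for w
      unfolding GG'[OF that] vec.linear_scale[OF R(1)]
      using R(4)[of "g w" "G' w"] g(2) G'g[OF that] by auto
    \<comment> \<open>The pairing of \<open>f\<close> and \<open>g\<close> reproduces the source
      form, which is nonzero at this pair of points. This keeps both induced maps from being nowhere
      defined.\<close>
    have nzfg: "f (\<sigma> w1) \<noteq> 0" "g w1 \<noteq> 0" using fg[of "\<sigma> w1" w1] e by auto
    have imV: "proj_along V W ` \<phi> a = R ` \<phi> a" "proj_along V W ` \<psi> a = R ` \<psi> a" if "a \<in> U" for a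
      using valE[OF that] by (auto intro!: image_cong simp: alongV subset_iff)
    have ind: "induced_by U (\<lambda>p. R ` \<phi> p) f" "induced_by U (\<lambda>p. R ` \<psi> p) g"
    proof -
      show "induced_by U (\<lambda>p. R ` \<phi> p) f"
        by (rule induced_by_extend[OF U \<phi> E R(1) f(1) nzfg(1) S(1,2) SU, of F]) (use RF \<phi>S p in blast)
      show "induced_by U (\<lambda>p. R ` \<psi> p) g"
        by (rule induced_by_extend[OF U \<psi> E R(1) g(1) nzfg(2) T(1,2) TU, of G])
          (use RG \<psi>T q in \<open>metis complex_cnj_zero_iff\<close>)
    qed
    have ind': "induced_by U (\<lambda>p. proj_along V W ` \<phi> p) f" "induced_by U (\<lambda>p. proj_along V W ` \<psi> p) g"
      by (subst induced_by_cong[OF imV(1)], assumption, rule ind(1))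
        (subst induced_by_cong[OF imV(2)], assumption, rule ind(2))
    \<comment> \<open>The conformal factor is 1, because the scalars went into \<open>F'\<close> and
      \<open>G'\<close>.\<close>
    have B': "herm_form Q {} (f z) (g w) = of_real 1 * herm_form P N z w" for z w
      using herm_form_eq_hdot[of "f z" Q "g w"] f(2) V(2) fg by (auto simp: E_def BB)
    have std: "standard_pair (herm_form P N) V (herm_form Q {}) U
        (\<lambda>p. proj_along V W ` \<phi> p) (\<lambda>p. proj_along V W ` \<psi> p)"
      unfolding standard_pair_def
      by (intro exI[of _ f] exI[of _ g] exI[of _ 1] conjI f g ind' allI B') simp
    \<comment> \<open>On \<open>S\<close> and \<open>T\<close> the components in \<open>W\<close>
      are scalar multiples of \<open>F' z - f z\<close> and \<open>G' w - g w\<close>, which are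
      orthogonal by \<open>W0\<close>; being given by a linear map, they can be fed to
      \<open>null_extend\<close>.\<close>
    have "clinear (\<lambda>x. x - R x)" by (intro vec.module_hom_sub vec.linear_ident R(1))
    then have W0': "hdot (x - R x) (y - R y) = 0" if "a \<in> U" "b \<in> U" "x \<in> \<phi> a" "y \<in> \<psi> b" for a b x y
    proof (rule null_extend[OF U \<phi> \<psi> E _ S(1,2) SU T(1,2) TU _ that])
      fix z w x y assume z: "z \<in> S" "x \<in> \<phi> (vec.span {z})" and w: "w \<in> T" "y \<in> \<psi> (vec.span {w})"
      obtain c d where c: "x = c *s F z" and d: "y = d *s G w"
        using z(2)[unfolded \<phi>S(1)[OF z(1)]] w(2)[unfolded \<psi>T(1)[OF w(1)]]
        unfolding vec.span_singleton by blast
      have "x - R x = (c * p z) *s (F' z - f z)"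
        unfolding c vec.linear_scale[OF R(1)] RF[OF z(1)]
        by (subst FF'[OF z(1)]) (simp only: vec.scale_right_diff_distrib vec.scale_scale)
      moreover have "y - R y = (d * cnj (q w)) *s (G' w - g w)"
        unfolding d vec.linear_scale[OF R(1)] RG[OF w(1)]
        by (subst GG'[OF w(1)]) (simp only: vec.scale_right_diff_distrib vec.scale_scale)
      ultimately show "hdot (x - R x) (y - R y) = 0"
        using W0[OF z(1) w(1)] by (simp only: hdot_simps(5,6)) simp
    qed
    have "null_pair (herm_form Q {}) U (\<lambda>p. proj_along W V ` \<phi> p) (\<lambda>p. proj_along W V ` \<psi> p)"
      unfolding null_pair_def perp_def
    proof (intro ballI)
      fix a b v w
      assume a: "a \<in> def_domain U (\<lambda>p. proj_along W V ` \<phi> p)" "v \<in> proj_along W V ` \<phi> a"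
        and b: "b \<in> def_domain U (\<lambda>p. proj_along W V ` \<psi> p)" "w \<in> proj_along W V ` \<psi> b"
      then have ab: "a \<in> U" "b \<in> U" by (auto simp: def_domain_def)
      obtain x y where xy: "x \<in> \<phi> a" "y \<in> \<psi> b" "v = proj_along W V x" "w = proj_along W V y" using a b by blast
      then have "x \<in> E" "y \<in> E" using valE ab by blast+
      then have vw: "v = x - R x" "w = y - R y" using xy alongW by auto
      then have "v \<in> coord_space Q" using RW[OF \<open>x \<in> E\<close>] by (simp add: W_def E_def)
      then show "herm_form Q {} v w = 0" using W0'[OF ab xy(1,2)] herm_form_eq_hdot vw by metis
    qed
    then show ?thesis
      using std dec unfolding quasi_standard_pair_def E_def by blast
  qed
qed

end
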